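(* Let $X$ be the homogeneous diffusion with coefficients $a,b$ described in the context, and assume $\Phi(0,+\infty)<+\infty$ and $\Phi(0,-\infty)=-\infty$. Let $f:\mathbb{R}\to\mathbb{R}$ be a measurable function such that $f$ and $f/a^2$ are locally integrable, and assume that $$P_0=2\sup_{x\in\mathbb{R}}\left(\int_x^{+\infty}\frac{|f(u)|}{a(u)^2}\Phi(u,+\infty)\,du+\Phi(x,+\infty)\int_{-\infty}^x\frac{|f(u)|}{a(u)^2}\varphi(u,x)\,du\right)<\infty.$$ Then the integral functional $J_\infty(f)$ has a bounded potential $P=\sup_{x\in\mathbb{R}}\mathsf{E}\left[J^x_\infty(f)\right]<\infty$, and $P\le P_0$.
   Context: On a complete filtered probability space $(\Omega,\mathcal{F},\{\mathcal{F}_t\}_{t\ge0},\mathsf{P})$ with a standard $\mathcal{F}_t$-Wiener process $W$, consider the family $\{X^x_t,\,t\ge 0,\,x\in\mathbb{R}\}$ of one-dimensional homogeneous diffusion processes $$dX^x_t=b(X^x_t)\,dt+a(X^x_t)\,dW_t,\quad t\ge 0,\qquad X_0^x=x.$$ The coefficients $a,b:\mathbb{R}\to\mathbb{R}$ are continuous, $a(x)\ne 0$ for all $x\in\mathbb{R}$, and they are such that a non-explosive weak solution on $\mathbb{R}$ exists. Define $\varphi(x_0,x)=\exp\left\{-2\int_{x_0}^{x}\frac{b(u)}{a(u)^2}\,du\right\}$ and $\Phi(x_0,x)=\int_{x_0}^x\varphi(x_0,z)\,dz$ for $x_0,x\in\mathbb{R}$, and $\Phi(x_0,\pm\infty)=\lim_{x\to\pm\infty}\Phi(x_0,x)$.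 Integral functional: $J^x_\infty(f)=\int_0^\infty f(X^x_s)\,ds$. The functional $J_\infty(f)$ is said to have a bounded potential $P$ if $P=\sup_{x\in\mathbb{R}}\mathsf{E}[J^x_\infty(f)]<\infty$. *)

theory Defs
  imports "HOL-Probability.Probability"
begin

section \<open>Filtered probability spaces and Wiener processes\<close>

text \<open>Time is \<open>real\<close>; only the indices \<open>t \<ge> 0\<close> of a filtration or a process are meaningful.
  Completeness means that \<open>M\<close> is complete and that every null set belongs to \<open>F 0\<close>;
  right-continuity of the filtration is not required.\<close>

definition complete_filtered_prob_space :: "'a measure \<Rightarrow> (real \<Rightarrow> 'a measure) \<Rightarrow> bool" where
  "complete_filtered_prob_space M F \<longleftrightarrow>
     prob_space M \<and> complete_measure M \<and>
     (\<forall>t\<ge>0. subalgebra M (F t)) \<and>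
     (\<forall>s t. 0 \<le> s \<longrightarrow> s \<le> t \<longrightarrow> sets (F s) \<subseteq> sets (F t)) \<and>
     null_sets M \<subseteq> sets (F 0)"

definition continuous_adapted :: "'a measure \<Rightarrow> (real \<Rightarrow> 'a measure) \<Rightarrow> (real \<Rightarrow> 'a \<Rightarrow> real) \<Rightarrow> bool" where
  "continuous_adapted M F Y \<longleftrightarrow>
     (\<forall>t\<ge>0. Y t \<in> borel_measurable (F t)) \<and>
     (\<forall>\<omega>\<in>space M. continuous_on {0..} (\<lambda>t. Y t \<omega>))"

definition wiener_process :: "'a measure \<Rightarrow> (real \<Rightarrow> 'a measure) \<Rightarrow> (real \<Rightarrow> 'a \<Rightarrow> real) \<Rightarrow> bool" where
  "wiener_process M F W \<longleftrightarrow>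
     continuous_adapted M F W \<and>
     (AE \<omega> in M. W 0 \<omega> = 0) \<and>
     (\<forall>s t. 0 \<le> s \<longrightarrow> s < t \<longrightarrow>
        distributed M lborel (\<lambda>\<omega>. W t \<omega> - W s \<omega>) (\<lambda>y. ennreal (normal_density 0 (sqrt (t - s)) y)) \<and>
        prob_space.indep_set M (sets (F s))
          (sets (vimage_algebra (space M) (\<lambda>\<omega>. W t \<omega> - W s \<omega>) borel)))"


section \<open>The Ito integral\<close>

text \<open>An entry \<open>(s, t, \<xi>)\<close> of the list stands for the elementary process
  \<open>\<xi> 1\<^bsub>(s,t]\<^esub>\<close>; the list stands for the sum of its entries. The intervals may overlap, which
  gives the same class of processes as disjoint intervals.\<close>

type_synonym 'a simple = "(real \<times> real \<times> ('a \<Rightarrow> real)) list"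

definition simple_process :: "'a measure \<Rightarrow> (real \<Rightarrow> 'a measure) \<Rightarrow> 'a simple \<Rightarrow> bool" where
  "simple_process M F S \<longleftrightarrow>
     (\<forall>(s, t, \<xi>) \<in> set S. 0 \<le> s \<and> s \<le> t \<and> \<xi> \<in> borel_measurable (F s) \<and>
        (\<exists>C. \<forall>\<omega>\<in>space M. \<bar>\<xi> \<omega>\<bar> \<le> C))"

definition simple_value :: "'a simple \<Rightarrow> real \<Rightarrow> 'a \<Rightarrow> real" where
  "simple_value S u \<omega> = (\<Sum>(s, t, \<xi>) \<leftarrow> S. \<xi> \<omega> * indicator {s<..t} u)"

definition simple_integral :: "(real \<Rightarrow> 'a \<Rightarrow> real) \<Rightarrow> 'a simple \<Rightarrow> real \<Rightarrow> 'a \<Rightarrow> real" where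
  "simple_integral W S T \<omega> = (\<Sum>(s, t, \<xi>) \<leftarrow> S. \<xi> \<omega> * (W (min t T) \<omega> - W (min s T) \<omega>))"

definition tendsto_zero_in_prob :: "'a measure \<Rightarrow> (nat \<Rightarrow> 'a \<Rightarrow> ennreal) \<Rightarrow> bool" where
  "tendsto_zero_in_prob M Z \<longleftrightarrow>
     (\<forall>k. Z k \<in> borel_measurable M) \<and>
     (\<forall>\<epsilon>>0::real. (\<lambda>k. measure M {\<omega>\<in>space M. ennreal \<epsilon> < Z k \<omega>}) \<longlonglongrightarrow> 0)"

definition progressively_measurable :: "(real \<Rightarrow> 'a measure) \<Rightarrow> (real \<Rightarrow> 'a \<Rightarrow> real) \<Rightarrow> bool" where
  "progressively_measurable F H \<longleftrightarrow>
     (\<forall>T\<ge>0. (\<lambda>(s, \<omega>). H s \<omega>) \<in> borel_measurable (restrict_space borel {0..T} \<Otimes>\<^sub>M F T))"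

text \<open>\<open>ito_integral M F W H Y\<close>: the process \<open>Y\<close> is (a continuous version of) the integral
  \<open>\<integral>\<^sub>0\<^sup>t H\<^sub>s dW\<^sub>s\<close>, where \<open>H\<close> is progressively measurable with almost surely locally
  square integrable paths. The integral is the limit in probability of the integrals of simple
  processes approximating \<open>H\<close>; it determines \<open>Y\<close> up to indistinguishability.\<close>

definition ito_integral ::
  "'a measure \<Rightarrow> (real \<Rightarrow> 'a measure) \<Rightarrow> (real \<Rightarrow> 'a \<Rightarrow> real) \<Rightarrow> (real \<Rightarrow> 'a \<Rightarrow> real) \<Rightarrow> (real \<Rightarrow> 'a \<Rightarrow> real) \<Rightarrow> bool"
  where
  "ito_integral M F W H Y \<longleftrightarrow>
     progressively_measurable F H \<and>
     (AE \<omega> in M. \<forall>T\<ge>0. (\<integral>\<^sup>+s\<in>{0..T}. ennreal ((H s \<omega>)\<^sup>2) \<partial>lborel) < \<infinity>) \<and>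
     continuous_adapted M F Y \<and>
     (\<exists>S :: nat \<Rightarrow> 'a simple.
        (\<forall>k. simple_process M F (S k)) \<and>
        (\<forall>T\<ge>0.
           tendsto_zero_in_prob M
             (\<lambda>k \<omega>. \<integral>\<^sup>+s\<in>{0..T}. ennreal ((simple_value (S k) s \<omega> - H s \<omega>)\<^sup>2) \<partial>lborel) \<and>
           tendsto_zero_in_prob M
             (\<lambda>k \<omega>. ennreal \<bar>simple_integral W (S k) T \<omega> - Y T \<omega>\<bar>)))"


section \<open>Diffusions\<close>

text \<open>\<open>X\<close> satisfies \<open>dX = b(X) dt + a(X) dW\<close>, \<open>X\<^sub>0 = x\<close>. Non-explosion is built in:
  the paths are real-valued and continuous on all of \<open>[0, \<infinity>)\<close>.\<close>

definition sde_solution ::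
  "'a measure \<Rightarrow> (real \<Rightarrow> 'a measure) \<Rightarrow> (real \<Rightarrow> 'a \<Rightarrow> real) \<Rightarrow> (real \<Rightarrow> real) \<Rightarrow> (real \<Rightarrow> real) \<Rightarrow>
   real \<Rightarrow> (real \<Rightarrow> 'a \<Rightarrow> real) \<Rightarrow> bool" where
  "sde_solution M F W a b x X \<longleftrightarrow>
     continuous_adapted M F X \<and>
     (AE \<omega> in M. \<forall>t\<ge>0. set_integrable lborel {0..t} (\<lambda>s. b (X s \<omega>))) \<and>
     (\<exists>Y. ito_integral M F W (\<lambda>s \<omega>. a (X s \<omega>)) Y \<and>
        (AE \<omega> in M. \<forall>t\<ge>0. X t \<omega> = x + (LBINT s:{0..t}. b (X s \<omega>)) + Y t \<omega>))"

definition phi :: "(real \<Rightarrow> real) \<Rightarrow> (real \<Rightarrow> real) \<Rightarrow> real \<Rightarrow> real \<Rightarrow> real" where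
  "phi a b x0 x = exp (- 2 * (LBINT u=ereal x0..ereal x. b u / (a u)\<^sup>2))"

definition Phi :: "(real \<Rightarrow> real) \<Rightarrow> (real \<Rightarrow> real) \<Rightarrow> real \<Rightarrow> real \<Rightarrow> real" where
  "Phi a b x0 x = (LBINT z=ereal x0..ereal x. phi a b x0 z)"

definition Phi_at_top :: "(real \<Rightarrow> real) \<Rightarrow> (real \<Rightarrow> real) \<Rightarrow> real \<Rightarrow> ereal" where
  "Phi_at_top a b x0 = Lim at_top (\<lambda>x. ereal (Phi a b x0 x))"

definition Phi_at_bot :: "(real \<Rightarrow> real) \<Rightarrow> (real \<Rightarrow> real) \<Rightarrow> real \<Rightarrow> ereal" where
  "Phi_at_bot a b x0 = Lim at_bot (\<lambda>x. ereal (Phi a b x0 x))"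


section \<open>Integral functionals and their potentials\<close>

definition locally_integrable :: "(real \<Rightarrow> real) \<Rightarrow> bool" where
  "locally_integrable f \<longleftrightarrow> (\<forall>K. compact K \<longrightarrow> set_integrable lborel K f)"

definition J_infty :: "(real \<Rightarrow> real) \<Rightarrow> (real \<Rightarrow> 'a \<Rightarrow> real) \<Rightarrow> 'a \<Rightarrow> real" where
  "J_infty f X \<omega> = (LBINT s:{0..}. f (X s \<omega>))"

definition potential :: "'a measure \<Rightarrow> (real \<Rightarrow> real \<Rightarrow> 'a \<Rightarrow> real) \<Rightarrow> (real \<Rightarrow> real) \<Rightarrow> ereal" where
  "potential M X f = (SUP x. ereal (\<integral>\<omega>. J_infty f (X x) \<omega> \<partial>M))"

text \<open>The Bochner integral of a non-integrable function is \<open>0\<close>, so the existence of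
  \<open>J\<^sub>\<infinity>\<close> and of its expectation is part of the definition.\<close>

definition has_bounded_potential :: "'a measure \<Rightarrow> (real \<Rightarrow> real \<Rightarrow> 'a \<Rightarrow> real) \<Rightarrow> (real \<Rightarrow> real) \<Rightarrow> bool" where
  "has_bounded_potential M X f \<longleftrightarrow>
     (\<forall>x. (AE \<omega> in M. set_integrable lborel {0..} (\<lambda>s. f (X x s \<omega>))) \<and>
          integrable M (J_infty f (X x))) \<and>
     potential M X f < \<infinity>"

definition potential_bound :: "(real \<Rightarrow> real) \<Rightarrow> (real \<Rightarrow> real) \<Rightarrow> (real \<Rightarrow> real) \<Rightarrow> ennreal" where
  "potential_bound a b f = 2 * (SUP x.
     (\<integral>\<^sup>+u\<in>{x..}. ennreal (\<bar>f u\<bar> / (a u)\<^sup>2) * e2ennreal (Phi_at_top a b u) \<partial>lborel) +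
     e2ennreal (Phi_at_top a b x) *
       (\<integral>\<^sup>+u\<in>{..x}. ennreal (\<bar>f u\<bar> / (a u)\<^sup>2 * phi a b u x) \<partial>lborel))"

end

theory Submission
  imports Defs
begin

text \<open>
  For a continuous \<open>g \<ge> 0\<close> with compact support the function \<open>u(x) = \<integral> g(v) G(x,v) dv\<close>, where
  \<open>G(x,v) = (2 / a(v)\<^sup>2) \<integral>\<^bsub>max x v\<^esub>\<^sup>\<infinity> \<phi>(v,z) dz\<close>, is nonnegative, twice continuously differentiable and
  satisfies \<open>b u' + (a\<^sup>2 / 2) u'' = -g\<close>. By Ito's formula \<open>u(X\<^sub>t) + \<integral>\<^sub>0\<^sup>t g(X\<^sub>s) ds\<close> is a supermartingale,
  so \<open>E \<integral>\<^sub>0\<^sup>t g(X\<^sub>s) ds \<le> u(x)\<close>. Hence the occupation measure of \<open>X\<close> is at most \<open>G(x,v) dv\<close>, and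
  integrating \<open>\<bar>f\<bar>\<close> against \<open>G(x,v) dv\<close> gives the expression in \<open>P\<^sub>0\<close>.

  Stopping times are avoided. The integrand of the Ito integral is replaced by simple processes \<open>S\<close>, for which
  the generator inequality is a second order Taylor expansion with Gaussian increments, and the process
  is killed at rate \<open>L \<bar>S\<^sup>2 - a(X)\<^sup>2\<bar> + \<kappa>(X)\<close>. For a test function bounded away from \<open>0\<close> and a large
  constant \<open>L\<close> the first term dominates the second order error made by \<open>S\<close>, and the second term dominates
  the generator far out, so that Fatou's lemma applies when \<open>S\<close> tends to \<open>a(X)\<close>.
\<close>


section \<open>Calculus on the line\<close>

text \<open>The Ito integral is given only as a limit in probability of elementary integrals, so no
  moment of \<open>S\<close> is bounded uniformly along the approximation. The killing replaces such
  bounds: when \<open>\<bar>h''\<bar> \<le> 2 * L * h\<close>, the term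
  \<open>L * \<bar>S^2 - a(X)^2\<bar> * h\<close> absorbs \<open>h'' * (S^2 - a(X)^2) / 2\<close>
  whatever the size of \<open>S\<close>. Both killing terms disappear again, the first because the
  time integral of \<open>\<bar>S^2 - a(X)^2\<bar>\<close> tends to 0 along the approximation, the
  second because a continuous path stays in a bounded set up to time \<open>T\<close>. The order of
  the limits is forced: the mesh of the time partition at fixed \<open>S\<close>; then
  \<open>S\<close>; then the radius beyond which killing acts; then the constant
  \<open>\<epsilon>\<close> added to \<open>u\<close>, on which \<open>L\<close> depends; then
  \<open>T\<close>. Only inequalities are needed, so the nonnegative terminal term is dropped at
  once. Measures are compared at the end because Ito's formula says nothing about a merely
  measurable function.\<close>

lemma additive_interval_induct:
  fixes T \<delta> :: real and Q :: "real \<Rightarrow> real \<Rightarrow> bool"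
  assumes "finite B" and "0 < \<delta>"
    and add: "\<And>s t v. 0 \<le> s \<Longrightarrow> s < t \<Longrightarrow> t < v \<Longrightarrow> v \<le> T \<Longrightarrow> Q s t \<Longrightarrow> Q t v \<Longrightarrow> Q s v"
    and small: "\<And>s t. 0 \<le> s \<Longrightarrow> s < t \<Longrightarrow> t \<le> T \<Longrightarrow> t - s \<le> \<delta> \<Longrightarrow> B \<inter> {s<..<t} = {} \<Longrightarrow> Q s t"
    and "0 \<le> s" "s < t" "t \<le> T"
  shows "Q s t"
proof -
  \<comment> \<open>Two inductions: here on the number \<open>n\<close> of steps of length
    \<open>\<delta>\<close> that cover an interval free of points of \<open>B\<close>, below on the
    number of points of \<open>B\<close> strictly inside the interval, splitting at one of
    them.\<close>
  have nobreak: "Q s t" if "0 \<le> s" "s < t" "t \<le> T" "B \<inter> {s<..<t} = {}" "t - s \<le> real n * \<delta>" for n s t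
    using that
  proof (induction n arbitrary: s)
    case (Suc n)
    show ?case
    proof (cases "t - s \<le> \<delta>")
      case True
      then show ?thesis using Suc.prems small by blast
    next
      case False
      have "Q s (s + \<delta>)"
        using Suc.prems False \<open>0 < \<delta>\<close> by (intro small) auto
      moreover have "Q (s + \<delta>) t"
        using Suc.prems False \<open>0 < \<delta>\<close> by (intro Suc.IH) (auto simp: algebra_simps)
      ultimately show ?thesis
        using Suc.prems False \<open>0 < \<delta>\<close> by (intro add[of s "s + \<delta>" t]) auto
    qed
  qed simp
  have nobreak': "Q s t" if st: "0 \<le> s" "s < t" "t \<le> T" "B \<inter> {s<..<t} = {}" for s t
  proof -
    obtain n where "(t - s) / \<delta> \<le> real n" using real_arch_simple by blast
    then have "t - s \<le> real n * \<delta>" using \<open>0 < \<delta>\<close> by (simp add: field_simps)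
    then show ?thesis using nobreak st by blast
  qed
  have "Q s t" if "0 \<le> s" "s < t" "t \<le> T" for s t
    using that
  proof (induction "card (B \<inter> {s<..<t})" arbitrary: s t rule: less_induct)
    case less
    show ?case
    proof (cases "B \<inter> {s<..<t} = {}")
      case False
      then obtain r where r: "r \<in> B" "s < r" "r < t" by auto
      have "B \<inter> {s<..<r} \<subset> B \<inter> {s<..<t}" "B \<inter> {r<..<t} \<subset> B \<inter> {s<..<t}"
        using r by auto
      then have "card (B \<inter> {s<..<r}) < card (B \<inter> {s<..<t})"
        "card (B \<inter> {r<..<t}) < card (B \<inter> {s<..<t})"
        using \<open>finite B\<close> by (auto intro!: psubset_card_mono)
      then have "Q s r" "Q r t" using less r by auto
      then show ?thesis using add less.prems r by blast
    qed (use less nobreak' in auto)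
  qed
  then show ?thesis using assms by blast
qed

text \<open>The modulus of continuity enters as \<open>\<eta> + K * d^2\<close> instead of as a
  limit statement: the remainder is then a polynomial in the displacement, and under a Gaussian
  increment its expectation needs only the second and fourth moments.\<close>

lemma taylor2_bound:
  fixes h h' h'' :: "real \<Rightarrow> real"
  assumes h: "\<And>y. (h has_real_derivative h' y) (at y)"
    and h': "\<And>y. (h' has_real_derivative h'' y) (at y)"
    and mod: "\<And>p q. \<bar>h'' q - h'' p\<bar> \<le> \<eta> + K * (q - p)\<^sup>2" and K: "0 \<le> K"
  shows "h (p + d) \<le> h p + h' p * d + h'' p * d\<^sup>2 / 2 + (\<eta> + K * d\<^sup>2) * d\<^sup>2 / 2"
proof (cases "d = 0")
  case False
  define diff where "diff = (\<lambda>m::nat. if m = 0 then h else if m = 1 then h' else h'')"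
  have D: "\<forall>m t. m < 2 \<and> min p (p+d) \<le> t \<and> t \<le> max p (p+d) \<longrightarrow> DERIV (diff m) t :> diff (Suc m) t"
    using h h' by (auto simp: diff_def less_2_cases_iff)
  have "\<exists>t. (if p + d < p then p + d < t \<and> t < p else p < t \<and> t < p + d) \<and>
      h (p + d) = (\<Sum>m<2. (diff m p / fact m) * (p + d - p)^m) + (diff 2 t / fact 2) * (p + d - p)^2"
    by (rule Taylor[where a = "min p (p+d)" and b = "max p (p+d)"]) (use D False in \<open>auto simp: diff_def\<close>)
  then obtain t where t': "if p + d < p then p + d < t \<and> t < p else p < t \<and> t < p + d"
    and eq: "h (p + d) = (\<Sum>m<2. (diff m p / fact m) * d^m) + (diff 2 t / fact 2) * d^2"
    by auto
  have t: "\<bar>t - p\<bar> \<le> \<bar>d\<bar>" using t' by (auto split: if_splits)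
  have "h (p + d) = h p + h' p * d + h'' t * d\<^sup>2 / 2"
    unfolding eq by (simp add: diff_def lessThan_Suc numeral_2_eq_2)
  moreover have "(t - p)\<^sup>2 \<le> d\<^sup>2" using t by (simp add: abs_le_square_iff)
  then have "K * (t - p)\<^sup>2 \<le> K * d\<^sup>2" using K mult_left_mono by blast
  then have "h'' t \<le> h'' p + (\<eta> + K * d\<^sup>2)"
    using mod[of t p] by linarith
  then have "h'' t * d\<^sup>2 \<le> (h'' p + (\<eta> + K * d\<^sup>2)) * d\<^sup>2"
    by (intro mult_right_mono) auto
  ultimately show ?thesis by (simp add: algebra_simps add_divide_distrib)
qed simp

text \<open>Below the distance \<open>d\<close> of uniform continuity the oscillation is less than
  \<open>\<eta>\<close>; beyond it the trivial bound \<open>2 * B\<close> is at most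
  \<open>K * (q - p)^2\<close> once \<open>K\<close> reaches \<open>2 * B / d^2\<close>. Every
  larger \<open>K\<close> works too, so several functions can share one constant.\<close>

lemma uniformly_continuous_bounded_modulus:
  fixes f :: "real \<Rightarrow> real"
  assumes "uniformly_continuous_on UNIV f" "\<And>x. \<bar>f x\<bar> \<le> B" "0 < \<eta>"
  shows "\<exists>K0. \<forall>K\<ge>K0. \<forall>p q. \<bar>f q - f p\<bar> \<le> \<eta> + K * (q - p)\<^sup>2"
proof -
  obtain d where d: "0 < d" "\<And>p q. \<bar>q - p\<bar> < d \<Longrightarrow> \<bar>f q - f p\<bar> < \<eta>"
    using assms(1,3) unfolding uniformly_continuous_on_def dist_real_def by blast
  have B: "0 \<le> B" using assms(2)[of 0] by linarith
  show ?thesis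
  proof (intro exI allI impI)
    fix K p q assume K: "2 * B / d\<^sup>2 \<le> K"
    have "0 \<le> 2 * B / d\<^sup>2" using B by simp
    then have K0: "0 \<le> K" using K by linarith
    show "\<bar>f q - f p\<bar> \<le> \<eta> + K * (q - p)\<^sup>2"
    proof (cases "\<bar>q - p\<bar> < d")
      case True
      have "0 \<le> K * (q - p)\<^sup>2" using K0 by simp
      then show ?thesis using d(2)[OF True] by linarith
    next
      case False
      then have "d\<^sup>2 \<le> (q - p)\<^sup>2" using d(1) by (simp add: abs_le_square_iff[symmetric])
      then have "(2 * B / d\<^sup>2) * d\<^sup>2 \<le> K * (q - p)\<^sup>2"
        using K K0 B d by (intro mult_mono) auto
      then have "2 * B \<le> K * (q - p)\<^sup>2" using d by simp
      moreover have "\<bar>f q - f p\<bar> \<le> 2 * B" using assms(2)[of q] assms(2)[of p] by linarith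
      ultimately show ?thesis using assms(3) by linarith
    qed
  qed
qed

section \<open>Filtrations and Wiener increments\<close>

locale filtered_wiener =
  fixes M :: "'a measure" and F :: "real \<Rightarrow> 'a measure" and W :: "real \<Rightarrow> 'a \<Rightarrow> real"
  assumes filtered: "complete_filtered_prob_space M F" and wiener: "wiener_process M F W"

sublocale filtered_wiener \<subseteq> prob_space M
  using filtered by (simp add: complete_filtered_prob_space_def)

context filtered_wiener
begin

lemma space_F [simp]: "0 \<le> t \<Longrightarrow> space (F t) = space M"
  and sets_F_M: "0 \<le> t \<Longrightarrow> sets (F t) \<subseteq> sets M"
  using filtered by (auto simp: complete_filtered_prob_space_def subalgebra_def)

lemma sets_F_mono: "0 \<le> s \<Longrightarrow> s \<le> t \<Longrightarrow> sets (F s) \<subseteq> sets (F t)"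
  using filtered by (auto simp: complete_filtered_prob_space_def)

lemma measurable_F_mono: "0 \<le> s \<Longrightarrow> s \<le> t \<Longrightarrow> f \<in> measurable (F s) N \<Longrightarrow> f \<in> measurable (F t) N"
  by (rule measurable_mono[THEN subsetD, of N N "F s" "F t"]) (auto dest: sets_F_mono)

lemma measurable_F_M: "0 \<le> s \<Longrightarrow> f \<in> measurable (F s) N \<Longrightarrow> f \<in> measurable M N"
  by (rule measurable_mono[THEN subsetD, of N N "F s" M]) (auto dest: sets_F_M)

lemma W_adapted: "continuous_adapted M F W"
  using wiener by (simp add: wiener_process_def)

lemma W_measurable_F: "0 \<le> t \<Longrightarrow> W t \<in> borel_measurable (F t)"
  using W_adapted by (simp add: continuous_adapted_def)

lemma W_measurable: "0 \<le> t \<Longrightarrow> W t \<in> borel_measurable M"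
  using W_measurable_F measurable_F_M by blast

lemma W_increment_distributed:
  assumes "0 \<le> s" "s < t"
  shows "distributed M lborel (\<lambda>\<omega>. W t \<omega> - W s \<omega>) (\<lambda>y. ennreal (normal_density 0 (sqrt (t - s)) y))"
  using wiener assms by (simp add: wiener_process_def)

lemma W_increment_power_integrable:
  assumes "0 \<le> s" "s < t"
  shows "integrable M (\<lambda>\<omega>. (W t \<omega> - W s \<omega>) ^ k)"
proof -
  have "integrable lborel (\<lambda>x. normal_density 0 (sqrt (t - s)) x * x ^ k)"
    using integrable_normal_moment[of "sqrt (t - s)" 0 k] assms by simp
  then show ?thesis
    by (subst (asm) distributed_integrable[OF W_increment_distributed[OF assms]]) auto
qed

lemma W_increment_moments:
  assumes "0 \<le> s" "s < t"
  shows "expectation (\<lambda>\<omega>. W t \<omega> - W s \<omega>) = 0"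
    and "expectation (\<lambda>\<omega>. (W t \<omega> - W s \<omega>)\<^sup>2) = t - s"
    and "expectation (\<lambda>\<omega>. (W t \<omega> - W s \<omega>) ^ 4) = 3 * (t - s)\<^sup>2"
proof -
  have \<sigma>: "0 < sqrt (t - s)" using assms by simp
  have E: "expectation (\<lambda>\<omega>. (W t \<omega> - W s \<omega>) ^ k) = (\<integral>x. normal_density 0 (sqrt (t - s)) x * x ^ k \<partial>lborel)" for k
    by (rule distributed_integral[OF W_increment_distributed[OF assms], symmetric]) auto
  show "expectation (\<lambda>\<omega>. W t \<omega> - W s \<omega>) = 0"
    using E[of 1] integral_normal_moment_odd[OF \<sigma>, of 0 0] by simp
  show "expectation (\<lambda>\<omega>. (W t \<omega> - W s \<omega>)\<^sup>2) = t - s"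
    using E[of 2] integral_normal_moment_even[OF \<sigma>, of 0 1] assms by (simp add: fact_numeral)
  show "expectation (\<lambda>\<omega>. (W t \<omega> - W s \<omega>) ^ 4) = 3 * (t - s)\<^sup>2"
    using E[of 4] integral_normal_moment_even[OF \<sigma>, of 0 2] assms
    by (simp add: fact_numeral power_divide field_simps)
qed

text \<open>Independence is assumed for sigma-algebras; \<open>Z\<close> and the increment generate
  sub-sigma-algebras of the two involved, so it is inherited.\<close>

lemma W_increment_indep:
  assumes "0 \<le> s" "s < t" "Z \<in> borel_measurable (F s)"
  shows "indep_var borel Z borel (\<lambda>\<omega>. W t \<omega> - W s \<omega>)"
proof -
  define D where "D = (\<lambda>\<omega>. W t \<omega> - W s \<omega>)"
  have ind: "indep_set (sets (F s)) (sets (vimage_algebra (space M) D borel))"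
    using wiener assms by (simp add: wiener_process_def D_def)
  have Dm: "D \<in> borel_measurable M" unfolding D_def
    using W_measurable[of t] W_measurable[of s] assms by auto
  have Zm: "Z \<in> borel_measurable M" using measurable_F_M assms by blast
  have "sigma_sets (space M) {Z -` A \<inter> space M | A. A \<in> sets borel} \<subseteq> sets (F s)"
    using sets.sigma_sets_subset[of "{Z -` A \<inter> space M | A. A \<in> sets borel}" "F s"]
      measurable_sets[OF assms(3)] assms(1) by auto
  moreover have "sigma_sets (space M) {D -` A \<inter> space M | A. A \<in> sets borel} \<subseteq> sets (vimage_algebra (space M) D borel)"
    using sets.sigma_sets_subset[of "{D -` A \<inter> space M | A. A \<in> sets borel}" "vimage_algebra (space M) D borel"]
    by (auto intro!: in_vimage_algebra)
  ultimately have "indep_set (sigma_sets (space M) {Z -` A \<inter> space M | A. A \<in> sets borel})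
      (sigma_sets (space M) {D -` A \<inter> space M | A. A \<in> sets borel})"
    using ind unfolding indep_sets2_eq by blast
  then show ?thesis
    unfolding indep_var_eq using Zm Dm by (simp add: D_def)
qed

text \<open>This factorisation takes the place of conditional expectations given \<open>F s\<close>:
  with \<open>k = 1\<close> it makes the stochastic term centred, with \<open>k = 2\<close> it
  produces the Ito correction.\<close>

lemma bounded_times_W_increment_power:
  assumes "0 \<le> s" "s < t" "Z \<in> borel_measurable (F s)" "\<And>\<omega>. \<omega> \<in> space M \<Longrightarrow> \<bar>Z \<omega>\<bar> \<le> C"
  shows "integrable M (\<lambda>\<omega>. Z \<omega> * (W t \<omega> - W s \<omega>) ^ k)"
    and "expectation (\<lambda>\<omega>. Z \<omega> * (W t \<omega> - W s \<omega>) ^ k) = expectation Z * expectation (\<lambda>\<omega>. (W t \<omega> - W s \<omega>) ^ k)"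
proof -
  have Zm: "Z \<in> borel_measurable M" using measurable_F_M assms by blast
  have iv: "indep_var borel Z borel (\<lambda>\<omega>. (W t \<omega> - W s \<omega>) ^ k)"
    using indep_var_compose[OF W_increment_indep[OF assms(1-3)], of id borel "\<lambda>x. x ^ k" borel]
    by (simp add: comp_def)
  have Zi: "integrable M Z"
    by (rule integrable_const_bound[of _ C]) (use assms Zm in auto)
  note Wi = W_increment_power_integrable[OF assms(1,2), of k]
  show "integrable M (\<lambda>\<omega>. Z \<omega> * (W t \<omega> - W s \<omega>) ^ k)"
    by (rule indep_var_integrable[OF iv Zi Wi])
  show "expectation (\<lambda>\<omega>. Z \<omega> * (W t \<omega> - W s \<omega>) ^ k) = expectation Z * expectation (\<lambda>\<omega>. (W t \<omega> - W s \<omega>) ^ k)"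
    by (rule indep_var_lebesgue_integral[OF iv Zi Wi])
qed


section \<open>Progressively measurable processes\<close>

lemma progressive_indicator:
  fixes H :: "real \<Rightarrow> 'a \<Rightarrow> real"
  assumes "progressively_measurable F H" "0 \<le> T"
  shows "(\<lambda>(q, \<omega>). indicator {0..T} q * H q \<omega>) \<in> borel_measurable (borel \<Otimes>\<^sub>M F T)"
proof -
  have [measurable]: "(\<lambda>(q, \<omega>). H q \<omega>) \<in> borel_measurable (restrict_space borel {0..T} \<Otimes>\<^sub>M F T)"
    using assms by (auto simp: progressively_measurable_def)
  \<comment> \<open>Clamping is a measurable retraction of the line onto \<open>{0..T}\<close>; it
    extends \<open>H\<close> beyond the interval, and the indicator then erases the artificial
    values.\<close>
  have [measurable]: "(\<lambda>q::real. max 0 (min T q)) \<in> measurable borel (restrict_space borel {0..T})"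
    using assms(2) by (intro measurable_restrict_space2) auto
  have "(\<lambda>x. indicator {0..T} (fst x) * (case (max 0 (min T (fst x)), snd x) of (q, \<omega>) \<Rightarrow> H q \<omega>)) \<in> borel_measurable (borel \<Otimes>\<^sub>M F T)"
    by measurable
  also have "(\<lambda>x. indicator {0..T} (fst x) * (case (max 0 (min T (fst x)), snd x) of (q, \<omega>) \<Rightarrow> H q \<omega>)) = (\<lambda>(q, \<omega>). indicator {0..T} q * H q \<omega>)"
    by (auto simp: fun_eq_iff indicator_def)
  finally show ?thesis .
qed

lemma measurable_pair_F_M:
  "0 \<le> T \<Longrightarrow> f \<in> measurable (borel \<Otimes>\<^sub>M F T) N \<Longrightarrow> f \<in> measurable (borel \<Otimes>\<^sub>M M) N"
  by (rule measurable_mono[THEN subsetD, of N N "borel \<Otimes>\<^sub>M F T" "borel \<Otimes>\<^sub>M M"])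
     (auto simp: space_pair_measure sets_pair_measure dest!: sets_F_M intro!: sigma_sets_mono')

lemma progressive_measurable_F:
  assumes "progressively_measurable F H" "0 \<le> T"
  shows "H T \<in> borel_measurable (F T)"
proof -
  have "(\<lambda>\<omega>. (\<lambda>(q, \<omega>). indicator {0..T} q * H q \<omega>) (T, \<omega>)) \<in> borel_measurable (F T)"
    using progressive_indicator[OF assms] by measurable
  then show ?thesis using assms by simp
qed

lemma progressive_section:
  assumes "progressively_measurable F H" "0 \<le> T" "\<omega> \<in> space M"
  shows "(\<lambda>q. indicator {0..T} q * H q \<omega>) \<in> borel_measurable borel"
proof -
  have "(\<lambda>q. (\<lambda>(q, \<omega>). indicator {0..T} q * H q \<omega>) (q, \<omega>)) \<in> borel_measurable borel"
    using measurable_compose[OF measurable_Pair2'[of \<omega> "F T" borel] progressive_indicator[OF assms(1,2)]] assms by simp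
  then show ?thesis by simp
qed

lemma progressive_LBINT_measurable:
  assumes "progressively_measurable F H" "0 \<le> T"
  shows "(\<lambda>\<omega>. LBINT q:{0..T}. H q \<omega>) \<in> borel_measurable (F T)"
proof -
  have [measurable]: "(\<lambda>(q, \<omega>). indicator {0..T} q * H q \<omega>) \<in> borel_measurable (borel \<Otimes>\<^sub>M F T)"
    by (rule progressive_indicator[OF assms])
  have "(\<lambda>(\<omega>, q). (\<lambda>(q, \<omega>). indicator {0..T} q * H q \<omega>) (q, \<omega>)) \<in> borel_measurable (F T \<Otimes>\<^sub>M lborel)"
    by measurable
  then have "(\<lambda>(\<omega>, q). indicator {0..T} q * H q \<omega>) \<in> borel_measurable (F T \<Otimes>\<^sub>M lborel)" by simp
  then show ?thesis
    unfolding set_lebesgue_integral_def using lborel.borel_measurable_lebesgue_integral by (simp add: real_scaleR_def)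
qed

text \<open>The path is sampled at the last point before time \<open>q\<close> of the grid of mesh
  \<open>1 / (n + 1)\<close>. Sampling to the left keeps the values measurable for
  \<open>F T\<close>, and continuity of the paths gives convergence. The grid index takes countably
  many values, which reduces joint measurability to that of each single
  \<open>Y (t n i)\<close>.\<close>

lemma continuous_adapted_progressive:
  assumes "continuous_adapted M F Y"
  shows "progressively_measurable F Y"
  unfolding progressively_measurable_def
proof (intro allI impI)
  fix T :: real assume T: "0 \<le> T"
  let ?P = "restrict_space borel {0..T} \<Otimes>\<^sub>M F T"
  \<comment> \<open>\<open>min T\<close> only matters for indices beyond the interval, where the
    sample must still be measurable for \<open>F T\<close>.\<close>
  define t where "t = (\<lambda>(n::nat) (i::nat). min T (real i / real (Suc n)))"
  define j where "j = (\<lambda>(n::nat) (q::real). nat \<lfloor>q * real (Suc n)\<rfloor>)"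
  have m: "(\<lambda>x. Y (t n (j n (fst x))) (snd x)) \<in> borel_measurable ?P" for n
  proof (rule measurable_compose_countable)
    fix i
    have "Y (t n i) \<in> borel_measurable (F T)"
      using assms T by (intro measurable_F_mono[of "t n i" T]) (auto simp: t_def continuous_adapted_def)
    then show "(\<lambda>x. Y (t n i) (snd x)) \<in> borel_measurable ?P" by measurable
  next
    have "j n \<in> measurable borel (count_space UNIV)" unfolding j_def by measurable
    then have "j n \<in> measurable (restrict_space borel {0..T}) (count_space UNIV)"
      by (rule measurable_restrict_space1)
    then show "(\<lambda>x. j n (fst x)) \<in> measurable ?P (count_space UNIV)" by measurable
  qed
  have "(\<lambda>x. Y (fst x) (snd x)) \<in> borel_measurable ?P"
  proof (rule borel_measurable_LIMSEQ_real[OF _ m])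
    fix x assume "x \<in> space ?P"
    then have x: "0 \<le> fst x" "fst x \<le> T" "snd x \<in> space M"
      using T by (auto simp: space_pair_measure space_restrict_space)
    have lim: "(\<lambda>n. t n (j n (fst x))) \<longlonglongrightarrow> fst x"
    proof (rule LIMSEQ_I)
      fix r :: real assume "0 < r"
      then obtain N where N: "inverse (real (Suc N)) < r" using reals_Archimedean by blast
      show "\<exists>no. \<forall>n\<ge>no. norm (t n (j n (fst x)) - fst x) < r"
      proof (intro exI[of _ N] allI impI)
        fix n assume "N \<le> n"
        then have n: "inverse (real (Suc n)) < r"
          using N by (smt (verit) le_imp_inverse_le of_nat_0_less_iff of_nat_le_iff Suc_le_mono zero_less_Suc)
        define z where "z = fst x * real (Suc n)"
        have z: "0 \<le> z" using x by (simp add: z_def)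
        have "real (j n (fst x)) = of_int \<lfloor>z\<rfloor>"
          using z unfolding j_def z_def by simp
        then have fl: "real (j n (fst x)) \<le> z" "z < real (j n (fst x)) + 1"
          by linarith+
        have "real (j n (fst x)) / real (Suc n) \<le> fst x"
          using fl(1) by (simp add: z_def divide_le_eq)
        moreover have "fst x < real (j n (fst x)) / real (Suc n) + inverse (real (Suc n))"
          using fl(2) by (simp add: z_def field_simps)
        ultimately show "norm (t n (j n (fst x)) - fst x) < r"
          using n x by (auto simp: t_def min_def)
      qed
    qed
    have "continuous_on {0..} (\<lambda>t. Y t (snd x))"
      using assms x by (simp add: continuous_adapted_def)
    from continuous_on_tendsto_compose[OF this lim]
    show "(\<lambda>n. Y (t n (j n (fst x))) (snd x)) \<longlonglongrightarrow> Y (fst x) (snd x)"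
      using x T by (auto simp: t_def)
  qed
  then show "(\<lambda>(s, \<omega>). Y s \<omega>) \<in> borel_measurable ?P" by (simp add: case_prod_beta)
qed

section \<open>Elementary integrands and their integrals\<close>

lemma simple_process_Cons:
  "simple_process M F ((s, t, \<xi>) # S) \<longleftrightarrow>
     0 \<le> s \<and> s \<le> t \<and> \<xi> \<in> borel_measurable (F s) \<and> (\<exists>C. \<forall>\<omega>\<in>space M. \<bar>\<xi> \<omega>\<bar> \<le> C) \<and> simple_process M F S"
  by (auto simp: simple_process_def)

lemma simple_value_progressive:
  assumes "simple_process M F S"
  shows "progressively_measurable F (simple_value S)"
  unfolding progressively_measurable_def
proof (intro allI impI)
  fix T :: real assume T: "0 \<le> T"
  show "(\<lambda>(q, \<omega>). simple_value S q \<omega>) \<in> borel_measurable (restrict_space borel {0..T} \<Otimes>\<^sub>M F T)"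
    using assms
  proof (induction S)
    case Nil
    then show ?case by (simp add: simple_value_def)
  next
    case (Cons e S)
    obtain s t \<xi> where e: "e = (s, t, \<xi>)" by (cases e)
    have m: "0 \<le> s" "s \<le> t" "\<xi> \<in> borel_measurable (F s)" "simple_process M F S"
      using Cons.prems by (auto simp: e simple_process_Cons)
    note [measurable] = Cons.IH[OF m(4)]
    have "(\<lambda>(q, \<omega>). \<xi> \<omega> * indicator {s<..t} q :: real) \<in> borel_measurable (restrict_space borel {0..T} \<Otimes>\<^sub>M F T)"
    \<comment> \<open>For \<open>T < s\<close> the coefficient \<open>\<xi>\<close> need not be
      measurable for \<open>F T\<close>, but then the entry vanishes on
      \<open>{0..T}\<close>.\<close>
    proof (cases "s \<le> T")
      case True
      have [measurable]: "\<xi> \<in> borel_measurable (F T)" by (rule measurable_F_mono[OF m(1) True m(3)])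
      have [measurable]: "(indicator {s<..t} :: real \<Rightarrow> real) \<in> borel_measurable (restrict_space borel {0..T})"
        by (rule measurable_restrict_space1) auto
      show ?thesis by measurable
    next
      case False
      have "(\<lambda>(q, \<omega>). 0 :: real) \<in> borel_measurable (restrict_space borel {0..T} \<Otimes>\<^sub>M F T)" by measurable
      then show ?thesis
        by (rule measurable_cong[THEN iffD1, rotated])
           (use False T in \<open>auto simp: space_pair_measure space_restrict_space\<close>)
    qed
    then have "(\<lambda>x. (\<lambda>(q, \<omega>). \<xi> \<omega> * indicator {s<..t} q :: real) x + (\<lambda>(q, \<omega>). simple_value S q \<omega>) x) \<in> borel_measurable (restrict_space borel {0..T} \<Otimes>\<^sub>M F T)"
      by measurable
    then show ?case by (simp add: e simple_value_def case_prod_beta)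
  qed
qed

lemma simple_value_bounded:
  assumes "simple_process M F S"
  shows "\<exists>C. \<forall>q. \<forall>\<omega>\<in>space M. \<bar>simple_value S q \<omega>\<bar> \<le> C"
  using assms
proof (induction S)
  case Nil
  then show ?case by (auto simp: simple_value_def)
next
  case (Cons e S)
  obtain s t \<xi> where e: "e = (s, t, \<xi>)" by (cases e)
  obtain C where C: "\<forall>q. \<forall>\<omega>\<in>space M. \<bar>simple_value S q \<omega>\<bar> \<le> C"
    using Cons by (auto simp: e simple_process_Cons)
  obtain D where D: "\<forall>\<omega>\<in>space M. \<bar>\<xi> \<omega>\<bar> \<le> D"
    using Cons.prems by (auto simp: e simple_process_Cons)
  have "\<bar>simple_value (e # S) q \<omega>\<bar> \<le> D + C" if "\<omega> \<in> space M" for q \<omega>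
  proof -
    have "\<bar>\<xi> \<omega> * indicator {s<..t} q\<bar> \<le> D"
      using D that by (auto simp: indicator_def intro: order.trans[OF abs_ge_zero])
    moreover have "\<bar>simple_value S q \<omega>\<bar> \<le> C" using C that by blast
    moreover have "simple_value (e # S) q \<omega> = \<xi> \<omega> * indicator {s<..t} q + simple_value S q \<omega>"
      by (simp add: e simple_value_def)
    ultimately show ?thesis by linarith
  qed
  then show ?case by blast
qed

lemma simple_integral_continuous_adapted:
  assumes "simple_process M F S"
  shows "continuous_adapted M F (simple_integral W S)"
  using assms
proof (induction S)
  case Nil
  then show ?case by (simp add: simple_integral_def continuous_adapted_def)
next
  case (Cons e S)
  obtain s t \<xi> where e: "e = (s, t, \<xi>)" by (cases e)
  have m: "0 \<le> s" "s \<le> t" "\<xi> \<in> borel_measurable (F s)" "simple_process M F S"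
    using Cons.prems by (auto simp: e simple_process_Cons)
  have IH: "continuous_adapted M F (simple_integral W S)" by (rule Cons.IH[OF m(4)])
  have eq: "simple_integral W (e # S) r \<omega> = \<xi> \<omega> * (W (min t r) \<omega> - W (min s r) \<omega>) + simple_integral W S r \<omega>" for r \<omega>
    by (simp add: e simple_integral_def)
  show ?case
    unfolding continuous_adapted_def
  proof (intro conjI allI impI ballI)
    fix r :: real assume r: "0 \<le> r"
    have [measurable]: "simple_integral W S r \<in> borel_measurable (F r)"
      using IH r by (simp add: continuous_adapted_def)
    have [measurable]: "W (min t r) \<in> borel_measurable (F r)" "W (min s r) \<in> borel_measurable (F r)"
      using m r by (auto intro: measurable_F_mono[OF _ _ W_measurable_F])
    have "(\<lambda>\<omega>. \<xi> \<omega> * (W (min t r) \<omega> - W (min s r) \<omega>)) \<in> borel_measurable (F r)"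
    proof (cases "s \<le> r")
      case True
      have [measurable]: "\<xi> \<in> borel_measurable (F r)" by (rule measurable_F_mono[OF m(1) True m(3)])
      show ?thesis by measurable
    qed (use m in \<open>simp add: min_def\<close>)
    then show "simple_integral W (e # S) r \<in> borel_measurable (F r)"
      unfolding eq by measurable
  next
    fix \<omega> assume \<omega>: "\<omega> \<in> space M"
    have c: "continuous_on {0..} (\<lambda>t. W t \<omega>)" "continuous_on {0..} (\<lambda>r. simple_integral W S r \<omega>)"
      using W_adapted IH \<omega> by (auto simp: continuous_adapted_def)
    have "continuous_on {0..} (\<lambda>r. W (min u r) \<omega>)" if "0 \<le> u" for u
      by (rule continuous_on_compose2[OF c(1)]) (use that in \<open>auto intro!: continuous_intros\<close>)
    then show "continuous_on {0..} (\<lambda>r. simple_integral W (e # S) r \<omega>)"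
      unfolding eq using c m by (auto intro!: continuous_intros)
  qed
qed

definition breakpoints :: "'b simple \<Rightarrow> real set" where
  "breakpoints S = (\<Union>(s, t, \<xi>)\<in>set S. {s, t})"

lemma finite_breakpoints: "finite (breakpoints S)"
  by (auto simp: breakpoints_def)

text \<open>The intervals are closed on the right, so the constant value on \<open>{s<..t}\<close>
  is the one at \<open>t\<close>, while the value at \<open>s\<close> may belong to the previous
  piece. It is known at time \<open>s\<close>, because an entry that is active on the stretch has
  begun by then. The integral over the stretch is therefore a frozen factor times an independent
  increment.\<close>

lemma simple_between_breakpoints:
  assumes "simple_process M F S" "0 \<le> s" "s < t" "breakpoints S \<inter> {s<..<t} = {}"
  shows "simple_value S t \<in> borel_measurable (F s)"
    and "\<And>r \<omega>. s < r \<Longrightarrow> r \<le> t \<Longrightarrow> simple_value S r \<omega> = simple_value S t \<omega>"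
    and "\<And>r \<omega>. s < r \<Longrightarrow> r \<le> t \<Longrightarrow>
      simple_integral W S r \<omega> = simple_integral W S s \<omega> + simple_value S t \<omega> * (W r \<omega> - W s \<omega>)"
proof -
  have "simple_value S t \<in> borel_measurable (F s) \<and>
    (\<forall>r \<omega>. s < r \<longrightarrow> r \<le> t \<longrightarrow> simple_value S r \<omega> = simple_value S t \<omega> \<and>
      simple_integral W S r \<omega> = simple_integral W S s \<omega> + simple_value S t \<omega> * (W r \<omega> - W s \<omega>))"
    using assms(1,4)
  proof (induction S)
    case Nil
    then show ?case by (simp add: simple_value_def simple_integral_def)
  next
    case (Cons e S)
    obtain u v \<xi> where e: "e = (u, v, \<xi>)" by (cases e)
    have m: "0 \<le> u" "u \<le> v" "\<xi> \<in> borel_measurable (F u)" "simple_process M F S"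
      and u: "u \<le> s \<or> t \<le> u" and v: "v \<le> s \<or> t \<le> v" and b: "breakpoints S \<inter> {s<..<t} = {}"
      using Cons.prems by (auto simp: e simple_process_Cons breakpoints_def not_less)
    note IH = Cons.IH[OF m(4) b]
    have "(\<lambda>\<omega>. \<xi> \<omega> * indicator {u<..v} t :: real) \<in> borel_measurable (F s)"
    proof (cases "u \<le> s")
      case True
      have [measurable]: "\<xi> \<in> borel_measurable (F s)" by (rule measurable_F_mono[OF m(1) True m(3)])
      show ?thesis by measurable
    qed (use u assms in auto)
    moreover have "simple_value S t \<in> borel_measurable (F s)" using IH by blast
    ultimately have "(\<lambda>\<omega>. \<xi> \<omega> * indicator {u<..v} t + simple_value S t \<omega>) \<in> borel_measurable (F s)"
      by (rule borel_measurable_add)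
    moreover have "(\<lambda>\<omega>. \<xi> \<omega> * indicator {u<..v} t + simple_value S t \<omega>) = simple_value (e # S) t"
      by (simp add: fun_eq_iff e simple_value_def)
    ultimately have "simple_value (e # S) t \<in> borel_measurable (F s)" by simp
    moreover have i: "indicator {u<..v} r = (indicator {u<..v} t :: real)" if "s < r" "r \<le> t" for r
      using that u v by (auto simp: indicator_def)
    have w: "W (min v r) \<omega> - W (min u r) \<omega> = W (min v s) \<omega> - W (min u s) \<omega> + indicator {u<..v} t * (W r \<omega> - W s \<omega>)"
      if "s < r" "r \<le> t" for r \<omega>
    proof -
      \<comment> \<open>With no breakpoint strictly inside, an entry covers the whole stretch, has
        ended by \<open>s\<close>, or begins at \<open>t\<close> or later.\<close>
      consider "u \<le> s" "t \<le> v" | "v \<le> s" | "t \<le> u" using u v by blast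
      then show ?thesis
      proof cases
        case 1
        then have "min v r = r" "min u r = u" "min v s = s" "min u s = u" "indicator {u<..v} t = (1::real)"
          using that assms by (auto simp: indicator_def)
        then show ?thesis by simp
      next
        case 2
        then have "min v r = v" "min u r = u" "min v s = v" "min u s = u" "indicator {u<..v} t = (0::real)"
          using that assms m by (auto simp: indicator_def)
        then show ?thesis by simp
      next
        case 3
        then have "min v r = r" "min u r = r" "min v s = s" "min u s = s" "indicator {u<..v} t = (0::real)"
          using that assms m by (auto simp: indicator_def)
        then show ?thesis by simp
      qed
    qed
    have "simple_value (e # S) r \<omega> = simple_value (e # S) t \<omega> \<and>
      simple_integral W (e # S) r \<omega> = simple_integral W (e # S) s \<omega> + simple_value (e # S) t \<omega> * (W r \<omega> - W s \<omega>)"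
      if r: "s < r" "r \<le> t" for r \<omega>
    proof -
      have *: "simple_value S r \<omega> = simple_value S t \<omega>"
        "simple_integral W S r \<omega> = simple_integral W S s \<omega> + simple_value S t \<omega> * (W r \<omega> - W s \<omega>)"
        using IH r by blast+
      have sv: "simple_value (e # S) q \<omega> = \<xi> \<omega> * indicator {u<..v} q + simple_value S q \<omega>"
        and si: "simple_integral W (e # S) q \<omega> = \<xi> \<omega> * (W (min v q) \<omega> - W (min u q) \<omega>) + simple_integral W S q \<omega>" for q
        by (simp_all add: e simple_value_def simple_integral_def)
      show ?thesis unfolding sv si i[OF r] w[OF r] * by (simp add: algebra_simps)
    qed
    with \<open>simple_value (e # S) t \<in> borel_measurable (F s)\<close> show ?case by blast
  qed
  then show "simple_value S t \<in> borel_measurable (F s)"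
    and "\<And>r \<omega>. s < r \<Longrightarrow> r \<le> t \<Longrightarrow> simple_value S r \<omega> = simple_value S t \<omega>"
    and "\<And>r \<omega>. s < r \<Longrightarrow> r \<le> t \<Longrightarrow>
      simple_integral W S r \<omega> = simple_integral W S s \<omega> + simple_value S t \<omega> * (W r \<omega> - W s \<omega>)"
    by blast+
qed


section \<open>Time integrals of bounded progressive processes\<close>

lemma progressive_bounded_section:
  assumes H: "progressively_measurable F H" "\<And>q \<omega>. \<omega> \<in> space M \<Longrightarrow> \<bar>H q \<omega>\<bar> \<le> C"
    and \<omega>: "\<omega> \<in> space M" and st: "0 \<le> s" "s \<le> t"
  shows "set_integrable lborel {s..t} (\<lambda>q. H q \<omega>)"
    and "set_integrable lborel {s<..t} (\<lambda>q. H q \<omega>)"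
    and "\<bar>LBINT q:{s<..t}. H q \<omega>\<bar> \<le> C * (t - s)"
    and "(LBINT q:{0..t}. H q \<omega>) = (LBINT q:{0..s}. H q \<omega>) + (LBINT q:{s<..t}. H q \<omega>)"
proof -
  have m: "(\<lambda>q. indicator {0..t} q * H q \<omega>) \<in> borel_measurable borel"
    using progressive_section[OF H(1) _ \<omega>] st by simp
  have int: "set_integrable lborel A (\<lambda>q. H q \<omega>)" if "A \<subseteq> {0..t}" "A \<in> sets borel" for A
  proof -
    have "(\<lambda>q. indicator A q * (indicator {0..t} q * H q \<omega>)) \<in> borel_measurable borel"
      using m that by measurable
    moreover have "(\<lambda>q. indicator A q * (indicator {0..t} q * H q \<omega>)) = (\<lambda>q. indicator A q *\<^sub>R H q \<omega>)"
      using that by (auto simp: indicator_def fun_eq_iff)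
    ultimately have mA: "(\<lambda>q. indicator A q *\<^sub>R H q \<omega>) \<in> borel_measurable lborel" by simp
    show ?thesis
      unfolding set_integrable_def
    proof (rule integrableI_bounded_set[where A = A and B = C])
      have "emeasure lborel A \<le> emeasure lborel {0..t}" using that by (intro emeasure_mono) auto
      then show "emeasure lborel A < \<infinity>" using st by (auto intro: le_less_trans)
    qed (use that mA H(2)[OF \<omega>] in auto)
  qed
  show "set_integrable lborel {s..t} (\<lambda>q. H q \<omega>)" by (rule int) (use st in auto)
  show 1: "set_integrable lborel {s<..t} (\<lambda>q. H q \<omega>)" by (rule int) (use st in auto)
  have "\<bar>LBINT q:{s<..t}. H q \<omega>\<bar> \<le> (LBINT q:{s<..t}. \<bar>H q \<omega>\<bar>)"
    using integral_norm_bound[of lborel "\<lambda>q. indicator {s<..t} q *\<^sub>R H q \<omega>"]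
    by (simp add: set_lebesgue_integral_def abs_mult)
  also have "\<dots> \<le> (LBINT q:{s<..t}. C)"
    using set_integrable_abs[OF 1] st H(2)[OF \<omega>]
    by (intro set_integral_mono) (auto simp: set_integrable_def)
  finally show "\<bar>LBINT q:{s<..t}. H q \<omega>\<bar> \<le> C * (t - s)"
    using st by (simp add: set_lebesgue_integral_def mult.commute)
  have "{0..t} = {0..s} \<union> {s<..t}" using st by auto
  then show "(LBINT q:{0..t}. H q \<omega>) = (LBINT q:{0..s}. H q \<omega>) + (LBINT q:{s<..t}. H q \<omega>)"
    by (simp only:) (intro set_integral_Un int; use st in auto)
qed

lemma progressive_LBINT_continuous_adapted:
  assumes H: "progressively_measurable F H" "\<And>q \<omega>. \<omega> \<in> space M \<Longrightarrow> \<bar>H q \<omega>\<bar> \<le> C"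
  shows "continuous_adapted M F (\<lambda>r \<omega>. LBINT q:{0..r}. H q \<omega>)"
  unfolding continuous_adapted_def
proof (intro conjI allI impI ballI)
  fix t :: real assume "0 \<le> t"
  then show "(\<lambda>\<omega>. LBINT q:{0..t}. H q \<omega>) \<in> borel_measurable (F t)"
    by (rule progressive_LBINT_measurable[OF H(1)])
next
  fix \<omega> assume \<omega>: "\<omega> \<in> space M"
  have C: "0 \<le> C" using H(2)[OF \<omega>, of 0] by linarith
  have b: "\<bar>(LBINT q:{0..t}. H q \<omega>) - (LBINT q:{0..s}. H q \<omega>)\<bar> \<le> C * (t - s)" if "0 \<le> s" "s \<le> t" for s t
    using progressive_bounded_section(3,4)[OF H \<omega> that] by simp
  have "C-lipschitz_on {0..} (\<lambda>t. LBINT q:{0..t}. H q \<omega>)"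
  proof (rule lipschitz_onI[OF _ C])
    fix s t :: real assume "s \<in> {0..}" "t \<in> {0..}"
    then show "dist (LBINT q:{0..s}. H q \<omega>) (LBINT q:{0..t}. H q \<omega>) \<le> C * dist s t"
      using b[of s t] b[of t s] by (cases "s \<le> t") (auto simp: dist_real_def)
  qed
  then show "continuous_on {0..} (\<lambda>t. LBINT q:{0..t}. H q \<omega>)"
    by (rule lipschitz_on_continuous_on)
qed

text \<open>The factor \<open>Z\<close> will be a quantity frozen at the left end of a time step; it
  is carried, together with the expectation, through the time integral of a drift or a killing rate
  that is merely measurable in time.\<close>

lemma progressive_Fubini:
  assumes H: "progressively_measurable F H" "\<And>q \<omega>. \<omega> \<in> space M \<Longrightarrow> \<bar>H q \<omega>\<bar> \<le> C"
    and Z: "Z \<in> borel_measurable M" "\<And>\<omega>. \<omega> \<in> space M \<Longrightarrow> \<bar>Z \<omega>\<bar> \<le> C'"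
    and st: "0 \<le> s" "s \<le> t"
  shows "set_integrable lborel {s<..t} (\<lambda>r. expectation (\<lambda>\<omega>. Z \<omega> * H r \<omega>))"
    and "(LBINT r:{s<..t}. expectation (\<lambda>\<omega>. Z \<omega> * H r \<omega>)) = expectation (\<lambda>\<omega>. Z \<omega> * (LBINT r:{s<..t}. H r \<omega>))"
proof -
  interpret P: pair_sigma_finite lborel M ..
  define f where "f = (\<lambda>r \<omega>. indicator {s<..t} r * (Z \<omega> * H r \<omega>))"
  have [measurable]: "(\<lambda>(q, \<omega>). indicator {0..t} q * H q \<omega>) \<in> borel_measurable (borel \<Otimes>\<^sub>M M)"
    using progressive_indicator[OF H(1)] measurable_pair_F_M st by (meson order.trans)
  note [measurable] = Z(1)
  have "(\<lambda>x. indicator {s<..t} (fst x) * (Z (snd x) * (\<lambda>(q, \<omega>). indicator {0..t} q * H q \<omega>) x)) \<in> borel_measurable (borel \<Otimes>\<^sub>M M)"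
    by measurable
  also have "(\<lambda>x. indicator {s<..t} (fst x) * (Z (snd x) * (\<lambda>(q, \<omega>). indicator {0..t} q * H q \<omega>) x)) = (\<lambda>(r, \<omega>). f r \<omega>)"
    using st by (auto simp: f_def fun_eq_iff indicator_def)
  finally have fm: "(\<lambda>(r, \<omega>). f r \<omega>) \<in> borel_measurable (lborel \<Otimes>\<^sub>M M)"
    by (simp cong: measurable_cong_sets sets_pair_measure_cong)
  have fi: "integrable (lborel \<Otimes>\<^sub>M M) (\<lambda>(r, \<omega>). f r \<omega>)"
  proof (rule integrableI_bounded_set[where A = "{s<..t} \<times> space M" and B = "C' * C"])
    show "emeasure (lborel \<Otimes>\<^sub>M M) ({s<..t} \<times> space M) < \<infinity>"
      using st by (subst emeasure_pair_measure_Times) (auto simp: emeasure_space_1 ennreal_mult_less_top)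
    show "AE x\<in>{s<..t} \<times> space M in lborel \<Otimes>\<^sub>M M. norm (case x of (r, \<omega>) \<Rightarrow> f r \<omega>) \<le> C' * C"
    proof (rule AE_I2, clarsimp simp: space_pair_measure)
      fix r \<omega> assume \<omega>: "\<omega> \<in> space M"
      have "\<bar>Z \<omega>\<bar> * \<bar>H r \<omega>\<bar> \<le> C' * C"
        using Z(2)[OF \<omega>] H(2)[OF \<omega>, of r] by (intro mult_mono) auto
      then show "s < r \<Longrightarrow> r \<le> t \<Longrightarrow> \<bar>f r \<omega>\<bar> \<le> C' * C"
        by (simp add: f_def abs_mult)
    qed
    show "AE x in lborel \<Otimes>\<^sub>M M. x \<notin> {s<..t} \<times> space M \<longrightarrow> (case x of (r, \<omega>) \<Rightarrow> f r \<omega>) = 0"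
      by (rule AE_I2) (auto simp: f_def space_pair_measure indicator_def)
  qed (use fm in auto)
  have e1: "(\<integral>\<omega>. f r \<omega> \<partial>M) = indicator {s<..t} r *\<^sub>R expectation (\<lambda>\<omega>. Z \<omega> * H r \<omega>)" for r
    by (simp add: f_def)
  have e2: "(\<integral>r. f r \<omega> \<partial>lborel) = Z \<omega> * (LBINT r:{s<..t}. H r \<omega>)" for \<omega>
    by (simp add: f_def set_lebesgue_integral_def ac_simps flip: integral_mult_right_zero)
  show "set_integrable lborel {s<..t} (\<lambda>r. expectation (\<lambda>\<omega>. Z \<omega> * H r \<omega>))"
    unfolding set_integrable_def e1[symmetric] by (rule P.integrable_fst[OF fi])
  show "(LBINT r:{s<..t}. expectation (\<lambda>\<omega>. Z \<omega> * H r \<omega>)) = expectation (\<lambda>\<omega>. Z \<omega> * (LBINT r:{s<..t}. H r \<omega>))"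
    using P.Fubini_integral[OF fi] unfolding e1 e2 set_lebesgue_integral_def by simp
qed

lemma progressive_compose2:
  fixes f :: "real \<Rightarrow> real \<Rightarrow> real"
  assumes "progressively_measurable F H" "progressively_measurable F K"
    and [measurable]: "(\<lambda>(x, y). f x y) \<in> borel_measurable (borel \<Otimes>\<^sub>M borel)"
  shows "progressively_measurable F (\<lambda>q \<omega>. f (H q \<omega>) (K q \<omega>))"
  unfolding progressively_measurable_def
proof (intro allI impI)
  fix T :: real assume "0 \<le> T"
  then have [measurable]: "(\<lambda>(q, \<omega>). H q \<omega>) \<in> borel_measurable (restrict_space borel {0..T} \<Otimes>\<^sub>M F T)"
    "(\<lambda>(q, \<omega>). K q \<omega>) \<in> borel_measurable (restrict_space borel {0..T} \<Otimes>\<^sub>M F T)"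
    using assms by (auto simp: progressively_measurable_def)
  have "(\<lambda>x. (\<lambda>(x, y). f x y) ((\<lambda>(q, \<omega>). H q \<omega>) x, (\<lambda>(q, \<omega>). K q \<omega>) x)) \<in> borel_measurable (restrict_space borel {0..T} \<Otimes>\<^sub>M F T)"
    by measurable
  then show "(\<lambda>(q, \<omega>). f (H q \<omega>) (K q \<omega>)) \<in> borel_measurable (restrict_space borel {0..T} \<Otimes>\<^sub>M F T)"
    by (simp add: case_prod_beta)
qed

lemma progressive_compose:
  assumes "progressively_measurable F H" "f \<in> borel_measurable borel"
  shows "progressively_measurable F (\<lambda>q \<omega>. f (H q \<omega>))"
  using progressive_compose2[of H H "\<lambda>x y. f x"] assms by simp

lemma continuous_adapted_add:
  "continuous_adapted M F Y \<Longrightarrow> continuous_adapted M F Z \<Longrightarrow> continuous_adapted M F (\<lambda>r \<omega>. Y r \<omega> + Z r \<omega>)"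
  by (auto simp: continuous_adapted_def intro!: continuous_intros borel_measurable_add)

lemma continuous_adapted_const: "continuous_adapted M F (\<lambda>r \<omega>. x)"
  by (auto simp: continuous_adapted_def)

end

lemma discounted_taylor_bound:
  fixes h h' h'' :: "real \<Rightarrow> real"
  assumes h: "\<And>y. (h has_real_derivative h' y) (at y)"
    and h': "\<And>y. (h' has_real_derivative h'' y) (at y)"
    and mod: "\<And>p q. \<bar>h q - h p\<bar> \<le> \<eta> + K * (q - p)\<^sup>2"
      "\<And>p q. \<bar>h'' q - h'' p\<bar> \<le> \<eta> + K * (q - p)\<^sup>2"
    and bnd: "\<And>y. 0 \<le> h y" "\<And>y. h y \<le> C" "\<And>y. \<bar>h'' y\<bar> \<le> C"
    and C: "1 \<le> C" and K: "0 \<le> K" and \<eta>: "0 < \<eta>" and \<delta>: "0 < \<delta>" "\<delta> \<le> 1"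
    and D: "\<bar>D\<bar> \<le> C * \<delta>" and \<xi>: "\<bar>\<xi>\<bar> \<le> C" and c: "0 \<le> c" "c \<le> C * \<delta>" and a: "0 \<le> a"
  shows "exp (- (a + c)) * h (p + D + \<xi> * w) \<le>
    exp (- a) * (h p + h' p * (D + \<xi> * w) + h'' p * \<xi>\<^sup>2 / 2 * w\<^sup>2 - c * h p) +
    ((\<eta> * C\<^sup>2 * \<delta>\<^sup>2 + 4 * K * C^4 * \<delta>^4 + 2 * C^3 * \<delta> * \<eta> + 2 * C^3 * \<delta>\<^sup>2 + 2 * C^3 * K * \<delta>^3)
     + (\<eta> * C\<^sup>2 + C^3 * \<delta> / \<eta> + 2 * C^3 * \<delta> * K) * w\<^sup>2 + 4 * K * C^4 * w^4)"
proof -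
  define y where "y = \<xi> * w"
  define d where "d = D + y"
  define q where "q = p + d"
  have y2: "y\<^sup>2 \<le> C\<^sup>2 * w\<^sup>2"
    using power_mono[OF \<xi>, of 2] unfolding y_def by (simp add: power_mult_distrib mult_right_mono)
  have D2: "D\<^sup>2 \<le> C\<^sup>2 * \<delta>\<^sup>2"
    using power_mono[OF D, of 2] by (simp add: power_mult_distrib)
  have d2: "d\<^sup>2 \<le> 2 * C\<^sup>2 * (\<delta>\<^sup>2 + w\<^sup>2)"
  proof -
    have "d\<^sup>2 \<le> 2 * D\<^sup>2 + 2 * y\<^sup>2" unfolding d_def using zero_le_power2[of "D - y"] by (simp add: power2_eq_square algebra_simps)
    then show ?thesis using y2 D2 by (simp add: algebra_simps)
  qed
  have d4: "d\<^sup>2 * d\<^sup>2 \<le> 8 * C^4 * (\<delta>^4 + w^4)"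
  proof -
    have "d\<^sup>2 * d\<^sup>2 \<le> (2 * C\<^sup>2 * (\<delta>\<^sup>2 + w\<^sup>2)) * (2 * C\<^sup>2 * (\<delta>\<^sup>2 + w\<^sup>2))"
      using d2 by (intro mult_mono) auto
    also have "\<dots> = 4 * C^4 * (\<delta>\<^sup>2 + w\<^sup>2)\<^sup>2" by (simp add: power2_eq_square power4_eq_xxxx)
    also have "(\<delta>\<^sup>2 + w\<^sup>2)\<^sup>2 \<le> 2 * (\<delta>^4 + w^4)"
      using zero_le_power2[of "\<delta>\<^sup>2 - w\<^sup>2"] by (simp add: power2_eq_square power4_eq_xxxx algebra_simps)
    finally show ?thesis using C by (simp add: mult_left_mono algebra_simps)
  qed
  \<comment> \<open>The mixed term is of order \<open>\<delta> * \<bar>w\<bar>\<close>. This bound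
    trades the absolute value for a square, which avoids absolute moments; the factor
    \<open>1 / \<eta>\<close> is harmless because it comes with \<open>\<delta>\<close>.\<close>
  have w: "\<bar>w\<bar> \<le> \<eta> + w\<^sup>2 / \<eta>"
  proof (cases "\<bar>w\<bar> \<le> \<eta>")
    case False
    then have "\<bar>w\<bar> * \<eta> \<le> \<bar>w\<bar> * \<bar>w\<bar>" by (intro mult_left_mono) auto
    then have "\<bar>w\<bar> \<le> w\<^sup>2 / \<eta>" using \<eta> by (simp add: field_simps power2_eq_square)
    then show ?thesis using \<eta> by linarith
  qed (use \<eta> in \<open>simp add: add_increasing2\<close>)
  have taylor: "h q \<le> h p + h' p * d + h'' p * d\<^sup>2 / 2 + (\<eta> + K * d\<^sup>2) * d\<^sup>2 / 2"
    unfolding q_def by (rule taylor2_bound[OF h h' mod(2) K])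
  have quad: "h'' p * d\<^sup>2 / 2 \<le> h'' p * y\<^sup>2 / 2 + (C^3 * \<delta> * (\<eta> + w\<^sup>2 / \<eta>) + C^3 * \<delta>\<^sup>2 / 2)"
  proof -
    have "h'' p * (2 * D * y + D\<^sup>2) \<le> C * (2 * (C * \<delta>) * (C * \<bar>w\<bar>) + C\<^sup>2 * \<delta>\<^sup>2)"
    proof -
      have "\<bar>2 * D * y + D\<^sup>2\<bar> \<le> 2 * (\<bar>D\<bar> * \<bar>y\<bar>) + D\<^sup>2"
        using abs_triangle_ineq[of "2 * D * y" "D\<^sup>2"] by (simp add: abs_mult)
      also have "\<bar>D\<bar> * \<bar>y\<bar> \<le> (C * \<delta>) * (C * \<bar>w\<bar>)"
        unfolding y_def abs_mult using D \<xi> C \<delta> by (intro mult_mono) auto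
      finally have "\<bar>2 * D * y + D\<^sup>2\<bar> \<le> 2 * (C * \<delta>) * (C * \<bar>w\<bar>) + C\<^sup>2 * \<delta>\<^sup>2" using D2 by simp
      then have "\<bar>h'' p\<bar> * \<bar>2 * D * y + D\<^sup>2\<bar> \<le> C * (2 * (C * \<delta>) * (C * \<bar>w\<bar>) + C\<^sup>2 * \<delta>\<^sup>2)"
        using bnd(3)[of p] C by (intro mult_mono) auto
      then show ?thesis by (simp add: abs_mult[symmetric])
    qed
    also have "\<dots> \<le> C * (2 * (C * \<delta>) * (C * (\<eta> + w\<^sup>2 / \<eta>)) + C\<^sup>2 * \<delta>\<^sup>2)"
      using w C \<delta> by (intro mult_left_mono add_right_mono) auto
    also have "\<dots> = 2 * (C^3 * \<delta> * (\<eta> + w\<^sup>2 / \<eta>) + C^3 * \<delta>\<^sup>2 / 2)"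
      by (simp add: power2_eq_square power3_eq_cube algebra_simps)
    finally have "h'' p * (2 * D * y + D\<^sup>2) \<le> 2 * (C^3 * \<delta> * (\<eta> + w\<^sup>2 / \<eta>) + C^3 * \<delta>\<^sup>2 / 2)" .
    moreover have "h'' p * d\<^sup>2 = h'' p * y\<^sup>2 + h'' p * (2 * D * y + D\<^sup>2)"
      unfolding d_def by (simp add: power2_eq_square algebra_simps)
    moreover have "a \<le> 2 * b \<Longrightarrow> u = v + a \<Longrightarrow> u / 2 \<le> v / 2 + b" for a b u v :: real by simp
    ultimately show ?thesis by blast
  qed
  have hq: "h q \<le> h p + h' p * d + h'' p * y\<^sup>2 / 2 + E1"
    if "E1 = \<eta> * C\<^sup>2 * (\<delta>\<^sup>2 + w\<^sup>2) + 4 * K * C^4 * (\<delta>^4 + w^4) + C^3 * \<delta> * (\<eta> + w\<^sup>2 / \<eta>) + C^3 * \<delta>\<^sup>2 / 2" for E1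
  proof -
    have "(\<eta> + K * d\<^sup>2) * d\<^sup>2 / 2 = \<eta> * d\<^sup>2 / 2 + K * (d\<^sup>2 * d\<^sup>2) / 2" by (simp add: algebra_simps add_divide_distrib)
    also have "\<dots> \<le> \<eta> * (2 * C\<^sup>2 * (\<delta>\<^sup>2 + w\<^sup>2)) / 2 + K * (8 * C^4 * (\<delta>^4 + w^4)) / 2"
      using d2 d4 \<eta> K by (intro add_mono divide_right_mono mult_left_mono) auto
    also have "\<dots> = \<eta> * C\<^sup>2 * (\<delta>\<^sup>2 + w\<^sup>2) + 4 * K * C^4 * (\<delta>^4 + w^4)" by simp
    finally have R: "(\<eta> + K * d\<^sup>2) * d\<^sup>2 / 2 \<le> \<eta> * C\<^sup>2 * (\<delta>\<^sup>2 + w\<^sup>2) + 4 * K * C^4 * (\<delta>^4 + w^4)" .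
    show ?thesis
      using order.trans[OF taylor add_mono[OF add_left_mono[OF quad] R]] unfolding that by (simp only: ac_simps)
  qed
  \<comment> \<open>For \<open>c \<le> 1\<close> use \<open>1 + c \<le> exp c\<close> and
    \<open>(1 - c + c^2) * (1 + c) = 1 + c^3\<close>; for larger \<open>c\<close> the right-hand
    side already exceeds 1.\<close>
  have exp_c: "exp (- c) \<le> 1 - c + c\<^sup>2"
  proof (cases "c \<le> 1")
    case True
    have "1 \<le> (1 - c + c\<^sup>2) * (1 + c)" using c(1) by (simp add: algebra_simps power2_eq_square)
    also have "\<dots> \<le> (1 - c + c\<^sup>2) * exp c"
      using exp_ge_add_one_self[of c] True by (intro mult_left_mono) auto
    finally show ?thesis by (simp add: exp_minus field_simps)
  next
    case False
    then have "c * 1 \<le> c * c" by (intro mult_left_mono) auto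
    moreover have "exp (- c) \<le> 1" using c by simp
    ultimately show ?thesis unfolding power2_eq_square by linarith
  qed
  have "exp (- c) * h q \<le> (1 - c + c\<^sup>2) * h q" using exp_c bnd(1) by (intro mult_right_mono) auto
  \<comment> \<open>The killing is made to act on the value at the starting point \<open>p\<close>,
    which is known before the step; moving it there costs an oscillation of \<open>h\<close> over
    the step.\<close>
  also have "\<dots> = h q - c * h p + c * (h p - h q) + c\<^sup>2 * h q" by (simp add: algebra_simps)
  also have "c * (h p - h q) \<le> (C * \<delta>) * (\<eta> + K * d\<^sup>2)"
  proof -
    have "h p - h q \<le> \<eta> + K * d\<^sup>2" using mod(1)[of q p] unfolding q_def by simp
    then have "c * (h p - h q) \<le> c * (\<eta> + K * d\<^sup>2)" using c by (intro mult_left_mono) auto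
    also have "\<dots> \<le> (C * \<delta>) * (\<eta> + K * d\<^sup>2)" using c \<eta> K by (intro mult_right_mono) auto
    finally show ?thesis .
  qed
  also have "\<dots> \<le> C * \<delta> * (\<eta> + K * (2 * C\<^sup>2 * (\<delta>\<^sup>2 + w\<^sup>2)))"
    using d2 K C \<delta> by (intro mult_left_mono add_left_mono) auto
  also have "c\<^sup>2 * h q \<le> (C\<^sup>2 * \<delta>\<^sup>2) * C"
    using power_mono[OF c(2,1), of 2] bnd[of q] by (intro mult_mono) (auto simp: power_mult_distrib)
  also note hq[OF refl]
  finally have main: "exp (- c) * h q \<le> (h p + h' p * d + h'' p * y\<^sup>2 / 2 - c * h p) + E2"
    if "E2 = (\<eta> * C\<^sup>2 * (\<delta>\<^sup>2 + w\<^sup>2) + 4 * K * C^4 * (\<delta>^4 + w^4) + C^3 * \<delta> * (\<eta> + w\<^sup>2 / \<eta>) + C^3 * \<delta>\<^sup>2 / 2)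
      + C * \<delta> * (\<eta> + K * (2 * C\<^sup>2 * (\<delta>\<^sup>2 + w\<^sup>2))) + (C\<^sup>2 * \<delta>\<^sup>2) * C" for E2
    unfolding that by simp
  define E2 where "E2 = (\<eta> * C\<^sup>2 * (\<delta>\<^sup>2 + w\<^sup>2) + 4 * K * C^4 * (\<delta>^4 + w^4) + C^3 * \<delta> * (\<eta> + w\<^sup>2 / \<eta>) + C^3 * \<delta>\<^sup>2 / 2)
      + C * \<delta> * (\<eta> + K * (2 * C\<^sup>2 * (\<delta>\<^sup>2 + w\<^sup>2))) + (C\<^sup>2 * \<delta>\<^sup>2) * C"
  have E2pos: "0 \<le> E2" unfolding E2_def using C K \<eta> \<delta> by (intro add_nonneg_nonneg mult_nonneg_nonneg) auto
  have "C * \<delta> * \<eta> \<le> C^3 * \<delta> * \<eta>"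
    using C \<delta> \<eta> power_increasing[of 1 3 C] by (intro mult_right_mono) auto
  moreover have "0 \<le> C^3 * \<delta>\<^sup>2 / 2" using C by auto
  ultimately have E2: "E2 \<le> (\<eta> * C\<^sup>2 * \<delta>\<^sup>2 + 4 * K * C^4 * \<delta>^4 + 2 * C^3 * \<delta> * \<eta> + 2 * C^3 * \<delta>\<^sup>2 + 2 * C^3 * K * \<delta>^3)
     + (\<eta> * C\<^sup>2 + C^3 * \<delta> / \<eta> + 2 * C^3 * \<delta> * K) * w\<^sup>2 + 4 * K * C^4 * w^4"
    unfolding E2_def by (simp add: algebra_simps power2_eq_square power3_eq_cube)
  have "exp (- (a + c)) * h q = exp (- a) * (exp (- c) * h q)" by (simp add: exp_add[symmetric])
  also have "\<dots> \<le> exp (- a) * ((h p + h' p * d + h'' p * y\<^sup>2 / 2 - c * h p) + E2)"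
    using main[OF E2_def] by (intro mult_left_mono) auto
  also have "\<dots> \<le> exp (- a) * (h p + h' p * d + h'' p * y\<^sup>2 / 2 - c * h p) + 1 * E2"
    unfolding distrib_left using E2pos a by (intro add_left_mono mult_right_mono) auto
  finally show ?thesis
    using E2 unfolding d_def y_def q_def by (simp add: power_mult_distrib mult.assoc add.assoc)
qed

section \<open>The generator inequality for elementary integrands\<close>

text \<open>Drift \<open>\<beta>\<close> and killing rate \<open>c\<close> are arbitrary bounded
  progressive processes instead of functions of \<open>Y\<close>: later they are evaluated along
  \<open>X\<close>, which \<open>Y\<close> only approximates. One constant \<open>C\<close>, at
  least 1 so that its powers can be compared, bounds everything.\<close>

locale simple_diffusion = filtered_wiener M F W
  for M :: "'a measure" and F W +
  fixes S :: "'a simple" and \<beta> c :: "real \<Rightarrow> 'a \<Rightarrow> real" and h h' h'' :: "real \<Rightarrow> real" and x C :: real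
  assumes S: "simple_process M F S" "\<And>q \<omega>. \<omega> \<in> space M \<Longrightarrow> \<bar>simple_value S q \<omega>\<bar> \<le> C"
    and \<beta>: "progressively_measurable F \<beta>" "\<And>q \<omega>. \<omega> \<in> space M \<Longrightarrow> \<bar>\<beta> q \<omega>\<bar> \<le> C"
    and c: "progressively_measurable F c" "\<And>q \<omega>. \<omega> \<in> space M \<Longrightarrow> 0 \<le> c q \<omega>" "\<And>q \<omega>. \<omega> \<in> space M \<Longrightarrow> c q \<omega> \<le> C"
    and h: "\<And>y. (h has_real_derivative h' y) (at y)" "\<And>y. (h' has_real_derivative h'' y) (at y)"
    and ucont: "uniformly_continuous_on UNIV h" "uniformly_continuous_on UNIV h'" "uniformly_continuous_on UNIV h''"
    and hbound: "\<And>y. 0 \<le> h y" "\<And>y. h y \<le> C" "\<And>y. \<bar>h' y\<bar> \<le> C" "\<And>y. \<bar>h'' y\<bar> \<le> C"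
    and C: "1 \<le> C"
begin

definition Y :: "real \<Rightarrow> 'a \<Rightarrow> real" where
  "Y r \<omega> = x + (LBINT q:{0..r}. \<beta> q \<omega>) + simple_integral W S r \<omega>"

definition A :: "real \<Rightarrow> 'a \<Rightarrow> real" where
  "A r \<omega> = (LBINT q:{0..r}. c q \<omega>)"

text \<open>Minus the generator of \<open>Y\<close>, killed at rate \<open>c\<close>, applied to \<open>h\<close>.\<close>

definition G :: "real \<Rightarrow> 'a \<Rightarrow> real" where
  "G r \<omega> = c r \<omega> * h (Y r \<omega>) - h' (Y r \<omega>) * \<beta> r \<omega> - h'' (Y r \<omega>) * (simple_value S r \<omega>)\<^sup>2 / 2"

lemma c_abs: "\<omega> \<in> space M \<Longrightarrow> \<bar>c q \<omega>\<bar> \<le> C"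
  using c(2)[of \<omega> q] c(3)[of \<omega> q] by simp

lemma Y_adapted: "continuous_adapted M F Y"
  unfolding Y_def[abs_def]
  by (intro continuous_adapted_add continuous_adapted_const simple_integral_continuous_adapted[OF S(1)]
      progressive_LBINT_continuous_adapted[OF \<beta>])

lemma A_adapted: "continuous_adapted M F A"
  unfolding A_def[abs_def]
  by (rule progressive_LBINT_continuous_adapted[OF c(1)]) (rule c_abs)

lemma measurable_h [measurable]: "h \<in> borel_measurable borel" "h' \<in> borel_measurable borel" "h'' \<in> borel_measurable borel"
  by (auto intro!: borel_measurable_continuous_onI uniformly_continuous_imp_continuous ucont)

lemma Y_measurable: "0 \<le> t \<Longrightarrow> Y t \<in> borel_measurable (F t)"
  and A_measurable: "0 \<le> t \<Longrightarrow> A t \<in> borel_measurable (F t)"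
  using Y_adapted A_adapted by (auto simp: continuous_adapted_def)

lemma A_nonneg: "\<omega> \<in> space M \<Longrightarrow> 0 \<le> A t \<omega>"
  unfolding A_def set_lebesgue_integral_def using c(2) by (intro Bochner_Integration.integral_nonneg) auto

lemma A_increment:
  assumes "\<omega> \<in> space M" "0 \<le> s" "s \<le> t"
  shows "A t \<omega> = A s \<omega> + (LBINT q:{s<..t}. c q \<omega>)"
    and "0 \<le> (LBINT q:{s<..t}. c q \<omega>)" and "(LBINT q:{s<..t}. c q \<omega>) \<le> C * (t - s)"
proof -
  note * = progressive_bounded_section[OF c(1) c_abs assms]
  show "A t \<omega> = A s \<omega> + (LBINT q:{s<..t}. c q \<omega>)" using *(4) by (simp add: A_def)
  show "0 \<le> (LBINT q:{s<..t}. c q \<omega>)"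
    unfolding set_lebesgue_integral_def using c(2) assms by (intro Bochner_Integration.integral_nonneg) auto
  show "(LBINT q:{s<..t}. c q \<omega>) \<le> C * (t - s)" using *(3) by linarith
qed

lemma G_abs: "\<omega> \<in> space M \<Longrightarrow> \<bar>G r \<omega>\<bar> \<le> 3 * C^3"
proof -
  assume \<omega>: "\<omega> \<in> space M"
  have "\<bar>c r \<omega> * h (Y r \<omega>)\<bar> \<le> C * C" unfolding abs_mult
    using c_abs[OF \<omega>] hbound C by (intro mult_mono) auto
  moreover have "\<bar>h' (Y r \<omega>) * \<beta> r \<omega>\<bar> \<le> C * C" unfolding abs_mult
    using \<beta>(2)[OF \<omega>] hbound C by (intro mult_mono) auto
  moreover have "\<bar>h'' (Y r \<omega>) * (simple_value S r \<omega>)\<^sup>2\<bar> \<le> C * C\<^sup>2" unfolding abs_mult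
    using power_mono[OF S(2)[OF \<omega>, of r], of 2] hbound C by (intro mult_mono) auto
  moreover have "C * C \<le> C^3" "C * C\<^sup>2 = C^3" "0 \<le> C^3"
    using C power_increasing[of 2 3 C] by (auto simp: power2_eq_square power3_eq_cube)
  ultimately show ?thesis unfolding G_def by linarith
qed

lemma G_progressive: "progressively_measurable F (\<lambda>r \<omega>. exp (- A r \<omega>) * G r \<omega>)"
proof -
  note pY = continuous_adapted_progressive[OF Y_adapted]
  note pA = continuous_adapted_progressive[OF A_adapted]
  note pS = simple_value_progressive[OF S(1)]
  have 1: "progressively_measurable F (\<lambda>r \<omega>. c r \<omega> * h (Y r \<omega>))"
    by (rule progressive_compose2[OF c(1) pY]) measurable
  have 2: "progressively_measurable F (\<lambda>r \<omega>. h' (Y r \<omega>) * \<beta> r \<omega>)"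
    by (rule progressive_compose2[OF pY \<beta>(1)]) measurable
  have 3: "progressively_measurable F (\<lambda>r \<omega>. h'' (Y r \<omega>) * (simple_value S r \<omega>)\<^sup>2 / 2)"
    by (rule progressive_compose2[OF pY pS]) measurable
  have 4: "progressively_measurable F (\<lambda>r \<omega>. c r \<omega> * h (Y r \<omega>) - h' (Y r \<omega>) * \<beta> r \<omega>)"
    by (rule progressive_compose2[OF 1 2]) measurable
  have 5: "progressively_measurable F G"
    unfolding G_def[abs_def] by (rule progressive_compose2[OF 4 3]) measurable
  show ?thesis by (rule progressive_compose2[OF pA 5]) measurable
qed

lemma discounted_G_abs: "\<omega> \<in> space M \<Longrightarrow> \<bar>exp (- A r \<omega>) * G r \<omega>\<bar> \<le> 3 * C^3"
proof -
  assume \<omega>: "\<omega> \<in> space M"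
  have "\<bar>exp (- A r \<omega>)\<bar> * \<bar>G r \<omega>\<bar> \<le> 1 * (3 * C^3)"
    using G_abs[OF \<omega>] A_nonneg[OF \<omega>] C by (intro mult_mono) auto
  then show ?thesis by (simp add: abs_mult)
qed

text \<open>By Dynkin's formula \<open>e t\<close> plus the integral of \<open>\<gamma>\<close> up
  to \<open>t\<close> would be constant; of this only the inequality in one direction is
  proved.\<close>

definition e :: "real \<Rightarrow> real" where "e t = expectation (\<lambda>\<omega>. exp (- A t \<omega>) * h (Y t \<omega>))"
definition \<gamma> :: "real \<Rightarrow> real" where "\<gamma> r = expectation (\<lambda>\<omega>. exp (- A r \<omega>) * G r \<omega>)"

lemma \<gamma>_integrable: "0 \<le> s \<Longrightarrow> s \<le> t \<Longrightarrow> set_integrable lborel {s<..t} \<gamma>"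
  using progressive_Fubini(1)[OF G_progressive discounted_G_abs, of "\<lambda>_. 1" 1 s t]
  by (simp add: \<gamma>_def[abs_def])

text \<open>Only what moves continuously is frozen at time \<open>s\<close>: the position and the
  discount. The processes \<open>\<beta>\<close> and \<open>c\<close> stay at time \<open>r\<close>,
  since they need not be continuous in time; integrated over the step they reproduce exactly the
  drift and the killing of the one-step expansion.\<close>

lemma frozen_generator_bound:
  assumes \<omega>: "\<omega> \<in> space M" and st: "0 \<le> s" "s < r" "r \<le> t" "t - s \<le> 1"
    and b: "breakpoints S \<inter> {s<..<t} = {}"
    and mod: "\<And>p q. \<bar>h q - h p\<bar> \<le> \<eta> + K * (q - p)\<^sup>2" "\<And>p q. \<bar>h' q - h' p\<bar> \<le> \<eta> + K * (q - p)\<^sup>2"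
      "\<And>p q. \<bar>h'' q - h'' p\<bar> \<le> \<eta> + K * (q - p)\<^sup>2"
    and K: "0 \<le> K" and \<eta>: "0 < \<eta>"
  shows "exp (- A r \<omega>) * G r \<omega> \<le>
    exp (- A s \<omega>) * (c r \<omega> * h (Y s \<omega>) - h' (Y s \<omega>) * \<beta> r \<omega> - h'' (Y s \<omega>) * (simple_value S t \<omega>)\<^sup>2 / 2) +
    (3 * C^4 * (t - s) + 3 * C\<^sup>2 * (\<eta> + K * (2 * C\<^sup>2 * (t - s)))) + 6 * C^4 * K * (W r \<omega> - W s \<omega>)\<^sup>2"
proof -
  define G0 where "G0 = c r \<omega> * h (Y s \<omega>) - h' (Y s \<omega>) * \<beta> r \<omega> - h'' (Y s \<omega>) * (simple_value S t \<omega>)\<^sup>2 / 2"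
  define \<xi> where "\<xi> = simple_value S t \<omega>"
  define w where "w = W r \<omega> - W s \<omega>"
  define D where "D = (LBINT q:{s<..r}. \<beta> q \<omega>)"
  define d where "d = D + \<xi> * w"
  have sb: "s < t" using st by simp
  note between = simple_between_breakpoints[OF S(1) st(1) sb b]
  have Yr: "Y r \<omega> = Y s \<omega> + d"
    using progressive_bounded_section(4)[OF \<beta> \<omega> st(1), of r] between(3)[OF st(2,3), of \<omega>] st
    by (simp add: Y_def D_def d_def \<xi>_def w_def)
  have \<xi>: "simple_value S r \<omega> = \<xi>" "\<bar>\<xi>\<bar> \<le> C"
    using between(2)[OF st(2,3), of \<omega>] S(2)[OF \<omega>] by (auto simp: \<xi>_def)
  have "\<bar>D\<bar> \<le> C * (r - s)"
    using progressive_bounded_section(3)[OF \<beta> \<omega> st(1), of r] st by (simp add: D_def)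
  then have D: "\<bar>D\<bar> \<le> C * (t - s)" using st C mult_left_mono[of "r - s" "t - s" C] by linarith
  have d2: "d\<^sup>2 \<le> 2 * C\<^sup>2 * ((t - s) + w\<^sup>2)"
  proof -
    have "d\<^sup>2 \<le> 2 * D\<^sup>2 + 2 * (\<xi> * w)\<^sup>2" unfolding d_def
      using zero_le_power2[of "D - \<xi> * w"] by (simp add: power2_eq_square algebra_simps)
    moreover have "D\<^sup>2 \<le> C\<^sup>2 * (t - s)\<^sup>2"
      using power_mono[OF D, of 2] by (simp add: power_mult_distrib)
    moreover have "C\<^sup>2 * (t - s)\<^sup>2 \<le> C\<^sup>2 * (t - s)"
      using st by (intro mult_left_mono) (auto simp: power2_eq_square mult_left_le)
    moreover have "(\<xi> * w)\<^sup>2 \<le> C\<^sup>2 * w\<^sup>2"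
      using power_mono[OF \<xi>(2), of 2] by (simp add: power_mult_distrib mult_right_mono)
    ultimately show ?thesis by (simp add: algebra_simps)
  qed
  define m where "m = \<eta> + K * d\<^sup>2"
  have m: "0 \<le> m" "m \<le> \<eta> + K * (2 * C\<^sup>2 * ((t - s) + w\<^sup>2))"
    unfolding m_def using d2 K \<eta> by (auto intro!: mult_left_mono add_nonneg_nonneg)
  have "\<bar>G r \<omega> - G0\<bar> \<le> 3 * C\<^sup>2 * m"
  proof -
    have "G r \<omega> - G0 = c r \<omega> * (h (Y r \<omega>) - h (Y s \<omega>)) - (h' (Y r \<omega>) - h' (Y s \<omega>)) * \<beta> r \<omega> - (h'' (Y r \<omega>) - h'' (Y s \<omega>)) * \<xi>\<^sup>2 / 2"
      unfolding G_def G0_def \<xi> \<xi>_def[symmetric] by (simp add: algebra_simps diff_divide_distrib)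
    moreover have "\<bar>c r \<omega> * (h (Y r \<omega>) - h (Y s \<omega>))\<bar> \<le> C * m" unfolding abs_mult
      using c_abs[OF \<omega>] mod(1)[of "Y r \<omega>" "Y s \<omega>"] C by (intro mult_mono) (auto simp: m_def Yr)
    moreover have "\<bar>(h' (Y r \<omega>) - h' (Y s \<omega>)) * \<beta> r \<omega>\<bar> \<le> m * C" unfolding abs_mult
      using \<beta>(2)[OF \<omega>] mod(2)[of "Y r \<omega>" "Y s \<omega>"] m by (intro mult_mono) (auto simp: m_def Yr)
    moreover have "\<bar>(h'' (Y r \<omega>) - h'' (Y s \<omega>)) * \<xi>\<^sup>2\<bar> \<le> m * C\<^sup>2" unfolding abs_mult
      using power_mono[OF \<xi>(2), of 2] mod(3)[of "Y r \<omega>" "Y s \<omega>"] m by (intro mult_mono) (auto simp: m_def Yr)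
    moreover have "C * m \<le> C\<^sup>2 * m" "0 \<le> C\<^sup>2 * m"
      using C m power_increasing[of 1 2 C] by (auto intro: mult_right_mono)
    ultimately show ?thesis by (simp add: mult.commute)
  qed
  then have GG: "G r \<omega> \<le> G0 + 3 * C\<^sup>2 * m" by linarith
  define cb where "cb = (LBINT q:{s<..r}. c q \<omega>)"
  have Ar: "A r \<omega> = A s \<omega> + cb" "0 \<le> cb" "cb \<le> C * (r - s)"
    using A_increment[OF \<omega> st(1), of r] st by (auto simp: cb_def)
  have cb: "cb \<le> C * (t - s)" using Ar st C mult_left_mono[of "r - s" "t - s" C] by linarith
  \<comment> \<open>\<open>G\<close> has no sign, so removing the discount of the step costs
    \<open>cb * \<bar>G r \<omega>\<bar>\<close>, which is of order \<open>t - s\<close>.\<close>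
  have 1: "exp (- cb) * G r \<omega> \<le> G r \<omega> + cb * \<bar>G r \<omega>\<bar>"
  proof -
    have "(1 - exp (- cb)) * (- G r \<omega>) \<le> (1 - exp (- cb)) * \<bar>G r \<omega>\<bar>"
      using Ar by (intro mult_left_mono) auto
    also have "\<dots> \<le> cb * \<bar>G r \<omega>\<bar>"
      using exp_ge_add_one_self[of "- cb"] by (intro mult_right_mono) auto
    finally show ?thesis by (simp add: algebra_simps)
  qed
  have 2: "cb * \<bar>G r \<omega>\<bar> \<le> (C * (t - s)) * (3 * C^3)"
  proof (rule mult_mono)
    show "0 \<le> C * (t - s)" using C st by simp
  qed (use cb Ar(2) G_abs[OF \<omega>, of r] in auto)
  have "exp (- cb) * G r \<omega> \<le> G0 + (3 * C\<^sup>2 * m + (C * (t - s)) * (3 * C^3))"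
    using 1 2 GG by linarith
  then have "exp (- A s \<omega>) * (exp (- cb) * G r \<omega>) \<le> exp (- A s \<omega>) * (G0 + (3 * C\<^sup>2 * m + (C * (t - s)) * (3 * C^3)))"
    by (rule mult_left_mono) simp
  also have "exp (- A s \<omega>) * (exp (- cb) * G r \<omega>) = (exp (- A s \<omega>) * exp (- cb)) * G r \<omega>" by simp
  also have "exp (- A s \<omega>) * exp (- cb) = exp (- A r \<omega>)" by (simp add: Ar exp_add[symmetric])
  also have "exp (- A s \<omega>) * (G0 + (3 * C\<^sup>2 * m + (C * (t - s)) * (3 * C^3)))
      \<le> exp (- A s \<omega>) * G0 + 1 * (3 * C\<^sup>2 * m + (C * (t - s)) * (3 * C^3))"
    unfolding distrib_left[of "exp (- A s \<omega>)" G0] using A_nonneg[OF \<omega>, of s] m C st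
    by (intro add_left_mono mult_right_mono add_nonneg_nonneg mult_nonneg_nonneg) auto
  finally have "exp (- A r \<omega>) * G r \<omega> \<le> exp (- A s \<omega>) * G0 + (3 * C\<^sup>2 * m + (C * (t - s)) * (3 * C^3))"
    by simp
  moreover have "3 * C\<^sup>2 * m \<le> 3 * C\<^sup>2 * (\<eta> + K * (2 * C\<^sup>2 * ((t - s) + w\<^sup>2)))"
    using m by (intro mult_left_mono) auto
  ultimately show ?thesis
    unfolding G0_def[symmetric] w_def by (simp add: algebra_simps power2_eq_square power3_eq_cube power4_eq_xxxx)
qed

lemma bounded_integrable:
  "f \<in> borel_measurable M \<Longrightarrow> (\<And>\<omega>. \<omega> \<in> space M \<Longrightarrow> \<bar>f \<omega>\<bar> \<le> B) \<Longrightarrow> integrable M f" for f :: "'a \<Rightarrow> real"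
  by (rule integrable_const_bound[of _ B]) auto

lemma one_step:
  assumes st: "0 \<le> s" "s < t" "t - s \<le> 1" and b: "breakpoints S \<inter> {s<..<t} = {}"
    and mod: "\<And>p q. \<bar>h q - h p\<bar> \<le> \<eta> + K * (q - p)\<^sup>2" "\<And>p q. \<bar>h' q - h' p\<bar> \<le> \<eta> + K * (q - p)\<^sup>2"
      "\<And>p q. \<bar>h'' q - h'' p\<bar> \<le> \<eta> + K * (q - p)\<^sup>2"
    and K: "0 \<le> K" and \<eta>: "0 < \<eta>" and \<delta>: "\<delta> = t - s"
  shows "e t - e s + (LBINT r:{s<..t}. \<gamma> r) \<le> \<delta> *
    (\<eta> * C\<^sup>2 * \<delta> + 4 * K * C^4 * \<delta>^3 + 2 * C^3 * \<eta> + 2 * C^3 * \<delta> + 2 * C^3 * K * \<delta>\<^sup>2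
     + (\<eta> * C\<^sup>2 + C^3 * \<delta> / \<eta> + 2 * C^3 * \<delta> * K) + 12 * K * C^4 * \<delta>
     + (3 * C^4 * \<delta> + 3 * C\<^sup>2 * (\<eta> + K * (2 * C\<^sup>2 * \<delta>)) + 6 * C^4 * K * \<delta>))"
proof -
  define \<zeta> where "\<zeta> \<omega> = exp (- A s \<omega>)" for \<omega>
  define D where "D \<omega> = (LBINT q:{s<..t}. \<beta> q \<omega>)" for \<omega>
  define cb where "cb \<omega> = (LBINT q:{s<..t}. c q \<omega>)" for \<omega>
  define \<xi> where "\<xi> = simple_value S t"
  define w where "w r \<omega> = W r \<omega> - W s \<omega>" for r \<omega>
  \<comment> \<open>Coefficients of the expansion at time \<open>s\<close>. They are measurable for
    \<open>F s\<close>, so powers of the increment factor out of the expectation; \<open>D\<close>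
    and \<open>cb\<close> need not be, and stay inside it.\<close>
  define Z0 where "Z0 \<omega> = \<zeta> \<omega> * h (Y s \<omega>)" for \<omega>
  define Z1 where "Z1 \<omega> = \<zeta> \<omega> * h' (Y s \<omega>)" for \<omega>
  define Z2 where "Z2 \<omega> = Z1 \<omega> * \<xi> \<omega>" for \<omega>
  define Z3 where "Z3 \<omega> = \<zeta> \<omega> * h'' (Y s \<omega>) * (\<xi> \<omega>)\<^sup>2 / 2" for \<omega>
  define E1 where "E1 = \<eta> * C\<^sup>2 * \<delta>\<^sup>2 + 4 * K * C^4 * \<delta>^4 + 2 * C^3 * \<delta> * \<eta> + 2 * C^3 * \<delta>\<^sup>2 + 2 * C^3 * K * \<delta>^3"
  define E2 where "E2 = \<eta> * C\<^sup>2 + C^3 * \<delta> / \<eta> + 2 * C^3 * \<delta> * K"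
  define E3 where "E3 = 4 * K * C^4"
  define R where "R = 3 * C^4 * \<delta> + 3 * C\<^sup>2 * (\<eta> + K * (2 * C\<^sup>2 * \<delta>))"
  define R' where "R' = 6 * C^4 * K"
  have \<delta>0: "0 < \<delta>" "\<delta> \<le> 1" using st \<delta> by auto
  note between = simple_between_breakpoints[OF S(1) st(1,2) b]
  have mF: "\<zeta> \<in> borel_measurable (F s)" "\<xi> \<in> borel_measurable (F s)" "Y s \<in> borel_measurable (F s)"
    using A_measurable[OF st(1)] Y_measurable[OF st(1)] between(1) by (auto simp: \<zeta>_def[abs_def] \<xi>_def)
  have Z_F: "Z0 \<in> borel_measurable (F s)" "Z1 \<in> borel_measurable (F s)" "Z2 \<in> borel_measurable (F s)" "Z3 \<in> borel_measurable (F s)"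
    using mF by (auto simp: Z0_def[abs_def] Z1_def[abs_def] Z2_def[abs_def] Z3_def[abs_def])
  note Z_M = Z_F[THEN measurable_F_M[OF st(1)]]
  have \<zeta>: "0 \<le> \<zeta> \<omega>" "\<zeta> \<omega> \<le> 1" if "\<omega> \<in> space M" for \<omega>
    using A_nonneg[OF that] by (auto simp: \<zeta>_def)
  have \<xi>_C: "\<bar>\<xi> \<omega>\<bar> \<le> C" if "\<omega> \<in> space M" for \<omega> using S(2)[OF that] by (simp add: \<xi>_def)
  have Z0_b: "\<bar>Z0 \<omega>\<bar> \<le> 1 * C" if "\<omega> \<in> space M" for \<omega>
    unfolding Z0_def abs_mult using \<zeta>[OF that] hbound C by (intro mult_mono) auto
  have Z1_b: "\<bar>Z1 \<omega>\<bar> \<le> 1 * C" if "\<omega> \<in> space M" for \<omega>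
    unfolding Z1_def abs_mult using \<zeta>[OF that] hbound C by (intro mult_mono) auto
  have Z2_b: "\<bar>Z2 \<omega>\<bar> \<le> (1 * C) * C" if "\<omega> \<in> space M" for \<omega>
    unfolding Z2_def abs_mult using Z1_b[OF that] \<xi>_C[OF that] C by (intro mult_mono) auto
  have Z3_b: "\<bar>Z3 \<omega>\<bar> \<le> (1 * C) * C\<^sup>2 / 2" if "\<omega> \<in> space M" for \<omega>
  proof -
    have "\<bar>\<zeta> \<omega> * h'' (Y s \<omega>) * (\<xi> \<omega>)\<^sup>2\<bar> \<le> (1 * C) * C\<^sup>2"
      unfolding abs_mult using \<zeta>[OF that] hbound C power_mono[OF \<xi>_C[OF that], of 2]
      by (intro mult_mono) auto
    then show ?thesis by (simp add: Z3_def)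
  qed
  have D_b: "\<bar>D \<omega>\<bar> \<le> C * \<delta>" if "\<omega> \<in> space M" for \<omega>
    using progressive_bounded_section(3)[OF \<beta> that st(1), of t] st by (simp add: D_def \<delta>)
  have D_eq: "Y t \<omega> = Y s \<omega> + D \<omega> + \<xi> \<omega> * w t \<omega>" if "\<omega> \<in> space M" for \<omega>
    using progressive_bounded_section(4)[OF \<beta> that st(1), of t] between(3)[OF st(2), of \<omega>] st
    by (simp add: Y_def D_def \<xi>_def w_def)
  have D_M: "D \<in> borel_measurable M"
  proof -
    have "(\<lambda>\<omega>. (LBINT q:{0..t}. \<beta> q \<omega>) - (LBINT q:{0..s}. \<beta> q \<omega>)) \<in> borel_measurable M"
      using st by (intro borel_measurable_diff measurable_F_M[OF _ progressive_LBINT_measurable[OF \<beta>(1)]]) auto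
    then show ?thesis
      by (rule measurable_cong[THEN iffD1, rotated])
         (use progressive_bounded_section(4)[OF \<beta> _ st(1), of _ t] st in \<open>auto simp: D_def\<close>)
  qed
  have cb: "A t \<omega> = A s \<omega> + cb \<omega>" "0 \<le> cb \<omega>" "cb \<omega> \<le> C * \<delta>" if "\<omega> \<in> space M" for \<omega>
    using A_increment[OF that st(1), of t] st by (auto simp: cb_def \<delta>)
  have cb_M: "cb \<in> borel_measurable M"
  proof -
    have "(\<lambda>\<omega>. A t \<omega> - A s \<omega>) \<in> borel_measurable M"
      using st by (intro borel_measurable_diff measurable_F_M[OF _ A_measurable]) auto
    then show ?thesis
      by (rule measurable_cong[THEN iffD1, rotated]) (use cb in auto)
  qed
  have iZ0: "integrable M Z0" and iZ3: "integrable M Z3"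
    using bounded_integrable Z_M Z0_b Z3_b by blast+
  have iZ1D: "integrable M (\<lambda>\<omega>. Z1 \<omega> * D \<omega>)"
  proof (rule bounded_integrable[where B = "(1 * C) * (C * \<delta>)"])
    show "\<bar>Z1 \<omega> * D \<omega>\<bar> \<le> (1 * C) * (C * \<delta>)" if "\<omega> \<in> space M" for \<omega>
      unfolding abs_mult using Z1_b[OF that] D_b[OF that] C by (intro mult_mono) auto
  qed (use Z_M D_M in auto)
  have iZ0c: "integrable M (\<lambda>\<omega>. Z0 \<omega> * cb \<omega>)"
  proof (rule bounded_integrable[where B = "(1 * C) * (C * \<delta>)"])
    show "\<bar>Z0 \<omega> * cb \<omega>\<bar> \<le> (1 * C) * (C * \<delta>)" if "\<omega> \<in> space M" for \<omega>
      unfolding abs_mult using Z0_b[OF that] cb[OF that] C by (intro mult_mono) auto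
  qed (use Z_M cb_M in auto)
  note wZ2 = bounded_times_W_increment_power[OF st(1,2) Z_F(3) Z2_b, of 1, folded w_def]
  note wZ3 = bounded_times_W_increment_power[OF st(1,2) Z_F(4) Z3_b, of 2, folded w_def]
  note wi = W_increment_power_integrable[OF st(1,2), folded w_def]
  note wm = W_increment_moments[OF st(1,2), folded w_def \<delta>]
  let ?f = "\<lambda>\<omega>. Z0 \<omega> + Z1 \<omega> * D \<omega> + Z2 \<omega> * w t \<omega> ^ 1 + Z3 \<omega> * (w t \<omega>)\<^sup>2 - Z0 \<omega> * cb \<omega> + E1 + E2 * (w t \<omega>)\<^sup>2 + E3 * w t \<omega> ^ 4"
  have e_le: "e t \<le> expectation (\<lambda>\<omega>. ?f \<omega>)"
    unfolding e_def
  proof (rule integral_mono)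
    have t0: "0 \<le> t" using st by simp
    have [measurable]: "A t \<in> borel_measurable M" "Y t \<in> borel_measurable M"
      by (rule measurable_F_M[OF t0 A_measurable[OF t0]], rule measurable_F_M[OF t0 Y_measurable[OF t0]])
    have "(\<lambda>\<omega>. exp (- A t \<omega>) * h (Y t \<omega>)) \<in> borel_measurable M" by measurable
    then show "integrable M (\<lambda>\<omega>. exp (- A t \<omega>) * h (Y t \<omega>))"
    proof (rule bounded_integrable[where B = "1 * C"])
      show "\<bar>exp (- A t \<omega>) * h (Y t \<omega>)\<bar> \<le> 1 * C" if "\<omega> \<in> space M" for \<omega>
        unfolding abs_mult using A_nonneg[OF that] hbound C by (intro mult_mono) auto
    qed
    show "integrable M (\<lambda>\<omega>. ?f \<omega>)"
      by (intro Bochner_Integration.integrable_add Bochner_Integration.integrable_diff integrable_mult_right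
          iZ0 iZ1D iZ0c wZ2(1) wZ3(1) wi integrable_const)
    fix \<omega> assume \<omega>: "\<omega> \<in> space M"
    show "exp (- A t \<omega>) * h (Y t \<omega>) \<le> ?f \<omega>"
      using discounted_taylor_bound[OF h mod(1,3) hbound(1,2,4) C K \<eta> \<delta>0 D_b[OF \<omega>] \<xi>_C[OF \<omega>] cb(2,3)[OF \<omega>] A_nonneg[OF \<omega>, of s], of "Y s \<omega>" "w t \<omega>"]
      unfolding cb(1)[OF \<omega>] D_eq[OF \<omega>] Z0_def Z1_def Z2_def Z3_def \<zeta>_def E1_def E2_def E3_def
      by (simp add: algebra_simps)
  qed
  also have "\<dots> = expectation Z0 + expectation (\<lambda>\<omega>. Z1 \<omega> * D \<omega>) + expectation Z3 * \<delta> - expectation (\<lambda>\<omega>. Z0 \<omega> * cb \<omega>)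
      + E1 + E2 * \<delta> + E3 * (3 * \<delta>\<^sup>2)"
    using iZ0 iZ1D iZ0c wZ2 wZ3 wi[of 2] wi[of 4] wm by (simp add: prob_space)
  finally have e_t: "e t \<le> \<dots>" .
  have e_s: "e s = expectation Z0" by (simp add: e_def Z0_def[abs_def] \<zeta>_def)
  have bM: "\<beta> r \<in> borel_measurable M" "c r \<in> borel_measurable M" if "0 \<le> r" for r
    using measurable_F_M[OF that] progressive_measurable_F[OF _ that] \<beta> c by blast+
  have \<gamma>_le: "\<gamma> r \<le> expectation (\<lambda>\<omega>. Z0 \<omega> * c r \<omega>) - expectation (\<lambda>\<omega>. Z1 \<omega> * \<beta> r \<omega>) - expectation Z3 + R + R' * \<delta>"
    if r: "s < r" "r \<le> t" for r
  proof -
    have r0: "0 \<le> r" using r st by simp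
    note wi = W_increment_power_integrable[OF st(1) r(1), folded w_def]
    have i1: "integrable M (\<lambda>\<omega>. Z0 \<omega> * c r \<omega>)"
    proof (rule bounded_integrable[where B = "(1 * C) * C"])
      show "\<bar>Z0 \<omega> * c r \<omega>\<bar> \<le> (1 * C) * C" if "\<omega> \<in> space M" for \<omega>
        unfolding abs_mult using Z0_b[OF that] c_abs[OF that] C by (intro mult_mono) auto
    qed (use Z_M bM[OF r0] in auto)
    have i2: "integrable M (\<lambda>\<omega>. Z1 \<omega> * \<beta> r \<omega>)"
    proof (rule bounded_integrable[where B = "(1 * C) * C"])
      show "\<bar>Z1 \<omega> * \<beta> r \<omega>\<bar> \<le> (1 * C) * C" if "\<omega> \<in> space M" for \<omega>
        unfolding abs_mult using Z1_b[OF that] \<beta>(2)[OF that] C by (intro mult_mono) auto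
    qed (use Z_M bM[OF r0] in auto)
    let ?f = "\<lambda>\<omega>. Z0 \<omega> * c r \<omega> - Z1 \<omega> * \<beta> r \<omega> - Z3 \<omega> + R + R' * (w r \<omega>)\<^sup>2"
    have "\<gamma> r \<le> expectation (\<lambda>\<omega>. ?f \<omega>)"
      unfolding \<gamma>_def
    proof (rule integral_mono)
      have "(\<lambda>\<omega>. exp (- A r \<omega>) * G r \<omega>) \<in> borel_measurable M"
        using measurable_F_M[OF r0 progressive_measurable_F[OF G_progressive r0]] .
      then show "integrable M (\<lambda>\<omega>. exp (- A r \<omega>) * G r \<omega>)"
        by (rule bounded_integrable) (rule discounted_G_abs)
      show "integrable M (\<lambda>\<omega>. ?f \<omega>)"
        by (intro Bochner_Integration.integrable_add Bochner_Integration.integrable_diff integrable_mult_right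
            i1 i2 iZ3 wi integrable_const)
      fix \<omega> assume \<omega>: "\<omega> \<in> space M"
      show "exp (- A r \<omega>) * G r \<omega> \<le> ?f \<omega>"
        using frozen_generator_bound[OF \<omega> st(1) r st(3) b mod K \<eta>]
        unfolding Z0_def Z1_def Z3_def R_def R'_def \<delta> w_def \<zeta>_def \<xi>_def by (simp add: algebra_simps)
    qed
    also have "\<dots> = expectation (\<lambda>\<omega>. Z0 \<omega> * c r \<omega>) - expectation (\<lambda>\<omega>. Z1 \<omega> * \<beta> r \<omega>) - expectation Z3 + R + R' * (r - s)"
      using i1 i2 iZ3 wi[of 2] W_increment_moments(2)[OF st(1) r(1), folded w_def] by (simp add: prob_space)
    also have "R' * (r - s) \<le> R' * \<delta>" using r K C by (intro mult_left_mono) (auto simp: R'_def \<delta>)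
    finally show ?thesis by simp
  qed
  note Fc = progressive_Fubini[OF c(1) c_abs Z_M(1) Z0_b st(1), of t]
  note F\<beta> = progressive_Fubini[OF \<beta> Z_M(2) Z1_b st(1), of t]
  have ci: "set_integrable lborel {s<..t} (\<lambda>r. k :: real)" for k
    using st by (auto simp: set_integrable_def intro!: integrable_real_indicator)
  \<comment> \<open>Integrating over \<open>r\<close> and exchanging with the expectation turns
    \<open>c r\<close> and \<open>\<beta> r\<close> into \<open>cb\<close> and \<open>D\<close>, the
    quantities that occur in the bound for \<open>e t\<close>.\<close>
  have "(LBINT r:{s<..t}. \<gamma> r) \<le> (LBINT r:{s<..t}. expectation (\<lambda>\<omega>. Z0 \<omega> * c r \<omega>) - expectation (\<lambda>\<omega>. Z1 \<omega> * \<beta> r \<omega>) + (- expectation Z3 + R + R' * \<delta>))"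
    using st Fc F\<beta> \<gamma>_le ci by (intro set_integral_mono \<gamma>_integrable set_integral_add set_integral_diff) force+
  also have "\<dots> = (LBINT r:{s<..t}. expectation (\<lambda>\<omega>. Z0 \<omega> * c r \<omega>)) - (LBINT r:{s<..t}. expectation (\<lambda>\<omega>. Z1 \<omega> * \<beta> r \<omega>)) + (LBINT r:{s<..t}. - expectation Z3 + R + R' * \<delta>)"
    using st Fc(1) F\<beta>(1) ci by (simp add: set_integral_add set_integral_diff)
  also have "(LBINT r:{s<..t}. - expectation Z3 + R + R' * \<delta>) = (- expectation Z3 + R + R' * \<delta>) * \<delta>"
    using st by (simp add: set_lebesgue_integral_def \<delta>)
  also have "(LBINT r:{s<..t}. expectation (\<lambda>\<omega>. Z0 \<omega> * c r \<omega>)) = expectation (\<lambda>\<omega>. Z0 \<omega> * cb \<omega>)"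
    using Fc(2) st by (simp add: cb_def)
  also have "(LBINT r:{s<..t}. expectation (\<lambda>\<omega>. Z1 \<omega> * \<beta> r \<omega>)) = expectation (\<lambda>\<omega>. Z1 \<omega> * D \<omega>)"
    using F\<beta>(2) st by (simp add: D_def)
  finally have "e t - e s + (LBINT r:{s<..t}. \<gamma> r) \<le> E1 + E2 * \<delta> + E3 * (3 * \<delta>\<^sup>2) + (R + R' * \<delta>) * \<delta>"
    using e_t e_s by (simp add: algebra_simps)
  also have "\<dots> = \<delta> *
    (\<eta> * C\<^sup>2 * \<delta> + 4 * K * C^4 * \<delta>^3 + 2 * C^3 * \<eta> + 2 * C^3 * \<delta> + 2 * C^3 * K * \<delta>\<^sup>2
     + E2 + 12 * K * C^4 * \<delta> + (R + R' * \<delta>))"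
    unfolding E1_def E3_def by (simp add: algebra_simps power2_eq_square power3_eq_cube power4_eq_xxxx)
  finally show ?thesis unfolding E2_def R_def R'_def .
qed

text \<open>The one-step errors add up to at most \<open>\<epsilon>'\<close> over a fine partition.
  The constants are chosen in the order \<open>\<eta>\<close>, \<open>K\<close>, step length: the
  term \<open>C^3 * \<delta> / \<eta>\<close> and the terms with \<open>K\<close> are harmless only
  in this order.\<close>

lemma supermartingale_inequality:
  assumes T: "0 < T"
  shows "(LBINT r:{0<..T}. \<gamma> r) \<le> h x"
proof (rule field_le_epsilon)
  fix \<epsilon>' :: real assume "0 < \<epsilon>'"
  define \<epsilon> where "\<epsilon> = \<epsilon>' / T"
  have \<epsilon>: "0 < \<epsilon>" using \<open>0 < \<epsilon>'\<close> T by (simp add: \<epsilon>_def)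
  define k where "k = 2 * C^3 + 4 * C\<^sup>2"
  define \<eta> where "\<eta> = \<epsilon> / (2 * k)"
  have C0: "0 < k" unfolding k_def using C by (intro mult_pos_pos add_pos_pos) auto
  have \<eta>: "0 < \<eta>" using \<epsilon> C0 by (simp add: \<eta>_def)
  have habs: "\<bar>h y\<bar> \<le> C" for y using hbound(1,2)[of y] by simp
  obtain K0 where K0: "\<And>K p q. K0 \<le> K \<Longrightarrow> \<bar>h q - h p\<bar> \<le> \<eta> + K * (q - p)\<^sup>2"
    using uniformly_continuous_bounded_modulus[OF ucont(1) habs \<eta>] by blast
  obtain K1 where K1: "\<And>K p q. K1 \<le> K \<Longrightarrow> \<bar>h' q - h' p\<bar> \<le> \<eta> + K * (q - p)\<^sup>2"
    using uniformly_continuous_bounded_modulus[OF ucont(2) hbound(3) \<eta>] by blast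
  obtain K2 where K2: "\<And>K p q. K2 \<le> K \<Longrightarrow> \<bar>h'' q - h'' p\<bar> \<le> \<eta> + K * (q - p)\<^sup>2"
    using uniformly_continuous_bounded_modulus[OF ucont(3) hbound(4) \<eta>] by blast
  define K where "K = max 0 (max K0 (max K1 K2))"
  have K: "0 \<le> K" and mod: "\<And>p q. \<bar>h q - h p\<bar> \<le> \<eta> + K * (q - p)\<^sup>2"
    "\<And>p q. \<bar>h' q - h' p\<bar> \<le> \<eta> + K * (q - p)\<^sup>2" "\<And>p q. \<bar>h'' q - h'' p\<bar> \<le> \<eta> + K * (q - p)\<^sup>2"
    using K0[of K] K1[of K] K2[of K] by (auto simp: K_def)
  define \<rho> where "\<rho> \<delta> = \<eta> * C\<^sup>2 * \<delta> + 4 * K * C^4 * \<delta>^3 + 2 * C^3 * \<eta> + 2 * C^3 * \<delta> + 2 * C^3 * K * \<delta>\<^sup>2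
     + (\<eta> * C\<^sup>2 + C^3 * \<delta> / \<eta> + 2 * C^3 * \<delta> * K) + 12 * K * C^4 * \<delta>
     + (3 * C^4 * \<delta> + 3 * C\<^sup>2 * (\<eta> + K * (2 * C\<^sup>2 * \<delta>)) + 6 * C^4 * K * \<delta>)" for \<delta>
  have "(\<rho> \<longlongrightarrow> \<rho> 0) (at_right 0)"
    unfolding \<rho>_def by (intro tendsto_intros) (use \<eta> in auto)
  moreover have "\<rho> 0 = k * \<eta>" by (simp add: \<rho>_def k_def algebra_simps)
  then have "\<rho> 0 = \<epsilon> / 2" using C0 by (simp add: \<eta>_def)
  then have "\<rho> 0 < \<epsilon>" using \<epsilon> by simp
  ultimately have "\<forall>\<^sub>F \<delta> in at_right 0. \<rho> \<delta> < \<epsilon>" by (rule order_tendstoD(2))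
  then obtain \<delta>0 where \<delta>0: "0 < \<delta>0" "\<And>\<delta>. 0 < \<delta> \<Longrightarrow> \<delta> < \<delta>0 \<Longrightarrow> \<rho> \<delta> < \<epsilon>"
    by (auto simp: eventually_at_right_field)
  \<comment> \<open>Halving turns \<open>t - s \<le> \<delta>1\<close> into a strict inequality
    below \<open>\<delta>0\<close>; the bound 1 is what \<open>one_step\<close> asks for.\<close>
  define \<delta>1 where "\<delta>1 = min 1 (\<delta>0 / 2)"
  \<comment> \<open>The slack is proportional to the length and hence additive, so intervals can be
    cut at the breakpoints of \<open>S\<close> and into steps of length
    \<open>\<delta>1\<close>.\<close>
  define Q where "Q s t \<longleftrightarrow> e t - e s + (LBINT r:{s<..t}. \<gamma> r) \<le> \<epsilon> * (t - s)" for s t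
  have "Q 0 T"
  proof (rule additive_interval_induct[OF finite_breakpoints[of S]])
    show "0 < \<delta>1" using \<delta>0 by (simp add: \<delta>1_def)
    show "Q s v" if "0 \<le> s" "s < t" "t < v" "v \<le> T" "Q s t" "Q t v" for s t v
    proof -
      have "{s<..v} = {s<..t} \<union> {t<..v}" using that by auto
      then have "(LBINT r:{s<..v}. \<gamma> r) = (LBINT r:{s<..t}. \<gamma> r) + (LBINT r:{t<..v}. \<gamma> r)"
        by (simp only:) (intro set_integral_Un \<gamma>_integrable; use that in auto)
      then show ?thesis using that by (simp add: Q_def algebra_simps)
    qed
    show "Q s t" if st: "0 \<le> s" "s < t" "t \<le> T" "t - s \<le> \<delta>1" "breakpoints S \<inter> {s<..<t} = {}" for s t
    proof -
      have "t - s \<le> 1" using st by (simp add: \<delta>1_def)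
      then have "e t - e s + (LBINT r:{s<..t}. \<gamma> r) \<le> (t - s) * \<rho> (t - s)"
        unfolding \<rho>_def by (intro one_step st mod K \<eta>) auto
      also have "\<dots> \<le> (t - s) * \<epsilon>"
        using \<delta>0(2)[of "t - s"] st \<delta>0(1) by (intro mult_left_mono) (auto simp: \<delta>1_def)
      finally show ?thesis by (simp add: Q_def mult.commute)
    qed
  qed (use T in auto)
  \<comment> \<open>The terminal value is discarded here: nonnegativity of \<open>h\<close> leaves a
    bound by \<open>h x\<close> alone.\<close>
  moreover have "0 \<le> e T" unfolding e_def using hbound by (intro Bochner_Integration.integral_nonneg) auto
  moreover have "e 0 = h x"
  proof -
    have "simple_integral W S 0 \<omega> = 0" for \<omega>
    proof -
      have "simple_integral W S 0 \<omega> = (\<Sum>e \<leftarrow> S. 0)"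
        unfolding simple_integral_def
      proof (intro arg_cong[where f = sum_list] map_cong refl)
        fix z assume z: "z \<in> set S"
        obtain s t \<xi> where z_eq: "z = (s, t, \<xi>)" by (cases z)
        have "0 \<le> s" "s \<le> t" using S(1) z unfolding simple_process_def z_eq by fast+
        then show "(case z of (s, t, \<xi>) \<Rightarrow> \<xi> \<omega> * (W (min t 0) \<omega> - W (min s 0) \<omega>)) = 0"
          by (simp add: z_eq)
      qed
      then show ?thesis by simp
    qed
    moreover have "(LBINT q:{0..0}. f q) = 0" for f :: "real \<Rightarrow> real"
      unfolding set_lebesgue_integral_def
      by (rule integral_eq_zero_AE) (use AE_lborel_singleton[of 0] in \<open>eventually_elim, auto\<close>)
    ultimately have "A 0 \<omega> = 0" "Y 0 \<omega> = x" for \<omega>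
      by (auto simp only: A_def Y_def)
    then show ?thesis by (simp add: e_def prob_space)
  qed
  ultimately show "(LBINT r:{0<..T}. \<gamma> r) \<le> h x + \<epsilon>'"
    using T by (simp add: Q_def \<epsilon>_def)
qed

end

section \<open>Convergence on the product of time and probability space\<close>

text \<open>The null sequence \<open>J\<close> may depend on \<open>\<rho>\<close>: both Young's
  inequality and truncation at a level produce estimates of this form.\<close>

lemma ennreal_tendsto_zeroI:
  fixes x :: "nat \<Rightarrow> ennreal"
  assumes "\<And>\<rho>::real. 0 < \<rho> \<Longrightarrow> \<exists>J. J \<longlonglongrightarrow> 0 \<and> (\<forall>k. x k \<le> J k + ennreal \<rho>)"
  shows "x \<longlonglongrightarrow> 0"
proof (rule order_tendstoI)
  fix a :: ennreal assume "0 < a"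
  then obtain \<rho> :: real where \<rho>: "0 < \<rho>" "ennreal \<rho> + ennreal \<rho> \<le> a"
  proof (cases a)
    case (real r)
    then show ?thesis using that[of "r / 2"] \<open>0 < a\<close> by (simp flip: ennreal_plus)
  qed (use that[of 1] in auto)
  obtain J where J: "J \<longlonglongrightarrow> 0" "\<And>k. x k \<le> J k + ennreal \<rho>" using assms[OF \<rho>(1)] by blast
  have "\<forall>\<^sub>F k in sequentially. J k < ennreal \<rho>"
    using order_tendstoD(2)[OF J(1)] \<rho>(1) by simp
  then show "\<forall>\<^sub>F k in sequentially. x k < a"
  proof eventually_elim
    case (elim k)
    have "J k + ennreal \<rho> < ennreal \<rho> + ennreal \<rho>"
      using elim by (simp add: ennreal_add_left_cancel_less add.commute)
    then show ?case using J(2)[of k] \<rho>(2) by order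
  qed
qed simp

text \<open>Since \<open>u^2 - v^2 = (u - v)^2 + 2 * v * (u - v)\<close>, Young's inequality leaves
  a multiple of \<open>(u - v)^2\<close> and an arbitrarily small constant. \<open>H\<close> is
  bounded because it will be \<open>a\<close> along one continuous path.\<close>

lemma nn_square_difference_tendsto:
  fixes s :: "nat \<Rightarrow> real \<Rightarrow> real" and H :: "real \<Rightarrow> real"
  assumes [measurable]: "\<And>k. (\<lambda>q. indicator {0..T} q * s k q) \<in> borel_measurable borel"
      "(\<lambda>q. indicator {0..T} q * H q) \<in> borel_measurable borel"
    and L: "\<And>q. q \<in> {0..T} \<Longrightarrow> \<bar>H q\<bar> \<le> L" and T: "0 < T"
    and lim: "(\<lambda>k. \<integral>\<^sup>+q\<in>{0..T}. ennreal ((s k q - H q)\<^sup>2) \<partial>lborel) \<longlonglongrightarrow> 0"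
  shows "(\<lambda>k. \<integral>\<^sup>+q\<in>{0..T}. ennreal \<bar>(s k q)\<^sup>2 - (H q)\<^sup>2\<bar> \<partial>lborel) \<longlonglongrightarrow> 0"
proof (rule ennreal_tendsto_zeroI)
  fix \<rho>' :: real assume "0 < \<rho>'"
  define \<rho> where "\<rho> = \<rho>' / T"
  have \<rho>: "0 < \<rho>" "\<rho>' = \<rho> * T" using \<open>0 < \<rho>'\<close> T by (auto simp: \<rho>_def)
  define c where "c = 1 + L\<^sup>2 / \<rho>"
  have c: "0 \<le> c" using \<rho> by (simp add: c_def)
  define J where "J k = ennreal c * (\<integral>\<^sup>+q\<in>{0..T}. ennreal ((s k q - H q)\<^sup>2) \<partial>lborel)" for k
  have "J \<longlonglongrightarrow> ennreal c * 0"
    unfolding J_def by (intro ennreal_tendsto_cmult lim) simp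
  moreover have "(\<integral>\<^sup>+q\<in>{0..T}. ennreal \<bar>(s k q)\<^sup>2 - (H q)\<^sup>2\<bar> \<partial>lborel) \<le> J k + ennreal \<rho>'" for k
  proof -
    have bound: "\<bar>u\<^sup>2 - v\<^sup>2\<bar> \<le> c * (u - v)\<^sup>2 + \<rho>" if v: "\<bar>v\<bar> \<le> L" for u v :: real
    proof -
      have "u\<^sup>2 - v\<^sup>2 = (u - v)\<^sup>2 + 2 * v * (u - v)" by (simp add: power2_eq_square algebra_simps)
      then have "\<bar>u\<^sup>2 - v\<^sup>2\<bar> \<le> (u - v)\<^sup>2 + 2 * \<bar>v\<bar> * \<bar>u - v\<bar>"
        using abs_triangle_ineq[of "(u - v)\<^sup>2" "2 * v * (u - v)"] by (simp add: abs_mult)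
      also have "2 * \<bar>v\<bar> * \<bar>u - v\<bar> \<le> 2 * L * \<bar>u - v\<bar>" using v by (intro mult_right_mono) auto
      also have "2 * L * \<bar>u - v\<bar> \<le> \<rho> + L\<^sup>2 / \<rho> * (u - v)\<^sup>2"
      proof -
        define z where "z = \<bar>u - v\<bar>"
        have "0 \<le> (\<rho> - L * z)\<^sup>2 / \<rho>" using \<rho> by simp
        also have "\<dots> = \<rho> - 2 * L * z + L\<^sup>2 / \<rho> * z\<^sup>2"
          using \<rho>(1) by (simp add: field_simps power2_eq_square)
        finally show ?thesis by (simp add: z_def)
      qed
      finally show ?thesis by (simp add: c_def algebra_simps)
    qed
    have eq: "ennreal ((s k q - H q)\<^sup>2) * indicator {0..T} q = ennreal ((indicator {0..T} q * s k q - indicator {0..T} q * H q)\<^sup>2)" for q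
      by (auto simp: indicator_def)
    have [measurable]: "(\<lambda>q. ennreal ((s k q - H q)\<^sup>2) * indicator {0..T} q) \<in> borel_measurable borel"
      unfolding eq by measurable
    have "(\<integral>\<^sup>+q\<in>{0..T}. ennreal \<bar>(s k q)\<^sup>2 - (H q)\<^sup>2\<bar> \<partial>lborel)
        \<le> (\<integral>\<^sup>+q. ennreal c * (ennreal ((s k q - H q)\<^sup>2) * indicator {0..T} q) + ennreal \<rho> * indicator {0..T} q \<partial>lborel)"
    proof (intro nn_integral_mono)
      fix q
      show "ennreal \<bar>(s k q)\<^sup>2 - (H q)\<^sup>2\<bar> * indicator {0..T} q
        \<le> ennreal c * (ennreal ((s k q - H q)\<^sup>2) * indicator {0..T} q) + ennreal \<rho> * indicator {0..T} q"
        using ennreal_leI[OF bound[of "H q" "s k q"]] L[of q] \<rho> c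
        by (auto simp: indicator_def ennreal_mult'[symmetric] simp flip: ennreal_plus)
    qed
    also have "\<dots> = J k + ennreal \<rho> * (\<integral>\<^sup>+q. indicator {0..T} q \<partial>lborel)"
      unfolding J_def by (subst nn_integral_add) (auto simp: nn_integral_cmult)
    also have "ennreal \<rho> * (\<integral>\<^sup>+q. indicator {0..T} q \<partial>lborel) = ennreal \<rho>'"
      using T \<rho> by (simp add: ennreal_mult)
    finally show ?thesis .
  qed
  ultimately show "\<exists>J. J \<longlonglongrightarrow> 0 \<and> (\<forall>k. (\<integral>\<^sup>+q\<in>{0..T}. ennreal \<bar>(s k q)\<^sup>2 - (H q)\<^sup>2\<bar> \<partial>lborel) \<le> J k + ennreal \<rho>')"
    by auto
qed

context filtered_wiener
begin

text \<open>On the product an expectation of a time integral becomes one integral for a finite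
  measure of mass \<open>T\<close>, so that one subsequence and one application of Fatou's lemma
  serve almost all times simultaneously.\<close>

abbreviation time_product :: "real \<Rightarrow> (real \<times> 'a) measure" where
  "time_product T \<equiv> restrict_space lborel {0..T} \<Otimes>\<^sub>M M"

lemma progressive_time_product:
  assumes "progressively_measurable F H" "0 \<le> T"
  shows "(\<lambda>(r, \<omega>). H r \<omega>) \<in> borel_measurable (time_product T)"
proof -
  have "(\<lambda>(r, \<omega>). H r \<omega>) \<in> borel_measurable (restrict_space borel {0..T} \<Otimes>\<^sub>M F T)"
    using assms by (auto simp: progressively_measurable_def)
  moreover have "measurable (restrict_space borel {0..T} \<Otimes>\<^sub>M F T) borel \<subseteq> measurable (time_product T) (borel :: real measure)"
    using assms(2) sets_restrict_space_cong[OF sets_lborel, of "{0..T}"] sets_F_M[OF assms(2)]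
    by (intro measurable_mono)
       (auto simp: space_pair_measure sets_pair_measure space_restrict_space intro!: sigma_sets_mono')
  ultimately show ?thesis by blast
qed

lemma finite_measure_time: "finite_measure (restrict_space lborel {0..T::real})"
  by (rule finite_measureI, cases "0 \<le> T") (auto simp: emeasure_restrict_space space_restrict_space)

lemma pair_sigma_finite_time: "pair_sigma_finite (restrict_space lborel {0..T::real}) M"
  by (intro pair_sigma_finite.intro finite_measure.sigma_finite_measure[OF finite_measure_time] sigma_finite_measure_axioms)

lemma emeasure_time_product: "0 \<le> T \<Longrightarrow> emeasure (time_product T) (space (time_product T)) = ennreal T"
  using sigma_finite_measure.emeasure_pair_measure_Times[of M "{0..T}" "restrict_space lborel {0..T}" "space M"]
  by (auto simp: space_pair_measure space_restrict_space emeasure_restrict_space emeasure_space_1 sigma_finite_measure_axioms sets_restrict_space_iff)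

lemma progressive_time_product_integral:
  assumes H: "progressively_measurable F H" "\<And>q \<omega>. \<omega> \<in> space M \<Longrightarrow> \<bar>H q \<omega>\<bar> \<le> C" and T: "0 \<le> T"
  shows "integrable (time_product T) (\<lambda>(r, \<omega>). H r \<omega>)"
    and "(\<integral>(r, \<omega>). H r \<omega> \<partial>time_product T) = (LBINT r:{0<..T}. expectation (H r))"
proof -
  interpret P: pair_sigma_finite "restrict_space lborel {0..T}" M by (rule pair_sigma_finite_time)
  show i: "integrable (time_product T) (\<lambda>(r, \<omega>). H r \<omega>)"
  proof (rule integrableI_bounded_set[where A = "space (time_product T)" and B = C])
    show "emeasure (time_product T) (space (time_product T)) < \<infinity>"
      using emeasure_time_product[OF T] by simp
    show "AE x\<in>space (time_product T) in time_product T. norm (case x of (r, \<omega>) \<Rightarrow> H r \<omega>) \<le> C"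
      by (rule AE_I2) (auto simp: space_pair_measure H(2))
  qed (use progressive_time_product[OF H(1) T] in \<open>auto intro!: AE_I2\<close>)
  have "(\<integral>(r, \<omega>). H r \<omega> \<partial>time_product T) = (\<integral>r. expectation (H r) \<partial>restrict_space lborel {0..T})"
    using P.integral_fst'[OF i] by simp
  also have "\<dots> = (LBINT r:{0..T}. expectation (H r))"
    by (subst integral_restrict_space) (auto simp: set_lebesgue_integral_def)
  also have "\<dots> = (LBINT r:{0<..T}. expectation (H r))"
    using T interval_integral_Icc[of 0 T "\<lambda>r. expectation (H r)"] interval_integral_Ioc[of 0 T "\<lambda>r. expectation (H r)"]
    by simp
  finally show "(\<integral>(r, \<omega>). H r \<omega> \<partial>time_product T) = \<dots>" .
qed

lemma AE_time_product:
  assumes "AE \<omega> in M. Q \<omega>"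
  shows "AE z in time_product T. Q (snd z)"
proof -
  obtain A where A: "A \<in> sets M" "emeasure M A = 0" "{\<omega> \<in> space M. \<not> Q \<omega>} \<subseteq> A"
    using AE_E[OF assms] by blast
  have "space (restrict_space lborel {0..T}) \<times> A \<in> null_sets (time_product T)"
  proof (rule null_setsI)
    have "emeasure (time_product T) (space (restrict_space lborel {0..T}) \<times> A) =
        emeasure (restrict_space lborel {0..T}) (space (restrict_space lborel {0..T})) * emeasure M A"
      by (rule emeasure_pair_measure_Times[OF sets.top A(1)])
    then show "emeasure (time_product T) (space (restrict_space lborel {0..T}) \<times> A) = 0"
      using A by simp
    show "space (restrict_space lborel {0..T}) \<times> A \<in> sets (time_product T)"
      by (rule pair_measureI[OF sets.top A(1)])
  qed
  then show ?thesis
    by (rule AE_I') (use A(3) in \<open>auto simp: space_pair_measure\<close>)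
qed

text \<open>\<open>min 1 (Z k)\<close> is at most \<open>\<rho>\<close> plus the indicator of the
  event that \<open>Z k\<close> exceeds \<open>\<rho>\<close>. The truncation also copes with the
  value infinity.\<close>

lemma tendsto_zero_in_prob_imp_truncated:
  assumes "tendsto_zero_in_prob M Z"
  shows "(\<lambda>k. \<integral>\<^sup>+\<omega>. min 1 (Z k \<omega>) \<partial>M) \<longlonglongrightarrow> 0"
proof (rule ennreal_tendsto_zeroI)
  fix \<rho> :: real assume \<rho>: "0 < \<rho>"
  have [measurable]: "Z k \<in> borel_measurable M" for k using assms by (auto simp: tendsto_zero_in_prob_def)
  define J where "J k = ennreal (prob {\<omega>\<in>space M. ennreal \<rho> < Z k \<omega>})" for k
  have "J \<longlonglongrightarrow> ennreal 0"
    unfolding J_def using assms \<rho> by (intro tendsto_ennrealI) (auto simp: tendsto_zero_in_prob_def)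
  moreover have "(\<integral>\<^sup>+\<omega>. min 1 (Z k \<omega>) \<partial>M) \<le> J k + ennreal \<rho>" for k
  proof -
    have "(\<integral>\<^sup>+\<omega>. min 1 (Z k \<omega>) \<partial>M) \<le> (\<integral>\<^sup>+\<omega>. indicator {\<omega>\<in>space M. ennreal \<rho> < Z k \<omega>} \<omega> + ennreal \<rho> \<partial>M)"
      by (intro nn_integral_mono) (auto simp: indicator_def not_less min.coboundedI1 min.coboundedI2)
    also have "\<dots> = J k + ennreal \<rho>"
      by (subst nn_integral_add) (auto simp: J_def emeasure_space_1 emeasure_eq_measure[symmetric])
    finally show ?thesis .
  qed
  ultimately show "\<exists>J. J \<longlonglongrightarrow> 0 \<and> (\<forall>k. (\<integral>\<^sup>+\<omega>. min 1 (Z k \<omega>) \<partial>M) \<le> J k + ennreal \<rho>)"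
    by auto
qed

end

section \<open>Passage to the diffusion\<close>

text \<open>Stands in for a localising stopping time: continuous coefficients composed with
  \<open>clip k\<close> are bounded, and along a fixed path up to a fixed time they agree with the
  original ones for all large \<open>k\<close>.\<close>

definition clip :: "nat \<Rightarrow> real \<Rightarrow> real" where
  "clip k y = max (- real k) (min (real k) y)"

lemma clip_bounds: "- real k \<le> clip k y" "clip k y \<le> real k"
  by (auto simp: clip_def)

lemma clip_eq: "\<bar>y\<bar> \<le> real k \<Longrightarrow> clip k y = y"
  by (auto simp: clip_def)

lemma clip_measurable [measurable]: "clip k \<in> borel_measurable borel"
  unfolding clip_def[abs_def] by measurable

lemma bounded_on_clip:
  assumes "continuous_on UNIV (f :: real \<Rightarrow> real)"
  shows "\<exists>B. \<forall>y. \<bar>f (clip k y)\<bar> \<le> B"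
proof -
  have "compact (f ` {- real k..real k})"
    by (intro compact_continuous_image continuous_on_subset[OF assms]) auto
  then obtain B where "\<forall>y\<in>f ` {- real k..real k}. norm y \<le> B"
    using compact_imp_bounded bounded_iff by metis
  then show ?thesis using clip_bounds by (intro exI[of _ B]) auto
qed

lemma ennreal_min_tendsto_zero:
  fixes f :: "nat \<Rightarrow> ennreal"
  assumes "(\<lambda>k. min 1 (f k)) \<longlonglongrightarrow> 0"
  shows "f \<longlonglongrightarrow> 0"
proof (rule Lim_transform_eventually[OF assms])
  have "\<forall>\<^sub>F k in sequentially. min 1 (f k) < 1" by (rule order_tendstoD(2)[OF assms]) simp
  then show "\<forall>\<^sub>F k in sequentially. min 1 (f k) = f k" by eventually_elim (auto simp: min_def split: if_splits)
qed

lemma LBINT_cong: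
  "(\<And>q. q \<in> {s..t} \<Longrightarrow> f q = g q) \<Longrightarrow> (LBINT q:{s..t}. f q) = (LBINT q:{s..t}. g q)" for f g :: "real \<Rightarrow> real"
  by (intro set_lebesgue_integral_cong) auto

locale diffusion = filtered_wiener M F W
  for M :: "'a measure" and F W +
  fixes a b :: "real \<Rightarrow> real" and x :: real and X :: "real \<Rightarrow> 'a \<Rightarrow> real"
  assumes a_cont: "continuous_on UNIV a" and b_cont: "continuous_on UNIV b"
    and sde: "sde_solution M F W a b x X"
begin

lemma X_adapted: "continuous_adapted M F X"
  using sde by (simp add: sde_solution_def)

lemma X_progressive: "progressively_measurable F X"
  by (rule continuous_adapted_progressive[OF X_adapted])

lemma ab_measurable [measurable]: "a \<in> borel_measurable borel" "b \<in> borel_measurable borel"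
  using a_cont b_cont by (auto intro: borel_measurable_continuous_onI)

lemma X_locally_bounded:
  assumes "\<omega> \<in> space M"
  shows "\<exists>k0. \<forall>k\<ge>k0. \<forall>q\<in>{0..T}. clip k (X q \<omega>) = X q \<omega>"
proof -
  have "continuous_on {0..} (\<lambda>q. X q \<omega>)" using X_adapted assms by (auto simp: continuous_adapted_def)
  then have "compact ((\<lambda>q. X q \<omega>) ` {0..T})"
    by (intro compact_continuous_image) (auto intro: continuous_on_subset)
  then obtain B where B: "\<forall>y\<in>(\<lambda>q. X q \<omega>) ` {0..T}. norm y \<le> B"
    using compact_imp_bounded bounded_iff by metis
  obtain k0 where "B \<le> real k0" using real_arch_simple by blast
  then show ?thesis using B by (intro exI[of _ k0]) (force intro!: clip_eq)
qed

lemma continuous_along_X: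
  assumes "continuous_on UNIV (f :: real \<Rightarrow> real)" "\<omega> \<in> space M"
  shows "continuous_on {0..} (\<lambda>q. f (X q \<omega>))"
  using X_adapted assms(2)
  by (intro continuous_on_compose2[OF assms(1)]) (auto simp: continuous_adapted_def)

text \<open>The integral provides convergence in probability at each fixed time. The truncated
  distances, averaged over time as well, tend to 0 in mean on the product, and a subsequence
  converges almost everywhere there.\<close>

lemma approximating_simple_processes:
  assumes T: "0 < T"
  obtains S Y where "\<And>k. simple_process M F (S k)"
    and "AE z in time_product T.
      (\<lambda>k. simple_integral W (S k) (fst z) (snd z)) \<longlonglongrightarrow> Y (fst z) (snd z) \<and>
      (\<lambda>k. \<integral>\<^sup>+s\<in>{0..T}. ennreal ((simple_value (S k) s (snd z) - a (X s (snd z)))\<^sup>2) \<partial>lborel) \<longlonglongrightarrow> 0 \<and>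
      X (fst z) (snd z) = x + (LBINT s:{0..fst z}. b (X s (snd z))) + Y (fst z) (snd z)"
proof -
  have T0: "0 \<le> T" using T by simp
  obtain Y where ito: "ito_integral M F W (\<lambda>s \<omega>. a (X s \<omega>)) Y"
    and eq: "AE \<omega> in M. \<forall>t\<ge>0. X t \<omega> = x + (LBINT s:{0..t}. b (X s \<omega>)) + Y t \<omega>"
    using sde by (auto simp: sde_solution_def)
  have "\<exists>S. (\<forall>k. simple_process M F (S k)) \<and>
      (\<forall>T\<ge>0. tendsto_zero_in_prob M (\<lambda>k \<omega>. \<integral>\<^sup>+s\<in>{0..T}. ennreal ((simple_value (S k) s \<omega> - a (X s \<omega>))\<^sup>2) \<partial>lborel) \<and>
         tendsto_zero_in_prob M (\<lambda>k \<omega>. ennreal \<bar>simple_integral W (S k) T \<omega> - Y T \<omega>\<bar>))"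
    using ito unfolding ito_integral_def by blast
  then obtain S where S: "\<And>k. simple_process M F (S k)"
    and S12: "\<forall>T\<ge>0. tendsto_zero_in_prob M (\<lambda>k \<omega>. \<integral>\<^sup>+s\<in>{0..T}. ennreal ((simple_value (S k) s \<omega> - a (X s \<omega>))\<^sup>2) \<partial>lborel) \<and>
         tendsto_zero_in_prob M (\<lambda>k \<omega>. ennreal \<bar>simple_integral W (S k) T \<omega> - Y T \<omega>\<bar>)"
    by blast
  have S1: "tendsto_zero_in_prob M (\<lambda>k \<omega>. \<integral>\<^sup>+s\<in>{0..T}. ennreal ((simple_value (S k) s \<omega> - a (X s \<omega>))\<^sup>2) \<partial>lborel)"
    and S2: "\<And>t. 0 \<le> t \<Longrightarrow> tendsto_zero_in_prob M (\<lambda>k \<omega>. ennreal \<bar>simple_integral W (S k) t \<omega> - Y t \<omega>\<bar>)"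
    using S12 T0 by blast+
  have Y_adapted: "continuous_adapted M F Y" using ito by (simp add: ito_integral_def)
  interpret P: pair_sigma_finite "restrict_space lborel {0..T}" M by (rule pair_sigma_finite_time)

  define Q where "Q k \<omega> = (\<integral>\<^sup>+s\<in>{0..T}. ennreal ((simple_value (S k) s \<omega> - a (X s \<omega>))\<^sup>2) \<partial>lborel)" for k \<omega>
  define D where "D k r \<omega> = min 1 (ennreal \<bar>simple_integral W (S k) r \<omega> - Y r \<omega>\<bar>)" for k r \<omega>
  \<comment> \<open>Both errors are put into one function so that a single subsequence serves for
    both.\<close>
  define U where "U k z = D k (fst z) (snd z) + min 1 (Q k (snd z))" for k z
  have Q_M [measurable]: "Q k \<in> borel_measurable M" for k
    using S1 unfolding tendsto_zero_in_prob_def Q_def by blast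
  have I_prog: "progressively_measurable F (\<lambda>r \<omega>. \<bar>simple_integral W (S k) r \<omega> - Y r \<omega>\<bar>)" for k
    by (rule progressive_compose2[OF continuous_adapted_progressive[OF simple_integral_continuous_adapted[OF S]]
        continuous_adapted_progressive[OF Y_adapted], of "\<lambda>u v. \<bar>u - v\<bar>"]) measurable
  have D_m: "(\<lambda>z. D k (fst z) (snd z)) \<in> borel_measurable (time_product T)" for k
    using progressive_time_product[OF I_prog T0, of k] unfolding D_def by (simp add: case_prod_beta)
  have U_m [measurable]: "U k \<in> borel_measurable (time_product T)" for k
    unfolding U_def using D_m by measurable
  let ?d = "\<lambda>k r. \<integral>\<^sup>+\<omega>. D k r \<omega> \<partial>M" and ?q = "\<lambda>k. \<integral>\<^sup>+\<omega>. min 1 (Q k \<omega>) \<partial>M"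
  have U_lim: "(\<lambda>k. \<integral>\<^sup>+z. U k z \<partial>time_product T) \<longlonglongrightarrow> 0"
  proof -
    have U_int: "(\<integral>\<^sup>+z. U k z \<partial>time_product T) =
        (\<integral>\<^sup>+r. ?d k r + ?q k \<partial>restrict_space lborel {0..T})" for k
    proof -
      have Dr: "D k r \<in> borel_measurable M" if "r \<in> space (restrict_space lborel {0..T})" for r
        using measurable_compose[OF measurable_Pair1'[OF that] D_m[of k]] by simp
      show ?thesis
        unfolding nn_integral_fst[OF U_m, symmetric]
        by (intro nn_integral_cong) (simp add: U_def nn_integral_add Dr)
    qed
    have *: "(\<lambda>k. ?d k r + ?q k) \<longlonglongrightarrow> 0 + 0" if "0 \<le> r" for r
      unfolding D_def Q_def
      by (intro tendsto_add tendsto_zero_in_prob_imp_truncated S1 S2 that)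
    have "(\<lambda>k. \<integral>\<^sup>+r. ?d k r + ?q k \<partial>restrict_space lborel {0..T})
        \<longlonglongrightarrow> (\<integral>\<^sup>+r. 0 \<partial>restrict_space lborel {0..T})"
    proof (rule nn_integral_dominated_convergence[where w = "\<lambda>_. 2"])
      show "(\<lambda>r. ?d k r + ?q k) \<in> borel_measurable (restrict_space lborel {0..T})" for k
        using borel_measurable_nn_integral_fst[OF D_m[of k]] by simp
      have "?d k r \<le> 1" for k r
      proof -
        have "?d k r \<le> (\<integral>\<^sup>+\<omega>. 1 \<partial>M)" by (intro nn_integral_mono) (simp add: D_def)
        then show ?thesis by (simp add: emeasure_space_1)
      qed
      moreover have "?q k \<le> 1" for k
      proof -
        have "?q k \<le> (\<integral>\<^sup>+\<omega>. 1 \<partial>M)" by (intro nn_integral_mono) simp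
        then show ?thesis by (simp add: emeasure_space_1)
      qed
      ultimately show "AE r in restrict_space lborel {0..T}. ?d k r + ?q k \<le> 2" for k
        using add_mono[of _ "1::ennreal" _ 1] by (intro AE_I2) (simp add: one_add_one)
      show "(\<integral>\<^sup>+r. 2 \<partial>restrict_space lborel {0..T}) < \<infinity>"
        using T0 by (simp add: emeasure_restrict_space space_restrict_space ennreal_mult_less_top)
      show "AE r in restrict_space lborel {0..T}. (\<lambda>k. ?d k r + ?q k) \<longlonglongrightarrow> 0"
        using * by (intro AE_I2) (auto simp: space_restrict_space)
    qed auto
    then show ?thesis unfolding U_int by simp
  qed
  have U_fin: "U k z \<le> 2" for k z
    unfolding U_def D_def using add_mono[of _ "1::ennreal" _ 1] by (simp add: one_add_one[symmetric] del: one_add_one)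
  \<comment> \<open>The truncated errors are finite, so they may be read as real functions, to which
    the subsequence theorem for convergence in mean applies.\<close>
  define u where "u k z = enn2real (U k z)" for k z
  have u_U: "ennreal (u k z) = U k z" for k z
  proof -
    have "(2::ennreal) < top" using ennreal_less_top[of 2] by simp
    then have "U k z < top" using U_fin[of k z] by (rule le_less_trans[rotated])
    then show ?thesis by (simp add: u_def)
  qed
  have u_m [measurable]: "u k \<in> borel_measurable (time_product T)" for k
    unfolding u_def by measurable
  have u_i: "integrable (time_product T) (u k)" for k
  proof (rule integrableI_bounded_set[where A = "space (time_product T)" and B = 2])
    show "AE z\<in>space (time_product T) in time_product T. norm (u k z) \<le> 2"
      using U_fin by (intro AE_I2) (auto simp: u_def intro!: enn2real_leI)
    show "emeasure (time_product T) (space (time_product T)) < \<infinity>"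
      using emeasure_time_product[OF T0] by simp
  qed (auto intro!: AE_I2)
  have "(\<lambda>k. \<integral>z. norm (u k z) \<partial>time_product T) \<longlonglongrightarrow> 0"
  proof -
    have "ennreal (\<integral>z. norm (u k z) \<partial>time_product T) = (\<integral>\<^sup>+z. U k z \<partial>time_product T)" for k
    proof -
      have "ennreal (\<integral>z. norm (u k z) \<partial>time_product T) = (\<integral>\<^sup>+z. ennreal (norm (u k z)) \<partial>time_product T)"
        using u_i by (intro nn_integral_eq_integral[symmetric] integrable_norm) auto
      also have "\<dots> = (\<integral>\<^sup>+z. U k z \<partial>time_product T)"
        unfolding u_U[symmetric] by (intro nn_integral_cong) (simp add: u_def)
      finally show ?thesis .
    qed
    then have "(\<lambda>k. ennreal (\<integral>z. norm (u k z) \<partial>time_product T)) \<longlonglongrightarrow> ennreal 0"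
      using U_lim by simp
    then show ?thesis by (rule tendsto_ennrealD) auto
  qed
  from tendsto_L1_AE_subseq[OF u_i this] obtain \<sigma> where \<sigma>: "strict_mono \<sigma>"
    and \<sigma>_lim: "AE z in time_product T. (\<lambda>k. u (\<sigma> k) z) \<longlonglongrightarrow> 0" by blast

  have "AE z in time_product T.
      (\<lambda>k. simple_integral W (S (\<sigma> k)) (fst z) (snd z)) \<longlonglongrightarrow> Y (fst z) (snd z) \<and>
      (\<lambda>k. Q (\<sigma> k) (snd z)) \<longlonglongrightarrow> 0 \<and>
      X (fst z) (snd z) = x + (LBINT s:{0..fst z}. b (X s (snd z))) + Y (fst z) (snd z)"
    using \<sigma>_lim AE_time_product[OF eq] AE_space
  proof eventually_elim
    case (elim z)
    then have r: "0 \<le> fst z" by (auto simp: space_pair_measure space_restrict_space)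
    have U0: "(\<lambda>k. U (\<sigma> k) z) \<longlonglongrightarrow> 0"
      using tendsto_ennrealI[OF elim(1)] unfolding u_U by simp
    have "(\<lambda>k. D (\<sigma> k) (fst z) (snd z)) \<longlonglongrightarrow> 0"
      by (rule tendsto_sandwich[OF _ _ tendsto_const U0]) (auto simp: U_def)
    then have "(\<lambda>k. ennreal \<bar>simple_integral W (S (\<sigma> k)) (fst z) (snd z) - Y (fst z) (snd z)\<bar>) \<longlonglongrightarrow> ennreal 0"
      unfolding D_def using ennreal_min_tendsto_zero by simp
    then have "(\<lambda>k. \<bar>simple_integral W (S (\<sigma> k)) (fst z) (snd z) - Y (fst z) (snd z)\<bar>) \<longlonglongrightarrow> 0"
      by (rule tendsto_ennrealD) auto
    then have "(\<lambda>k. simple_integral W (S (\<sigma> k)) (fst z) (snd z)) \<longlonglongrightarrow> Y (fst z) (snd z)"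
      using tendsto_rabs_zero_iff LIM_zero_iff by blast
    moreover have "(\<lambda>k. min 1 (Q (\<sigma> k) (snd z))) \<longlonglongrightarrow> 0"
      by (rule tendsto_sandwich[OF _ _ tendsto_const U0]) (auto simp: U_def)
    then have "(\<lambda>k. Q (\<sigma> k) (snd z)) \<longlonglongrightarrow> 0" by (rule ennreal_min_tendsto_zero)
    ultimately show ?case using elim(2) r by blast
  qed
  then show thesis
    unfolding Q_def using that[of "\<lambda>k. S (\<sigma> k)" Y] S by blast
qed

text \<open>Along \<open>X\<close> the rate \<open>\<kappa>\<close> is bounded on each path up to
  time \<open>T\<close> but need not be bounded uniformly, so its time integral is obtained as a
  limit of integrals of clipped rates, which are eventually equal to it on every path.\<close>

lemma killed_measurable:
  fixes \<kappa> g :: "real \<Rightarrow> real"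
  assumes \<kappa>: "continuous_on UNIV \<kappa>" and g: "g \<in> borel_measurable borel" and T0: "0 \<le> T"
  shows "(\<lambda>z. exp (- (LBINT q:{0..fst z}. \<kappa> (X q (snd z)))) * g (X (fst z) (snd z))) \<in> borel_measurable (time_product T)"
proof -
  have \<kappa>_m [measurable]: "\<kappa> \<in> borel_measurable borel"
    using \<kappa> by (auto intro: borel_measurable_continuous_onI)
  define Alim where "Alim r \<omega> = (LBINT q:{0..r}. \<kappa> (X q \<omega>))" for r \<omega>
  have X_m: "(\<lambda>z. X (fst z) (snd z)) \<in> borel_measurable (time_product T)"
    using progressive_time_product[OF X_progressive T0] by (simp add: case_prod_beta)
  have "(\<lambda>z. Alim (fst z) (snd z)) \<in> borel_measurable (time_product T)"
  proof (rule borel_measurable_LIMSEQ_real)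
    fix k
    obtain B\<kappa> where B\<kappa>: "\<And>y. \<bar>\<kappa> (clip k y)\<bar> \<le> B\<kappa>" using bounded_on_clip[OF \<kappa>, of k] by blast
    have "progressively_measurable F (\<lambda>q \<omega>. \<kappa> (clip k (X q \<omega>)))"
      by (rule progressive_compose[OF X_progressive]) measurable
    from progressive_time_product[OF continuous_adapted_progressive[OF progressive_LBINT_continuous_adapted[OF this B\<kappa>]] T0]
    show "(\<lambda>z. LBINT q:{0..fst z}. \<kappa> (clip k (X q (snd z)))) \<in> borel_measurable (time_product T)"
      by (simp add: case_prod_beta)
  next
    fix z assume "z \<in> space (time_product T)"
    then have z: "snd z \<in> space M" "0 \<le> fst z" "fst z \<le> T"
      by (auto simp: space_pair_measure space_restrict_space)
    obtain k0 where k0: "\<And>k q. k0 \<le> k \<Longrightarrow> q \<in> {0..T} \<Longrightarrow> clip k (X q (snd z)) = X q (snd z)"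
      using X_locally_bounded[OF z(1), of T] by blast
    have "(LBINT q:{0..fst z}. \<kappa> (clip k (X q (snd z)))) = Alim (fst z) (snd z)" if "k0 \<le> k" for k
      unfolding Alim_def by (rule LBINT_cong) (use k0[OF that] z in auto)
    then show "(\<lambda>k. LBINT q:{0..fst z}. \<kappa> (clip k (X q (snd z)))) \<longlonglongrightarrow> Alim (fst z) (snd z)"
      by (intro tendsto_eventually eventually_sequentiallyI[of k0])
  qed
  then show ?thesis unfolding Alim_def using X_m g by measurable
qed

text \<open>Passage to the limit from elementary integrands. The hypothesis on \<open>K\<close> has
  two positions because the coefficients are evaluated along \<open>X\<close> and the test function
  along its approximation. \<open>L\<close> is the rate at which killing outweighs the error in the
  squared integrand; \<open>K\<close> provides the minorant for Fatou's lemma.\<close>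

lemma killed_occupation_bound:
  fixes h h' h'' \<kappa> g :: "real \<Rightarrow> real" and B L K T :: real
  assumes h: "\<And>y. (h has_real_derivative h' y) (at y)" "\<And>y. (h' has_real_derivative h'' y) (at y)"
    and ucont: "uniformly_continuous_on UNIV h" "uniformly_continuous_on UNIV h'" "uniformly_continuous_on UNIV h''"
    and hbound: "\<And>y. 0 \<le> h y" "\<And>y. h y \<le> B" "\<And>y. \<bar>h' y\<bar> \<le> B" "\<And>y. \<bar>h'' y\<bar> \<le> B"
    and L: "0 \<le> L" "\<And>y. \<bar>h'' y\<bar> \<le> 2 * L * h y"
    and \<kappa>: "continuous_on UNIV \<kappa>" "\<And>y. 0 \<le> \<kappa> y"
    and K: "0 \<le> K" "\<And>y z. - K \<le> \<kappa> y * h z - h' z * b y - h'' z * (a y)\<^sup>2 / 2"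
    and g: "g \<in> borel_measurable borel" "\<And>y. 0 \<le> g y" "\<And>y. g y \<le> \<kappa> y * h y - h' y * b y - h'' y * (a y)\<^sup>2 / 2"
    and T: "0 < T"
  shows "(\<integral>\<^sup>+z. ennreal (exp (- (LBINT q:{0..fst z}. \<kappa> (X q (snd z)))) * g (X (fst z) (snd z))) \<partial>time_product T) \<le> ennreal (h x)"
proof -
  have T0: "0 \<le> T" using T by simp
  obtain S Y where S: "\<And>k. simple_process M F (S k)"
    and lim: "AE z in time_product T.
      (\<lambda>k. simple_integral W (S k) (fst z) (snd z)) \<longlonglongrightarrow> Y (fst z) (snd z) \<and>
      (\<lambda>k. \<integral>\<^sup>+s\<in>{0..T}. ennreal ((simple_value (S k) s (snd z) - a (X s (snd z)))\<^sup>2) \<partial>lborel) \<longlonglongrightarrow> 0 \<and>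
      X (fst z) (snd z) = x + (LBINT s:{0..fst z}. b (X s (snd z))) + Y (fst z) (snd z)"
    using approximating_simple_processes[OF T] by blast
  define \<beta> where "\<beta> k q \<omega> = b (clip k (X q \<omega>))" for k q \<omega>
  define c where "c k q \<omega> = L * \<bar>(simple_value (S k) q \<omega>)\<^sup>2 - (a (clip k (X q \<omega>)))\<^sup>2\<bar> + \<kappa> (clip k (X q \<omega>))" for k q \<omega>
  define V where "V k r \<omega> = x + (LBINT q:{0..r}. \<beta> k q \<omega>) + simple_integral W (S k) r \<omega>" for k r \<omega>
  define A where "A k r \<omega> = (LBINT q:{0..r}. c k q \<omega>)" for k r \<omega>
  define \<Gamma> where "\<Gamma> y z = \<kappa> y * h z - h' z * b y - h'' z * (a y)\<^sup>2 / 2" for y z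
  have \<kappa>_m [measurable]: "\<kappa> \<in> borel_measurable borel"
    using \<kappa> by (auto intro: borel_measurable_continuous_onI)
  have h_m [measurable]: "h \<in> borel_measurable borel" "h' \<in> borel_measurable borel" "h'' \<in> borel_measurable borel"
    by (auto intro!: borel_measurable_continuous_onI uniformly_continuous_imp_continuous ucont)
  let ?E = "\<lambda>k z. exp (- A k (fst z) (snd z)) * \<Gamma> (clip k (X (fst z) (snd z))) (V k (fst z) (snd z))"
  have bound_k: "(\<integral>\<^sup>+z. ennreal (?E k z + K) \<partial>time_product T)
      \<le> ennreal (h x + K * T)"
    and G_m: "(\<lambda>z. ?E k z + K) \<in> borel_measurable (time_product T)"
    and A_nonneg: "\<And>r \<omega>. \<omega> \<in> space M \<Longrightarrow> 0 \<le> A k r \<omega>" for k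
  proof -
    obtain Ba Bb B\<kappa> Bs where Ba: "\<And>y. \<bar>a (clip k y)\<bar> \<le> Ba" and Bb: "\<And>y. \<bar>b (clip k y)\<bar> \<le> Bb"
      and B\<kappa>: "\<And>y. \<bar>\<kappa> (clip k y)\<bar> \<le> B\<kappa>" and Bs: "\<And>q \<omega>. \<omega> \<in> space M \<Longrightarrow> \<bar>simple_value (S k) q \<omega>\<bar> \<le> Bs"
      using bounded_on_clip[OF a_cont, of k] bounded_on_clip[OF b_cont, of k] bounded_on_clip[OF \<kappa>(1), of k]
        simple_value_bounded[OF S, of k] by metis
    \<comment> \<open>The last entry bounds the killing rate \<open>c k\<close>. This constant
      depends on \<open>k\<close>, which is harmless because the resulting inequality does not
      contain it.\<close>
    define C where "C = Max {1, B, Bb, Bs, L * (Bs\<^sup>2 + Ba\<^sup>2) + B\<kappa>}"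
    have C: "1 \<le> C" "B \<le> C" "Bb \<le> C" "Bs \<le> C" "L * (Bs\<^sup>2 + Ba\<^sup>2) + B\<kappa> \<le> C"
      by (auto simp: C_def)
    have c_nonneg: "0 \<le> c k q \<omega>" for q \<omega> using L(1) \<kappa>(2) by (auto simp: c_def)
    have X_clip_prog: "progressively_measurable F (\<lambda>q \<omega>. clip k (X q \<omega>))"
      by (rule progressive_compose[OF X_progressive]) measurable
    have F1: "progressively_measurable F (\<beta> k)"
      unfolding \<beta>_def by (rule progressive_compose[OF X_clip_prog]) measurable
    have F2: "progressively_measurable F (c k)"
      unfolding c_def
      by (rule progressive_compose2[OF simple_value_progressive[OF S] X_clip_prog, of "\<lambda>s y. L * \<bar>s\<^sup>2 - (a y)\<^sup>2\<bar> + \<kappa> y"]) measurable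
    have F3: "c k q \<omega> \<le> C" if "\<omega> \<in> space M" for q \<omega>
    proof -
        have "(simple_value (S k) q \<omega>)\<^sup>2 \<le> Bs\<^sup>2" "(a (clip k (X q \<omega>)))\<^sup>2 \<le> Ba\<^sup>2"
        using power_mono[OF Bs[OF that, of q], of 2] power_mono[OF Ba[of "X q \<omega>"], of 2] by auto
        then have "\<bar>(simple_value (S k) q \<omega>)\<^sup>2 - (a (clip k (X q \<omega>)))\<^sup>2\<bar> \<le> Bs\<^sup>2 + Ba\<^sup>2"
        by (simp add: abs_le_iff add_increasing add_increasing2)
             (smt (verit) zero_le_power2)
        then have "L * \<bar>(simple_value (S k) q \<omega>)\<^sup>2 - (a (clip k (X q \<omega>)))\<^sup>2\<bar> \<le> L * (Bs\<^sup>2 + Ba\<^sup>2)"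
        using L(1) by (rule mult_left_mono)
        then show ?thesis using C(5) B\<kappa>[of "X q \<omega>"] unfolding c_def by linarith
    qed
    have F4: "\<bar>simple_value (S k) q \<omega>\<bar> \<le> C" if "\<omega> \<in> space M" for q \<omega>
      using Bs[OF that, of q] C by linarith
    have F5: "\<bar>\<beta> k q \<omega>\<bar> \<le> C" for q \<omega> using Bb[of "X q \<omega>"] C by (simp add: \<beta>_def)
    have F6: "h y \<le> C" "\<bar>h' y\<bar> \<le> C" "\<bar>h'' y\<bar> \<le> C" for y
      using hbound(2-4)[of y] C by linarith+
    interpret SD: simple_diffusion M F W "S k" "\<beta> k" "c k" h h' h'' x C
      by unfold_locales (use S F1 F2 F3 F4 F5 F6 h ucont hbound(1) C(1) c_nonneg in auto)
    have V_eq: "V k = SD.Y" and A_eq: "A k = SD.A"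
      by (auto simp: fun_eq_iff V_def SD.Y_def A_def SD.A_def)
    show An: "0 \<le> A k r \<omega>" if "\<omega> \<in> space M" for r \<omega>
      unfolding A_eq by (rule SD.A_nonneg[OF that])
    \<comment> \<open>The discount lies between 0 and 1, so it preserves the lower bound
      \<open>- K\<close>; adding \<open>K\<close> makes the integrands nonnegative.\<close>
    have \<Gamma>_K: "0 \<le> exp (- A k r \<omega>) * \<Gamma> y z + K" if "\<omega> \<in> space M" for r \<omega> y z
    proof -
      have "exp (- A k r \<omega>) * (- K) \<le> exp (- A k r \<omega>) * \<Gamma> y z"
        using K(2) by (intro mult_left_mono) (auto simp: \<Gamma>_def)
      moreover have "exp (- A k r \<omega>) * K \<le> 1 * K"
        using An[OF that, of r] K(1) by (intro mult_right_mono) auto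
      ultimately show ?thesis by simp
    qed
    \<comment> \<open>Here the killing pays for the wrong diffusion coefficient: \<open>SD.G\<close>
      exceeds \<open>\<Gamma>\<close> by \<open>L * \<bar>s2\<bar> * h - h'' * s2 / 2\<close>, which
      is nonnegative by the hypothesis on \<open>L\<close>.\<close>
    have \<Gamma>_G: "\<Gamma> (clip k (X r \<omega>)) (V k r \<omega>) \<le> SD.G r \<omega>" for r \<omega>
    proof -
      define s2 where "s2 = (simple_value (S k) r \<omega>)\<^sup>2 - (a (clip k (X r \<omega>)))\<^sup>2"
      have "h'' (V k r \<omega>) * s2 \<le> \<bar>h'' (V k r \<omega>)\<bar> * \<bar>s2\<bar>" by (simp add: abs_mult[symmetric])
      also have "\<dots> \<le> (2 * L * h (V k r \<omega>)) * \<bar>s2\<bar>" by (intro mult_right_mono L) auto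
      finally show ?thesis
        unfolding SD.G_def \<Gamma>_def V_eq[symmetric] \<beta>_def c_def s2_def by (simp add: algebra_simps diff_divide_distrib)
    qed
    have "progressively_measurable F (\<lambda>r \<omega>. \<Gamma> (clip k (X r \<omega>)) (V k r \<omega>))"
      unfolding V_eq \<Gamma>_def
      by (rule progressive_compose2[OF X_clip_prog continuous_adapted_progressive[OF SD.Y_adapted],
            of "\<lambda>y z. \<kappa> y * h z - h' z * b y - h'' z * (a y)\<^sup>2 / 2"]) measurable
    from progressive_compose2[OF continuous_adapted_progressive[OF SD.A_adapted] this, of "\<lambda>u v. exp (- u) * v + K"]
    have "progressively_measurable F (\<lambda>r \<omega>. exp (- A k r \<omega>) * \<Gamma> (clip k (X r \<omega>)) (V k r \<omega>) + K)"
      unfolding A_eq by measurable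
    from progressive_time_product[OF this T0]
    show "(\<lambda>z. ?E k z + K) \<in> borel_measurable (time_product T)"
      by (simp add: case_prod_beta)
    note Gi = progressive_time_product_integral[OF SD.G_progressive SD.discounted_G_abs T0, unfolded case_prod_beta]
    interpret fin: finite_measure "time_product T"
      by (rule finite_measureI) (use emeasure_time_product[OF T0] in simp)
    have mT: "measure (time_product T) (space (time_product T)) = T"
      using emeasure_time_product[OF T0] T0 by (simp add: measure_def)
    have "(\<integral>\<^sup>+z. ennreal (?E k z + K) \<partial>time_product T)
      \<le> (\<integral>\<^sup>+z. ennreal (exp (- SD.A (fst z) (snd z)) * SD.G (fst z) (snd z) + K) \<partial>time_product T)"
      unfolding A_eq[symmetric]
      by (intro nn_integral_mono ennreal_leI add_right_mono mult_left_mono \<Gamma>_G) auto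
    also have "\<dots> = ennreal (\<integral>z. exp (- SD.A (fst z) (snd z)) * SD.G (fst z) (snd z) + K \<partial>time_product T)"
    proof (rule nn_integral_eq_integral)
      show "integrable (time_product T) (\<lambda>z. exp (- SD.A (fst z) (snd z)) * SD.G (fst z) (snd z) + K)"
        using Gi(1) by simp
      show "AE z in time_product T. 0 \<le> exp (- SD.A (fst z) (snd z)) * SD.G (fst z) (snd z) + K"
      proof (rule AE_I2)
        fix z assume "z \<in> space (time_product T)"
        then have z: "snd z \<in> space M" by (auto simp: space_pair_measure)
        have "?E k z \<le> exp (- A k (fst z) (snd z)) * SD.G (fst z) (snd z)"
          by (intro mult_left_mono \<Gamma>_G) auto
        then show "0 \<le> exp (- SD.A (fst z) (snd z)) * SD.G (fst z) (snd z) + K"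
          using \<Gamma>_K[OF z, of "fst z" "clip k (X (fst z) (snd z))" "V k (fst z) (snd z)"] unfolding A_eq by linarith
      qed
    qed
    also have "(\<integral>z. exp (- SD.A (fst z) (snd z)) * SD.G (fst z) (snd z) + K \<partial>time_product T) = (LBINT r:{0<..T}. SD.\<gamma> r) + K * T"
      using Gi by (simp add: SD.\<gamma>_def mT mult.commute)
    also have "ennreal \<dots> \<le> ennreal (h x + K * T)"
      using SD.supermartingale_inequality[OF T] by (intro ennreal_leI) simp
    finally show "(\<integral>\<^sup>+z. ennreal (?E k z + K) \<partial>time_product T)
      \<le> ennreal (h x + K * T)" .
  qed
  define Alim where "Alim r \<omega> = (LBINT q:{0..r}. \<kappa> (X q \<omega>))" for r \<omega>
  \<comment> \<open>On a fixed path clipping is invisible from \<open>k0\<close> on. The drift is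
    then exact, and the only moving parts are the elementary integral and the integral of
    \<open>R k\<close> below, which tends to 0; so the part of the killing with factor
    \<open>L\<close> vanishes in the limit.\<close>
  have path_limits: "(\<lambda>k. A k r \<omega>) \<longlonglongrightarrow> Alim r \<omega>" "(\<lambda>k. V k r \<omega>) \<longlonglongrightarrow> X r \<omega>"
    "\<forall>\<^sub>F k in sequentially. clip k (X r \<omega>) = X r \<omega>"
    if \<omega>: "\<omega> \<in> space M" and r: "0 \<le> r" "r \<le> T"
      and I: "(\<lambda>k. simple_integral W (S k) r \<omega>) \<longlonglongrightarrow> Y r \<omega>"
      and Q: "(\<lambda>k. \<integral>\<^sup>+s\<in>{0..T}. ennreal ((simple_value (S k) s \<omega> - a (X s \<omega>))\<^sup>2) \<partial>lborel) \<longlonglongrightarrow> 0"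
      and eq: "X r \<omega> = x + (LBINT s:{0..r}. b (X s \<omega>)) + Y r \<omega>" for r \<omega>
  proof -
    obtain k0 where k0: "\<And>k q. k0 \<le> k \<Longrightarrow> q \<in> {0..T} \<Longrightarrow> clip k (X q \<omega>) = X q \<omega>"
      using X_locally_bounded[OF \<omega>, of T] by blast
    show "\<forall>\<^sub>F k in sequentially. clip k (X r \<omega>) = X r \<omega>"
      using k0 r by (intro eventually_sequentiallyI[of k0]) auto
    have V: "V k r \<omega> = x + (LBINT s:{0..r}. b (X s \<omega>)) + simple_integral W (S k) r \<omega>" if "k0 \<le> k" for k
    proof -
      have "(LBINT q:{0..r}. b (clip k (X q \<omega>))) = (LBINT q:{0..r}. b (X q \<omega>))"
        by (rule LBINT_cong) (use k0[OF that] r in auto)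
      then show ?thesis by (simp add: V_def \<beta>_def)
    qed
    show "(\<lambda>k. V k r \<omega>) \<longlonglongrightarrow> X r \<omega>"
    proof (rule Lim_transform_eventually)
      show "(\<lambda>k. x + (LBINT s:{0..r}. b (X s \<omega>)) + simple_integral W (S k) r \<omega>) \<longlonglongrightarrow> X r \<omega>"
        unfolding eq by (intro tendsto_intros I)
      show "\<forall>\<^sub>F k in sequentially. x + (LBINT s:{0..r}. b (X s \<omega>)) + simple_integral W (S k) r \<omega> = V k r \<omega>"
        using V by (intro eventually_sequentiallyI[of k0]) auto
    qed
    define R where "R k q = \<bar>(simple_value (S k) q \<omega>)\<^sup>2 - (a (X q \<omega>))\<^sup>2\<bar>" for k q
    have aX: "continuous_on {0..T} (\<lambda>q. a (X q \<omega>))" and \<kappa>X: "continuous_on {0..r} (\<lambda>q. \<kappa> (X q \<omega>))"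
      using continuous_along_X[OF a_cont \<omega>] continuous_along_X[OF \<kappa>(1) \<omega>] by (auto intro: continuous_on_subset)
    have "compact ((\<lambda>q. a (X q \<omega>)) ` {0..T})" using aX by (intro compact_continuous_image) auto
    then obtain B1 where B1: "\<forall>y\<in>(\<lambda>q. a (X q \<omega>)) ` {0..T}. norm y \<le> B1"
      using compact_imp_bounded bounded_iff by metis
    have m: "(\<lambda>q. indicator {0..T} q * simple_value (S k) q \<omega>) \<in> borel_measurable borel"
      "(\<lambda>q. indicator {0..T} q * a (X q \<omega>)) \<in> borel_measurable borel" for k
      using progressive_section[OF simple_value_progressive[OF S] T0 \<omega>]
        progressive_section[OF progressive_compose[OF X_progressive ab_measurable(1)] T0 \<omega>] by auto
    have R_lim: "(\<lambda>k. \<integral>\<^sup>+q\<in>{0..T}. ennreal (R k q) \<partial>lborel) \<longlonglongrightarrow> 0"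
      unfolding R_def by (rule nn_square_difference_tendsto[OF m _ T Q]) (use B1 in auto)
    have R_i: "set_integrable lborel {0..r} (R k)" for k
    proof -
      obtain B2 where B2: "\<And>q. \<bar>simple_value (S k) q \<omega>\<bar> \<le> B2"
        using simple_value_bounded[OF S, of k] \<omega> by blast
      have "(\<lambda>q. indicator {0..r} q * \<bar>(indicator {0..T} q * simple_value (S k) q \<omega>)\<^sup>2 - (indicator {0..T} q * a (X q \<omega>))\<^sup>2\<bar>) \<in> borel_measurable borel"
        using m by measurable
      also have "(\<lambda>q. indicator {0..r} q * \<bar>(indicator {0..T} q * simple_value (S k) q \<omega>)\<^sup>2 - (indicator {0..T} q * a (X q \<omega>))\<^sup>2\<bar>)
          = (\<lambda>q. indicator {0..r} q *\<^sub>R R k q)"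
        using r by (auto simp: R_def indicator_def fun_eq_iff)
      finally have Rm: "(\<lambda>q. indicator {0..r} q *\<^sub>R R k q) \<in> borel_measurable lborel" by simp
      show ?thesis
        unfolding set_integrable_def
      proof (rule integrableI_bounded_set[where A = "{0..r}" and B = "B2\<^sup>2 + B1\<^sup>2"])
        show "emeasure lborel {0..r} < \<infinity>" using r by simp
        show "AE q\<in>{0..r} in lborel. norm (indicator {0..r} q *\<^sub>R R k q) \<le> B2\<^sup>2 + B1\<^sup>2"
        proof (intro AE_I2 impI)
          fix q assume q: "q \<in> {0..r}"
          then have "\<bar>a (X q \<omega>)\<bar> \<le> B1" using B1 r by auto
          then have "(simple_value (S k) q \<omega>)\<^sup>2 \<le> B2\<^sup>2" "(a (X q \<omega>))\<^sup>2 \<le> B1\<^sup>2"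
            using power_mono[OF B2, of q 2] power_mono[of "\<bar>a (X q \<omega>)\<bar>" B1 2] by auto
          moreover have "0 \<le> (simple_value (S k) q \<omega>)\<^sup>2" "0 \<le> (a (X q \<omega>))\<^sup>2" by auto
          ultimately have "R k q \<le> B2\<^sup>2 + B1\<^sup>2" unfolding R_def by linarith
          then show "norm (indicator {0..r} q *\<^sub>R R k q) \<le> B2\<^sup>2 + B1\<^sup>2" using q by (simp add: R_def)
        qed
      qed (use Rm in auto)
    qed
    have \<kappa>_i: "set_integrable lborel {0..r} (\<lambda>q. \<kappa> (X q \<omega>))"
      by (rule borel_integrable_atLeastAtMost'[OF \<kappa>X])
    have LR_lim: "(\<lambda>k. LBINT q:{0..r}. R k q) \<longlonglongrightarrow> 0"
    proof -
      have eq: "ennreal (LBINT q:{0..r}. R k q) = (\<integral>\<^sup>+q\<in>{0..r}. ennreal (R k q) \<partial>lborel)" for k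
      proof -
        have "ennreal (LBINT q:{0..r}. R k q) = (\<integral>\<^sup>+q. ennreal (indicator {0..r} q *\<^sub>R R k q) \<partial>lborel)"
          unfolding set_lebesgue_integral_def
          using R_i[of k] by (intro nn_integral_eq_integral[symmetric]) (auto simp: set_integrable_def R_def)
        also have "\<dots> = (\<integral>\<^sup>+q\<in>{0..r}. ennreal (R k q) \<partial>lborel)"
          by (intro nn_integral_cong) (auto simp: indicator_def)
        finally show ?thesis .
      qed
      have "(\<lambda>k. ennreal (LBINT q:{0..r}. R k q)) \<longlonglongrightarrow> ennreal 0"
      proof (rule tendsto_sandwich[OF _ _ tendsto_const])
        show "\<forall>\<^sub>F k in sequentially. ennreal (LBINT q:{0..r}. R k q) \<le> (\<integral>\<^sup>+q\<in>{0..T}. ennreal (R k q) \<partial>lborel)"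
          unfolding eq using r by (intro always_eventually allI nn_integral_mono) (auto simp: indicator_def)
      qed (use R_lim in auto)
      then show ?thesis
        by (rule tendsto_ennrealD)
           (auto simp: set_lebesgue_integral_def R_def intro!: always_eventually Bochner_Integration.integral_nonneg)
    qed
    have A: "A k r \<omega> = L * (LBINT q:{0..r}. R k q) + Alim r \<omega>" if "k0 \<le> k" for k
    proof -
      have "A k r \<omega> = (LBINT q:{0..r}. L * R k q + \<kappa> (X q \<omega>))"
        unfolding A_def c_def R_def by (rule LBINT_cong) (use k0[OF that] r in auto)
      also have "\<dots> = L * (LBINT q:{0..r}. R k q) + Alim r \<omega>"
        unfolding Alim_def using R_i \<kappa>_i by (subst set_integral_add) auto
      finally show ?thesis .
    qed
    show "(\<lambda>k. A k r \<omega>) \<longlonglongrightarrow> Alim r \<omega>"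
    proof (rule Lim_transform_eventually)
      show "(\<lambda>k. L * (LBINT q:{0..r}. R k q) + Alim r \<omega>) \<longlonglongrightarrow> Alim r \<omega>"
        by (rule tendsto_eq_intros LR_lim refl)+ simp
      show "\<forall>\<^sub>F k in sequentially. L * (LBINT q:{0..r}. R k q) + Alim r \<omega> = A k r \<omega>"
        using A by (intro eventually_sequentiallyI[of k0]) auto
    qed
  qed
  define f where "f k z = ennreal (?E k z + K)" for k z
  define flim where "flim z = ennreal (exp (- Alim (fst z) (snd z)) * g (X (fst z) (snd z)))" for z
  have f_lim: "AE z in time_product T. flim z + ennreal K \<le> liminf (\<lambda>k. f k z)"
    using lim AE_space
  proof eventually_elim
    case (elim z)
    define r \<omega> where "r = fst z" and "\<omega> = snd z"
    have z: "\<omega> \<in> space M" "0 \<le> r" "r \<le> T"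
      using elim(2) by (auto simp: r_def \<omega>_def space_pair_measure space_restrict_space)
    note pl = path_limits[OF z, unfolded r_def \<omega>_def, OF elim(1)[THEN conjunct1]
        elim(1)[THEN conjunct2, THEN conjunct1] elim(1)[THEN conjunct2, THEN conjunct2], folded r_def \<omega>_def]
    have cont: "isCont h y" "isCont h' y" "isCont h'' y" for y
      using ucont[THEN uniformly_continuous_imp_continuous] by (auto simp: continuous_on_eq_continuous_at)
    have "(\<lambda>k. exp (- A k r \<omega>) * \<Gamma> (X r \<omega>) (V k r \<omega>) + K) \<longlonglongrightarrow> exp (- Alim r \<omega>) * \<Gamma> (X r \<omega>) (X r \<omega>) + K"
      unfolding \<Gamma>_def by (intro tendsto_intros pl isCont_tendsto_compose[OF cont(1)] isCont_tendsto_compose[OF cont(2)] isCont_tendsto_compose[OF cont(3)]) auto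
    then have "(\<lambda>k. exp (- A k r \<omega>) * \<Gamma> (clip k (X r \<omega>)) (V k r \<omega>) + K) \<longlonglongrightarrow> exp (- Alim r \<omega>) * \<Gamma> (X r \<omega>) (X r \<omega>) + K"
      by (rule Lim_transform_eventually) (use pl(3) in \<open>eventually_elim, simp\<close>)
    then have "(\<lambda>k. f k z) \<longlonglongrightarrow> ennreal (exp (- Alim r \<omega>) * \<Gamma> (X r \<omega>) (X r \<omega>) + K)"
      unfolding f_def r_def[symmetric] \<omega>_def[symmetric] by (rule tendsto_ennrealI)
    then have "liminf (\<lambda>k. f k z) = ennreal (exp (- Alim r \<omega>) * \<Gamma> (X r \<omega>) (X r \<omega>) + K)"
      by (rule lim_imp_Liminf[OF sequentially_bot])
    moreover have "exp (- Alim r \<omega>) * g (X r \<omega>) \<le> exp (- Alim r \<omega>) * \<Gamma> (X r \<omega>) (X r \<omega>)"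
      using g(3)[of "X r \<omega>"] unfolding \<Gamma>_def by (intro mult_left_mono) auto
    ultimately show ?case
      unfolding flim_def r_def[symmetric] \<omega>_def[symmetric]
      using g(2) K(1) by (simp add: ennreal_leI flip: ennreal_plus)
  qed
  have flim_m: "flim \<in> borel_measurable (time_product T)"
    using killed_measurable[OF \<kappa>(1) g(1) T0] unfolding flim_def Alim_def by measurable
  have "(\<integral>\<^sup>+z. flim z \<partial>time_product T) + ennreal (K * T) = (\<integral>\<^sup>+z. flim z + ennreal K \<partial>time_product T)"
    using flim_m K(1) T0 emeasure_time_product[OF T0] by (subst nn_integral_add) (auto simp: ennreal_mult)
  also have "\<dots> \<le> (\<integral>\<^sup>+z. liminf (\<lambda>k. f k z) \<partial>time_product T)"
    by (rule nn_integral_mono_AE[OF f_lim])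
  also have "\<dots> \<le> liminf (\<lambda>k. \<integral>\<^sup>+z. f k z \<partial>time_product T)"
    by (rule nn_integral_liminf) (use G_m in \<open>simp add: f_def\<close>)
  also have "\<dots> \<le> ennreal (h x + K * T)"
    by (rule order.trans[OF Liminf_le_Limsup[OF sequentially_bot] Limsup_bounded])
       (use bound_k in \<open>simp add: f_def\<close>)
  also have "\<dots> = ennreal (h x) + ennreal (K * T)"
    using hbound(1) K(1) T0 by simp
  \<comment> \<open>The constant \<open>K\<close> contributes \<open>K * T\<close> on both sides;
    being finite, it can be cancelled.\<close>
  finally have "(\<integral>\<^sup>+z. flim z \<partial>time_product T) \<le> ennreal (h x)"
    by (subst (asm) (1 2) add.commute) (simp add: ennreal_add_left_cancel_le)
  then show ?thesis unfolding flim_def Alim_def .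
qed

end

section \<open>Removing the killing\<close>

text \<open>The cube is the lowest integer power of the positive part that is twice continuously
  differentiable; the cutoff is built from it.\<close>

lemma DERIV_pos_part_cube: "((\<lambda>t::real. (max 0 t)^3) has_real_derivative 3 * (max 0 t)\<^sup>2) (at t)"
  and DERIV_pos_part_square: "((\<lambda>t::real. 3 * (max 0 t)\<^sup>2) has_real_derivative 6 * max 0 t) (at t)"
proof -
  have *: "((\<lambda>t::real. (max 0 t)^Suc (Suc n)) has_real_derivative of_nat (Suc (Suc n)) * (max 0 t)^Suc n) (at t)" for n :: nat and t :: real
  proof -
    consider "t < 0" | "0 < t" | "t = 0" by linarith
    then show ?thesis
    proof cases
      case 1
      have "((\<lambda>t::real. 0) has_real_derivative 0) (at t)" by simp
      then have "((\<lambda>t::real. (max 0 t)^Suc (Suc n)) has_real_derivative 0) (at t)"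
        by (rule has_field_derivative_transform_within_open[of _ _ _ "{..<0}"]) (use 1 in auto)
      then show ?thesis using 1 by simp
    next
      case 2
      have "((\<lambda>t::real. t^Suc (Suc n)) has_real_derivative of_nat (Suc (Suc n)) * t^Suc n) (at t)"
        using DERIV_pow[of "Suc (Suc n)" t] by simp
      then have "((\<lambda>t::real. (max 0 t)^Suc (Suc n)) has_real_derivative of_nat (Suc (Suc n)) * t^Suc n) (at t)"
        by (rule has_field_derivative_transform_within_open[of _ _ _ "{0<..}"]) (use 2 in auto)
      then show ?thesis using 2 by simp
    next
      case 3
      have "((\<lambda>h::real. (max 0 h)^Suc (Suc n) / h) \<longlongrightarrow> 0) (at 0)"
      proof (rule Lim_null_comparison)
        have "\<bar>(max 0 h)^Suc (Suc n) / h\<bar> \<le> \<bar>h\<bar>^Suc n" for h :: real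
        proof (cases "0 < h")
          case False
          then have "max 0 h = 0" by simp
          moreover have "0 \<le> \<bar>h\<bar>^Suc n" by (rule zero_le_power) simp
          ultimately show ?thesis by (simp del: power_Suc)
        qed (simp add: abs_mult power_abs)
        then show "\<forall>\<^sub>F h in at 0. norm ((max 0 h)^Suc (Suc n) / h) \<le> \<bar>h\<bar>^Suc n" by simp
        have "((\<lambda>h::real. \<bar>h\<bar>^Suc n) \<longlongrightarrow> \<bar>0\<bar>^Suc n) (at 0)" by (intro tendsto_intros)
        then show "((\<lambda>h::real. \<bar>h\<bar>^Suc n) \<longlongrightarrow> 0) (at 0)" by simp
      qed
      then show ?thesis using 3 by (simp add: DERIV_def)
    qed
  qed
  show "((\<lambda>t::real. (max 0 t)^3) has_real_derivative 3 * (max 0 t)\<^sup>2) (at t)"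
    using *[of 1 t] by (simp add: numeral_eq_Suc)
  show "((\<lambda>t::real. 3 * (max 0 t)\<^sup>2) has_real_derivative 6 * max 0 t) (at t)"
    using DERIV_cmult[OF *[of 0 t], of 3] by (simp add: numeral_eq_Suc mult.assoc[symmetric] del: mult_Suc_right)
qed

lemma C2_cutoff:
  fixes m :: real
  assumes m: "0 < m"
  obtains \<rho> \<rho>' \<rho>'' :: "real \<Rightarrow> real"
  where "\<And>y. (\<rho> has_real_derivative \<rho>' y) (at y)" "\<And>y. (\<rho>' has_real_derivative \<rho>'' y) (at y)"
    "continuous_on UNIV \<rho>''" "\<And>y. 0 \<le> \<rho> y"
    "\<And>y. \<bar>y\<bar> \<le> m \<Longrightarrow> \<rho> y = 1 \<and> \<rho>' y = 0 \<and> \<rho>'' y = 0"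
    "\<And>y. m + 1 \<le> \<bar>y\<bar> \<Longrightarrow> \<rho> y = 0 \<and> \<rho>' y = 0 \<and> \<rho>'' y = 0"
proof -
  define P P' P'' :: "real \<Rightarrow> real" where "P t = (max 0 t)^3" and "P' t = 3 * (max 0 t)\<^sup>2" and "P'' t = 6 * max 0 t" for t
  have P: "(P has_real_derivative P' t) (at t)" "(P' has_real_derivative P'' t) (at t)" for t
    using DERIV_pos_part_cube DERIV_pos_part_square unfolding P_def[abs_def] P'_def[abs_def] P''_def by auto
  define r r' r'' where "r y = P (y - m) + P (- y - m)" and "r' y = P' (y - m) - P' (- y - m)"
    and "r'' y = P'' (y - m) + P'' (- y - m)" for y
  have r: "(r has_real_derivative r' y) (at y)" "(r' has_real_derivative r'' y) (at y)" for y
    unfolding r_def[abs_def] r'_def[abs_def] r''_def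
    by (auto intro!: derivative_eq_intros DERIV_chain'[OF _ P(1)] DERIV_chain'[OF _ P(2)])
  \<comment> \<open>\<open>r\<close> vanishes where \<open>\<bar>y\<bar> \<le> m\<close> and is at
    least 1 where \<open>m + 1 \<le> \<bar>y\<bar>\<close>, so the cubed positive part of
    \<open>1 - r\<close> is 1 in the middle and 0 outside, and its first two derivatives vanish in
    both regions.\<close>
  define \<rho> \<rho>' \<rho>'' where "\<rho> y = P (1 - r y)" and "\<rho>' y = - (P' (1 - r y) * r' y)"
    and "\<rho>'' y = P'' (1 - r y) * r' y * r' y - P' (1 - r y) * r'' y" for y
  show thesis
  proof (rule that[of \<rho> \<rho>' \<rho>''])
    have 1: "((\<lambda>y. 1 - r y) has_real_derivative - r' y) (at y)" for y
      by (auto intro!: derivative_eq_intros r)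
    show "(\<rho> has_real_derivative \<rho>' y) (at y)" for y
      unfolding \<rho>_def[abs_def] \<rho>'_def by (rule DERIV_cong[OF DERIV_chain2[OF P(1) 1]]) simp
    show "(\<rho>' has_real_derivative \<rho>'' y) (at y)" for y
      unfolding \<rho>'_def[abs_def] \<rho>''_def
      by (rule DERIV_cong[OF DERIV_minus[OF DERIV_mult[OF DERIV_chain2[OF P(2) 1] r(2)]]]) (simp add: algebra_simps)
    have c: "continuous_on UNIV r" "continuous_on UNIV r'"
      using r by (auto simp: continuous_on_eq_continuous_at intro: DERIV_isCont)
    then show "continuous_on UNIV \<rho>''"
      unfolding \<rho>''_def[abs_def] P''_def P'_def r''_def by (intro continuous_intros)
    show "0 \<le> \<rho> y" for y by (simp add: \<rho>_def P_def)
    show "\<rho> y = 1 \<and> \<rho>' y = 0 \<and> \<rho>'' y = 0" if "\<bar>y\<bar> \<le> m" for y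
    proof -
      have "r y = 0" "r' y = 0" "r'' y = 0"
      proof -
        have "max 0 (y - m) = 0" "max 0 (- y - m) = 0" using that by auto
        then show "r y = 0" "r' y = 0" "r'' y = 0"
          by (auto simp: r_def r'_def r''_def P_def P'_def P''_def)
      qed
      then show ?thesis by (simp add: \<rho>_def \<rho>'_def \<rho>''_def P_def)
    qed
    show "\<rho> y = 0 \<and> \<rho>' y = 0 \<and> \<rho>'' y = 0" if "m + 1 \<le> \<bar>y\<bar>" for y
    proof -
      have "1 \<le> P t" if "1 \<le> t" for t using that one_le_power[of t 3] by (simp add: P_def max_def)
      moreover have "0 \<le> P t" for t by (simp add: P_def)
      ultimately have "1 \<le> r y"
        using that unfolding r_def by (cases "0 \<le> y") (smt (verit))+
      then show ?thesis by (simp add: \<rho>_def \<rho>'_def \<rho>''_def P_def P'_def P''_def)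
    qed
  qed
qed

text \<open>For \<open>k\<close> at least \<open>R\<close> such a function equals its composition
  with \<open>clip k\<close>, a map that does not increase distances and whose range is a compact
  interval, where continuity already gives a bound and uniform continuity.\<close>

lemma compact_support_uniformly_continuous:
  fixes f :: "real \<Rightarrow> real"
  assumes f: "continuous_on UNIV f" and z: "\<And>y. R \<le> \<bar>y\<bar> \<Longrightarrow> f y = 0"
  shows "uniformly_continuous_on UNIV f" and "\<exists>B. \<forall>y. \<bar>f y\<bar> \<le> B"
proof -
  obtain k where k: "R \<le> real k" using real_arch_simple by blast
  have eq: "f y = f (clip k y)" for y
    using k z[of y] z[of "clip k y"] by (cases "\<bar>y\<bar> \<le> real k") (auto simp: clip_eq clip_def)
  then show "\<exists>B. \<forall>y. \<bar>f y\<bar> \<le> B" using bounded_on_clip[OF f, of k] by metis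
  have "uniformly_continuous_on UNIV (\<lambda>y. f (clip k y))"
  proof (rule uniformly_continuous_on_compose[of UNIV "clip k" f, unfolded comp_def])
    show "uniformly_continuous_on UNIV (clip k)"
      unfolding uniformly_continuous_on_def dist_real_def clip_def by (auto intro!: exI)
    have "uniformly_continuous_on {- real k..real k} f"
      by (intro compact_uniformly_continuous continuous_on_subset[OF f]) auto
    moreover have "range (clip k) = {- real k..real k}"
    proof (rule antisym)
      show "{- real k..real k} \<subseteq> range (clip k)"
      proof
        fix y assume "y \<in> {- real k..real k}"
        then have "clip k y = y" by (intro clip_eq) auto
        then show "y \<in> range (clip k)" by (metis rangeI)
      qed
    qed (auto simp: clip_bounds)
    ultimately show "uniformly_continuous_on (range (clip k)) f" by simp
  qed
  moreover have "(\<lambda>y. f (clip k y)) = f" by (rule ext) (rule eq[symmetric])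
  ultimately show "uniformly_continuous_on UNIV f" by simp
qed

lemma uniformly_continuous_on_add_const:
  fixes f :: "real \<Rightarrow> real"
  shows "uniformly_continuous_on S f \<Longrightarrow> uniformly_continuous_on S (\<lambda>y. f y + c)"
  by (simp add: uniformly_continuous_on_def)

context diffusion
begin

text \<open>The killing rate \<open>m / \<epsilon>\<close> outside \<open>[-n, n]\<close> compensates the error made by cutting off \<open>u\<close>;
  as \<open>n\<close> grows the killing disappears, since paths are locally bounded.\<close>

lemma occupation_bound:
  fixes u u' u'' g :: "real \<Rightarrow> real"
  assumes u: "\<And>y. (u has_real_derivative u' y) (at y)" "\<And>y. (u' has_real_derivative u'' y) (at y)"
    and u'': "continuous_on UNIV u''" and u0: "\<And>y. 0 \<le> u y"
    and g: "g \<in> borel_measurable borel" "\<And>y. 0 \<le> g y" "\<And>y. R < \<bar>y\<bar> \<Longrightarrow> g y = 0"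
      "\<And>y. g y = - (u' y * b y + u'' y * (a y)\<^sup>2 / 2)"
    and T: "0 < T"
  shows "(\<integral>\<^sup>+z. ennreal (g (X (fst z) (snd z))) \<partial>time_product T) \<le> ennreal (u x)"
proof -
  have bound: "(\<integral>\<^sup>+z. ennreal (g (X (fst z) (snd z))) \<partial>time_product T) \<le> ennreal (u x) + ennreal \<epsilon>"
    if \<epsilon>: "0 < \<epsilon>" for \<epsilon> :: real
  proof -
    have killed: "\<exists>\<kappa>. continuous_on UNIV \<kappa> \<and> (\<forall>y. \<bar>y\<bar> \<le> real n \<longrightarrow> \<kappa> y = 0) \<and>
      (\<integral>\<^sup>+z. ennreal (exp (- (LBINT q:{0..fst z}. \<kappa> (X q (snd z)))) * g (X (fst z) (snd z))) \<partial>time_product T) \<le> ennreal (u x) + ennreal \<epsilon>"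
      if n: "R \<le> real n" "\<bar>x\<bar> \<le> real n" for n :: nat
    proof -
      \<comment> \<open>The cutoff starts only at radius \<open>n + 1\<close>: the killing rate is 0
        up to radius \<open>n\<close> and has full strength from \<open>n + 1\<close> on, and in
        between the test function must still coincide with \<open>u + \<epsilon>\<close>, whose
        generator is known.\<close>
      have "0 < real n + 1" by simp
      then obtain \<rho> \<rho>' \<rho>'' :: "real \<Rightarrow> real"
        where \<rho>: "\<And>y. (\<rho> has_real_derivative \<rho>' y) (at y)" "\<And>y. (\<rho>' has_real_derivative \<rho>'' y) (at y)"
          "continuous_on UNIV \<rho>''" "\<And>y. 0 \<le> \<rho> y"
          and \<rho>1: "\<And>y. \<bar>y\<bar> \<le> real n + 1 \<Longrightarrow> \<rho> y = 1 \<and> \<rho>' y = 0 \<and> \<rho>'' y = 0"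
          and \<rho>0: "\<And>y. real n + 1 + 1 \<le> \<bar>y\<bar> \<Longrightarrow> \<rho> y = 0 \<and> \<rho>' y = 0 \<and> \<rho>'' y = 0"
        using C2_cutoff[of "real n + 1"] by metis
      \<comment> \<open>The added \<open>\<epsilon>\<close> survives where the cutoff removes
        \<open>u\<close>. It makes \<open>B / (2 * \<epsilon>)\<close> an admissible
        \<open>L\<close>, and it lets a killing rate \<open>m / \<epsilon>\<close> outweigh a
        generator bounded by \<open>m\<close>.\<close>
      define h h' h'' where "h y = u y * \<rho> y + \<epsilon>" and "h' y = u' y * \<rho> y + u y * \<rho>' y"
        and "h'' y = u'' y * \<rho> y + 2 * u' y * \<rho>' y + u y * \<rho>'' y" for y
      have h: "(h has_real_derivative h' y) (at y)" "(h' has_real_derivative h'' y) (at y)" for y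
        unfolding h_def[abs_def] h'_def[abs_def] h''_def
        by (auto intro!: derivative_eq_intros u \<rho>)
      have cont: "continuous_on UNIV (\<lambda>y. u y * \<rho> y)" "continuous_on UNIV h'" "continuous_on UNIV h''"
      proof -
        have "continuous_on UNIV u" "continuous_on UNIV u'" "continuous_on UNIV \<rho>" "continuous_on UNIV \<rho>'"
          by (auto simp: continuous_on_eq_continuous_at
              intro: DERIV_isCont[OF u(1)] DERIV_isCont[OF u(2)] DERIV_isCont[OF \<rho>(1)] DERIV_isCont[OF \<rho>(2)])
        then show "continuous_on UNIV (\<lambda>y. u y * \<rho> y)" "continuous_on UNIV h'" "continuous_on UNIV h''"
          unfolding h'_def[abs_def] h''_def[abs_def] using u'' \<rho>(3) by (auto intro!: continuous_intros)
      qed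
      have supp: "u y * \<rho> y = 0" "h' y = 0" "h'' y = 0" if "real n + 1 + 1 \<le> \<bar>y\<bar>" for y
        using \<rho>0[OF that] by (auto simp: h'_def h''_def)
      note uc = compact_support_uniformly_continuous[OF cont(1) supp(1)]
        compact_support_uniformly_continuous[OF cont(2) supp(2)]
        compact_support_uniformly_continuous[OF cont(3) supp(3)]
      obtain B0 B1 B2 where B: "\<And>y. \<bar>u y * \<rho> y\<bar> \<le> B0" "\<And>y. \<bar>h' y\<bar> \<le> B1" "\<And>y. \<bar>h'' y\<bar> \<le> B2"
        using uc(2,4,6) by metis
      define B where "B = Max {B0 + \<epsilon>, B1, B2}"
      have BB: "B0 + \<epsilon> \<le> B" "B1 \<le> B" "B2 \<le> B" by (auto simp: B_def)
      have hb: "\<epsilon> \<le> h y" "h y \<le> B" "\<bar>h' y\<bar> \<le> B" "\<bar>h'' y\<bar> \<le> B" for y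
      proof -
        show "\<epsilon> \<le> h y" using u0[of y] \<rho>(4)[of y] by (simp add: h_def)
        show "h y \<le> B" using B(1)[of y] BB by (simp add: h_def)
        show "\<bar>h' y\<bar> \<le> B" "\<bar>h'' y\<bar> \<le> B" using B(2)[of y] B(3)[of y] BB by linarith+
      qed
      have B0: "0 \<le> B" using hb(3)[of 0] by linarith
      \<comment> \<open>\<open>m y\<close> bounds the generator with coefficients at
        \<open>y\<close> applied to \<open>h\<close> at an arbitrary other point, as needed when
        coefficients and test function are evaluated at different positions. \<open>\<theta>\<close>
        is a continuous ramp between the radii \<open>n\<close> and \<open>n + 1\<close>.\<close>
      define m where "m y = B * \<bar>b y\<bar> + B * (a y)\<^sup>2 / 2" for y
      define \<theta> where "\<theta> y = min 1 (max 0 (\<bar>y\<bar> - real n))" for y :: real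
      define \<kappa> where "\<kappa> y = m y / \<epsilon> * \<theta> y" for y
      have m0: "0 \<le> m y" for y using B0 by (simp add: m_def)
      have m_cont: "continuous_on UNIV m"
        unfolding m_def[abs_def] by (intro continuous_intros a_cont b_cont) auto
      have "continuous_on UNIV \<kappa>"
        unfolding \<kappa>_def[abs_def] \<theta>_def using \<epsilon> by (intro continuous_intros m_cont) auto
      have \<kappa>0: "0 \<le> \<kappa> y" for y using m0 \<epsilon> by (simp add: \<kappa>_def \<theta>_def)
      have gen: "\<bar>h' z * b y + h'' z * (a y)\<^sup>2 / 2\<bar> \<le> m y" for y z
      proof -
        have "\<bar>h' z * b y\<bar> \<le> B * \<bar>b y\<bar>" unfolding abs_mult using hb by (intro mult_right_mono) auto
        moreover have "\<bar>h'' z * (a y)\<^sup>2\<bar> \<le> B * (a y)\<^sup>2" unfolding abs_mult abs_power2 using hb by (intro mult_right_mono) auto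
        ultimately show ?thesis unfolding m_def by linarith
      qed
      have out: "m y \<le> \<kappa> y * h z" if "real n + 1 \<le> \<bar>y\<bar>" for y z
      proof -
        have "m y / \<epsilon> * \<epsilon> \<le> m y / \<epsilon> * h z" using hb(1) m0 \<epsilon> by (intro mult_left_mono) auto
        then show ?thesis using that \<epsilon> by (simp add: \<kappa>_def \<theta>_def)
      qed
      have \<kappa>h: "0 \<le> \<kappa> y * h z" for y z using \<kappa>0[of y] hb(1)[of z] \<epsilon> by simp
      \<comment> \<open>Beyond radius \<open>n + 1\<close> the killing term already exceeds
        \<open>m\<close>, so the lower bound is at stake only on a compact set, where
        \<open>m\<close> is bounded.\<close>
      obtain K where K: "\<And>y. \<bar>m (clip (n + 1) y)\<bar> \<le> K" using bounded_on_clip[OF m_cont] by blast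
      have K0: "0 \<le> K" using K[of 0] by linarith
      have "(\<integral>\<^sup>+z. ennreal (exp (- (LBINT q:{0..fst z}. \<kappa> (X q (snd z)))) * g (X (fst z) (snd z))) \<partial>time_product T) \<le> ennreal (h x)"
      proof (rule killed_occupation_bound[where h = h and h' = h' and h'' = h'' and B = B and L = "B / (2 * \<epsilon>)" and K = K])
        show "uniformly_continuous_on UNIV h" unfolding h_def by (rule uniformly_continuous_on_add_const[OF uc(1)])
        show "0 \<le> h y" for y using hb(1)[of y] \<epsilon> by simp
        show "\<bar>h'' y\<bar> \<le> 2 * (B / (2 * \<epsilon>)) * h y" for y
        proof -
          have "B / \<epsilon> * \<epsilon> \<le> B / \<epsilon> * h y" using hb(1) B0 \<epsilon> by (intro mult_left_mono) auto
          then show ?thesis using hb(4)[of y] \<epsilon> by simp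
        qed
        show "- K \<le> \<kappa> y * h z - h' z * b y - h'' z * (a y)\<^sup>2 / 2" for y z
        proof (cases "real n + 1 \<le> \<bar>y\<bar>")
          case True
          then show ?thesis using out[OF True, of z] gen[of z y] K0 by linarith
        next
          case False
          then have "clip (n + 1) y = y" by (intro clip_eq) auto
          then have "m y \<le> K" using K[of y] by simp
          then show ?thesis using \<kappa>h[of y z] gen[of z y] by linarith
        qed
        show "g y \<le> \<kappa> y * h y - h' y * b y - h'' y * (a y)\<^sup>2 / 2" for y
        proof (cases "real n + 1 \<le> \<bar>y\<bar>")
          case True
          then have "g y = 0" using g(3) n by simp
          then show ?thesis using out[OF True, of y] gen[of y y] by linarith
        next
          case False
          then have "h' y = u' y" "h'' y = u'' y" using \<rho>1[of y] by (auto simp: h'_def h''_def)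
          then show ?thesis using g(4)[of y] \<kappa>h[of y y] by simp
        qed
      qed (use h uc(3,5) hb \<kappa>0 K0 g(1,2) T B0 \<epsilon> \<open>continuous_on UNIV \<kappa>\<close> in auto)
      also have "h x = u x + \<epsilon>" using \<rho>1[of x] n by (simp add: h_def)
      finally show ?thesis
        using \<open>continuous_on UNIV \<kappa>\<close> u0 \<epsilon> by (intro exI[of _ \<kappa>]) (auto simp: \<kappa>_def \<theta>_def)
    qed
    \<comment> \<open>The starting point must lie where the cutoff equals 1, so that
      \<open>h x = u x + \<epsilon>\<close>, and \<open>g\<close> must vanish wherever the cutoff
      acts.\<close>
    obtain n0 :: nat where n0: "R \<le> real n0" "\<bar>x\<bar> \<le> real n0"
      using real_arch_simple[of "max R \<bar>x\<bar>"] by auto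
    have "\<exists>\<kappa>. \<forall>n\<ge>n0. continuous_on UNIV (\<kappa> n) \<and> (\<forall>y. \<bar>y\<bar> \<le> real n \<longrightarrow> \<kappa> n y = 0) \<and>
      (\<integral>\<^sup>+z. ennreal (exp (- (LBINT q:{0..fst z}. \<kappa> n (X q (snd z)))) * g (X (fst z) (snd z))) \<partial>time_product T) \<le> ennreal (u x) + ennreal \<epsilon>"
      using killed n0 by (intro choice allI) (meson of_nat_le_iff order.trans)
    then obtain \<kappa> where \<kappa>: "\<And>n. n0 \<le> n \<Longrightarrow> continuous_on UNIV (\<kappa> n)"
      "\<And>n y. n0 \<le> n \<Longrightarrow> \<bar>y\<bar> \<le> real n \<Longrightarrow> \<kappa> n y = 0"
      and \<kappa>_le: "\<And>n. n0 \<le> n \<Longrightarrow> (\<integral>\<^sup>+z. ennreal (exp (- (LBINT q:{0..fst z}. \<kappa> n (X q (snd z)))) * g (X (fst z) (snd z))) \<partial>time_product T) \<le> ennreal (u x) + ennreal \<epsilon>"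
      by blast
    define f where "f n z = ennreal (exp (- (LBINT q:{0..fst z}. \<kappa> (n + n0) (X q (snd z)))) * g (X (fst z) (snd z)))" for n z
    have f_m: "f n \<in> borel_measurable (time_product T)" for n
      unfolding f_def using killed_measurable[OF \<kappa>(1) g(1), of "n + n0" T] T by simp
    have "(\<integral>\<^sup>+z. ennreal (g (X (fst z) (snd z))) \<partial>time_product T) = (\<integral>\<^sup>+z. liminf (\<lambda>n. f n z) \<partial>time_product T)"
    proof (rule nn_integral_cong)
      fix z assume "z \<in> space (time_product T)"
      then have z: "snd z \<in> space M" "0 \<le> fst z" "fst z \<le> T"
        by (auto simp: space_pair_measure space_restrict_space)
      obtain k0 where k0: "\<And>k q. k0 \<le> k \<Longrightarrow> q \<in> {0..T} \<Longrightarrow> clip k (X q (snd z)) = X q (snd z)"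
        using X_locally_bounded[OF z(1), of T] by blast
      have "f n z = ennreal (g (X (fst z) (snd z)))" if "k0 \<le> n" for n
      proof -
        have "(LBINT q:{0..fst z}. \<kappa> (n + n0) (X q (snd z))) = (LBINT q:{0..fst z}. 0)"
        proof (rule LBINT_cong)
          fix q assume "q \<in> {0..fst z}"
          then have "clip (n + n0) (X q (snd z)) = X q (snd z)" using k0[of "n + n0" q] that z by auto
          then have "\<bar>X q (snd z)\<bar> \<le> real (n + n0)" using clip_bounds[of "n + n0" "X q (snd z)"] by simp
          then show "\<kappa> (n + n0) (X q (snd z)) = 0" by (intro \<kappa>(2)) auto
        qed
        then show ?thesis by (simp add: f_def)
      qed
      then have "(\<lambda>n. f n z) \<longlonglongrightarrow> ennreal (g (X (fst z) (snd z)))"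
        by (intro tendsto_eventually eventually_sequentiallyI[of k0])
      then show "ennreal (g (X (fst z) (snd z))) = liminf (\<lambda>n. f n z)"
        by (rule lim_imp_Liminf[OF sequentially_bot, symmetric])
    qed
    also have "\<dots> \<le> liminf (\<lambda>n. \<integral>\<^sup>+z. f n z \<partial>time_product T)"
      by (rule nn_integral_liminf[OF f_m])
    also have "\<dots> \<le> ennreal (u x) + ennreal \<epsilon>"
      by (rule order.trans[OF Liminf_le_Limsup[OF sequentially_bot] Limsup_bounded])
         (use \<kappa>_le in \<open>simp add: f_def\<close>)
    finally show ?thesis .
  qed
  then show ?thesis by (rule ennreal_le_epsilon)
qed

end

section \<open>Scale function and Green kernel\<close>

lemma DERIV_LBINT:
  fixes f :: "real \<Rightarrow> real" and c x :: real
  assumes f: "continuous_on UNIV f"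
  shows "((\<lambda>x. LBINT y=c..x. f y) has_real_derivative f x) (at x)"
proof -
  let ?A = "min c x - 1" and ?B = "max c x + 1"
  have "((\<lambda>u. LBINT y=c..u. f y) has_vector_derivative f x) (at x within {?A..?B})"
    by (rule interval_integral_FTC2) (auto intro: continuous_on_subset[OF f])
  moreover have "at x within {?A..?B} = at x"
    by (rule at_within_interior) auto
  ultimately show ?thesis by (simp add: has_real_derivative_iff_has_vector_derivative)
qed

lemma DERIV_left_tail:
  fixes q :: "real \<Rightarrow> real"
  assumes q: "continuous_on UNIV q" and i: "\<And>x. set_integrable lborel {..x} q"
  shows "((\<lambda>x. LBINT v:{..x}. q v) has_real_derivative q x) (at x)"
proof -
  define c where "c = x - 1"
  have "((\<lambda>y. (LBINT v:{..c}. q v) + (LBINT v=c..y. q v)) has_real_derivative q x) (at x)"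
    by (auto intro!: derivative_eq_intros DERIV_LBINT q)
  then show ?thesis
  proof (rule has_field_derivative_transform_within_open[of _ _ _ "{x - 1<..<x + 1}"])
    fix y assume "y \<in> {x - 1<..<x + 1}"
    then have y: "c \<le> y" by (auto simp: c_def)
    then have "{..y} = {..c} \<union> {c<..y}" by auto
    then have "(LBINT v:{..y}. q v) = (LBINT v:{..c}. q v) + (LBINT v:{c<..y}. q v)"
      by (simp only:) (intro set_integral_Un set_integrable_subset[OF i]; auto)
    then show "(LBINT v:{..c}. q v) + (LBINT v=c..y. q v) = (LBINT v:{..y}. q v)"
      using y by (simp add: interval_integral_Ioc)
  qed auto
qed

lemma DERIV_right_tail:
  fixes w :: "real \<Rightarrow> real"
  assumes w: "continuous_on UNIV w" and i: "\<And>x. set_integrable lborel {x..} w"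
  shows "((\<lambda>x. LBINT z:{x..}. w z) has_real_derivative - w x) (at x)"
proof -
  define c where "c = x + 1"
  have "((\<lambda>y. (LBINT v:{c<..}. w v) - (LBINT v=c..y. w v)) has_real_derivative - w x) (at x)"
    by (auto intro!: derivative_eq_intros DERIV_LBINT w)
  then show ?thesis
  proof (rule has_field_derivative_transform_within_open[of _ _ _ "{x - 1<..<x + 1}"])
    fix y assume "y \<in> {x - 1<..<x + 1}"
    then have y: "y \<le> c" by (auto simp: c_def)
    then have "{y..} = {y..c} \<union> {c<..}" by auto
    then have "(LBINT v:{y..}. w v) = (LBINT v:{y..c}. w v) + (LBINT v:{c<..}. w v)"
      by (simp only:) (intro set_integral_Un set_integrable_subset[OF i]; auto)
    moreover have "(LBINT v:{y..c}. w v) = - (LBINT v=c..y. w v)"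
      using y by (subst interval_integral_endpoints_reverse) (simp add: interval_integral_Icc)
    ultimately show "(LBINT v:{c<..}. w v) - (LBINT v=c..y. w v) = (LBINT z:{y..}. w z)"
      by simp
  qed auto
qed

lemma ennreal_set_LBINT:
  fixes f :: "real \<Rightarrow> real"
  assumes "set_integrable lborel A f" "\<And>x. 0 \<le> f x"
  shows "ennreal (LBINT x:A. f x) = (\<integral>\<^sup>+x\<in>A. ennreal (f x) \<partial>lborel)"
proof -
  have "ennreal (LBINT x:A. f x) = (\<integral>\<^sup>+x. ennreal (indicator A x *\<^sub>R f x) \<partial>lborel)"
    unfolding set_lebesgue_integral_def using assms
    by (intro nn_integral_eq_integral[symmetric]) (auto simp: set_integrable_def)
  also have "\<dots> = (\<integral>\<^sup>+x\<in>A. ennreal (f x) \<partial>lborel)"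
    by (intro nn_integral_cong) (auto simp: indicator_def)
  finally show ?thesis .
qed

locale scale_function =
  fixes a b :: "real \<Rightarrow> real"
  assumes a_cont: "continuous_on UNIV a" and b_cont: "continuous_on UNIV b" and a_nz: "a y \<noteq> 0"
begin

definition \<psi> :: "real \<Rightarrow> real" where "\<psi> = phi a b 0"

lemma ratio_cont: "continuous_on UNIV (\<lambda>u. b u / (a u)\<^sup>2)"
  by (intro continuous_intros a_cont b_cont) (simp add: a_nz)

lemma \<psi>_pos: "0 < \<psi> z"
  by (simp add: \<psi>_def phi_def)

text \<open>Additivity of the exponent separates the two variables: every kernel becomes a product,
  and its regularity reduces to that of \<open>\<psi>\<close>, the scale density normalised at
  0.\<close>

lemma phi_eq: "phi a b v z = \<psi> z / \<psi> v"
proof -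
  have "interval_lebesgue_integrable lborel (ereal (min 0 (min v z))) (ereal (max 0 (max v z))) (\<lambda>u. b u / (a u)\<^sup>2)"
    using ratio_cont by (intro interval_integrable_isCont) (auto simp: continuous_on_eq_continuous_at)
  then have "interval_lebesgue_integrable lborel (min (ereal 0) (min (ereal v) (ereal z))) (max (ereal 0) (max (ereal v) (ereal z))) (\<lambda>u. b u / (a u)\<^sup>2)"
    by (simp only: ereal_min[symmetric] ereal_max[symmetric])
  then have "(LBINT u=ereal 0..ereal v. b u / (a u)\<^sup>2) + (LBINT u=ereal v..ereal z. b u / (a u)\<^sup>2) = (LBINT u=ereal 0..ereal z. b u / (a u)\<^sup>2)"
    by (rule interval_integral_sum)
  then have "- 2 * (LBINT u=ereal v..ereal z. b u / (a u)\<^sup>2) =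
      - 2 * (LBINT u=ereal 0..ereal z. b u / (a u)\<^sup>2) - (- 2 * (LBINT u=ereal 0..ereal v. b u / (a u)\<^sup>2))" by simp
  then show ?thesis unfolding \<psi>_def phi_def exp_diff[symmetric] by simp
qed

lemma DERIV_\<psi>: "(\<psi> has_real_derivative - 2 * (b z / (a z)\<^sup>2) * \<psi> z) (at z)"
  unfolding \<psi>_def phi_def[abs_def]
  by (auto intro!: derivative_eq_intros DERIV_LBINT ratio_cont simp: field_simps)

lemma \<psi>_cont: "continuous_on UNIV \<psi>"
  using DERIV_\<psi> by (auto simp: continuous_on_eq_continuous_at intro: DERIV_isCont)

lemma scale_measurable [measurable]: "\<psi> \<in> borel_measurable borel" "a \<in> borel_measurable borel" "b \<in> borel_measurable borel"
  using \<psi>_cont a_cont b_cont by (auto intro: borel_measurable_continuous_onI)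

definition tail :: "real \<Rightarrow> ennreal" where
  "tail v = (\<integral>\<^sup>+z\<in>{v..}. ennreal (phi a b v z) \<partial>lborel)"

text \<open>The classical Green function: speed density \<open>2 / ((a v)^2 * \<psi> v)\<close>
  times the scale distance from \<open>max x v\<close> to \<open>+\<infinity>\<close>. Values in
  \<open>ennreal\<close> let it serve as a density before any finiteness is known.\<close>

definition green :: "real \<Rightarrow> real \<Rightarrow> ennreal" where
  "green x v = ennreal (2 / (a v)\<^sup>2) * (\<integral>\<^sup>+z\<in>{max x v..}. ennreal (phi a b v z) \<partial>lborel)"

lemma tail_measurable [measurable]: "tail \<in> borel_measurable borel"
  and green_measurable [measurable]: "green x \<in> borel_measurable borel"
proof -
  \<comment> \<open>The domain of integration depends on \<open>v\<close>; written as the indicator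
    of a closed set of pairs it is jointly measurable, so the parameter integral is
    measurable.\<close>
  have "(\<lambda>(v, z). ennreal (\<psi> z / \<psi> v) * indicator {u. fst u \<le> snd u} (v, z)) \<in> borel_measurable (borel \<Otimes>\<^sub>M lborel)"
    by measurable
  then have "(\<lambda>v. \<integral>\<^sup>+z. ennreal (\<psi> z / \<psi> v) * indicator {u. fst u \<le> snd u} (v, z) \<partial>lborel) \<in> borel_measurable borel"
    using lborel.borel_measurable_nn_integral by simp
  then show "tail \<in> borel_measurable borel"
    unfolding tail_def[abs_def] phi_eq
    by (rule measurable_cong[THEN iffD1, rotated]) (auto intro!: nn_integral_cong simp: indicator_def)
  have "(\<lambda>(v, z). ennreal (\<psi> z / \<psi> v) * indicator {u. max x (fst u) \<le> snd u} (v, z)) \<in> borel_measurable (borel \<Otimes>\<^sub>M lborel)"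
    by measurable
  then have "(\<lambda>v. \<integral>\<^sup>+z. ennreal (\<psi> z / \<psi> v) * indicator {u. max x (fst u) \<le> snd u} (v, z) \<partial>lborel) \<in> borel_measurable borel"
    using lborel.borel_measurable_nn_integral by simp
  then have [measurable]: "(\<lambda>v. \<integral>\<^sup>+z\<in>{max x v..}. ennreal (phi a b v z) \<partial>lborel) \<in> borel_measurable borel"
    unfolding phi_eq
    by (rule measurable_cong[THEN iffD1, rotated]) (auto intro!: nn_integral_cong simp: indicator_def)
  show "green x \<in> borel_measurable borel"
    unfolding green_def[abs_def] by measurable
qed

text \<open>\<open>Lim\<close> carries information only once a limit is known to exist. The partial
  integrals increase, so monotone convergence along the integers together with monotonicity in
  between provides it, finite or not.\<close>

lemma Phi_at_top_eq_tail: "e2ennreal (Phi_at_top a b v) = tail v" "Phi_at_top a b v = enn2ereal (tail v)"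
proof -
  have phi0: "0 \<le> phi a b v z" for z by (simp add: phi_def)
  have phi_cont: "continuous_on UNIV (phi a b v)"
    unfolding phi_eq[abs_def] using \<psi>_pos[of v] by (intro continuous_intros \<psi>_cont) auto
  define I where "I y = (\<integral>\<^sup>+z\<in>{v..y}. ennreal (phi a b v z) \<partial>lborel)" for y
  have phi_m [measurable]: "phi a b v \<in> borel_measurable borel"
    using phi_cont by (rule borel_measurable_continuous_onI)
  have Phi_I: "ereal (Phi a b v y) = enn2ereal (I y)" if "v \<le> y" for y
  proof -
    have "set_integrable lborel {v..y} (phi a b v)"
      by (rule borel_integrable_atLeastAtMost'[OF continuous_on_subset[OF phi_cont]]) auto
    from ennreal_set_LBINT[OF this phi0] have "ennreal (Phi a b v y) = I y"
      using that by (simp add: Phi_def interval_integral_Icc I_def)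
    moreover have "0 \<le> Phi a b v y"
      using that phi0 by (simp add: Phi_def interval_integral_Icc set_lebesgue_integral_def)
    ultimately show ?thesis by (simp flip: \<open>ennreal (Phi a b v y) = I y\<close>)
  qed
  have mono: "I y \<le> I y'" if "y \<le> y'" for y y'
    unfolding I_def using that by (intro nn_integral_mono) (auto simp: indicator_def)
  have "(I \<longlongrightarrow> tail v) at_top"
  proof (rule order_tendstoI)
    fix c assume "c < tail v"
    have "tail v = (\<integral>\<^sup>+z. (SUP n. ennreal (phi a b v z) * indicator {v..real n} z) \<partial>lborel)"
      unfolding tail_def
    proof (rule nn_integral_cong)
      fix z
      obtain n where n: "z \<le> real n" using real_arch_simple by blast
      show "ennreal (phi a b v z) * indicator {v..} z = (SUP n. ennreal (phi a b v z) * indicator {v..real n} z)"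
        by (rule antisym) (auto intro!: SUP_least SUP_upper2[of n] simp: indicator_def n)
    qed
    also have "\<dots> = (SUP n. I (real n))"
      unfolding I_def by (rule nn_integral_monotone_convergence_SUP) (auto simp: incseq_def le_fun_def indicator_def)
    finally obtain n where "c < I (real n)" using \<open>c < tail v\<close> by (auto simp: less_SUP_iff)
    then show "\<forall>\<^sub>F y in at_top. c < I y"
      using mono by (intro eventually_at_top_linorderI[of "real n"]) (auto intro: less_le_trans)
  next
    fix c assume c: "tail v < c"
    have "I y \<le> tail v" for y
      unfolding I_def tail_def by (intro nn_integral_mono) (auto simp: indicator_def)
    then have "I y < c" for y using c by (rule le_less_trans)
    then show "\<forall>\<^sub>F y in at_top. I y < c" by simp
  qed
  then have "((\<lambda>y. enn2ereal (I y)) \<longlongrightarrow> enn2ereal (tail v)) at_top"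
    using continuous_on_enn2ereal by (auto simp: continuous_on_def intro: filterlim_compose)
  then have "((\<lambda>y. ereal (Phi a b v y)) \<longlongrightarrow> enn2ereal (tail v)) at_top"
    by (rule Lim_transform_eventually) (auto intro!: eventually_at_top_linorderI[of v] simp: Phi_I)
  then show "Phi_at_top a b v = enn2ereal (tail v)"
    unfolding Phi_at_top_def by (intro tendsto_Lim) auto
  then show "e2ennreal (Phi_at_top a b v) = tail v" by simp
qed

text \<open>Split at \<open>v = x\<close>. For \<open>v \<ge> x\<close> the integral in
  \<open>green\<close> is \<open>tail v\<close>; for \<open>v < x\<close> the cocycle property takes
  out the factor \<open>phi a b v x\<close> and leaves \<open>tail x\<close>. These are the two
  summands of the bound, and the 2 in \<open>green\<close> is its leading factor.\<close>

lemma green_le_potential_bound: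
  assumes [measurable]: "f \<in> borel_measurable borel"
  shows "(\<integral>\<^sup>+v. ennreal \<bar>f v\<bar> * green x v \<partial>lborel) \<le> potential_bound a b f"
proof -
  have [measurable]: "(\<lambda>u. phi a b u x) \<in> borel_measurable borel" unfolding phi_eq by measurable
  define P1 P2 where "P1 v = ennreal (\<bar>f v\<bar> / (a v)\<^sup>2) * tail v * indicator {x..} v"
    and "P2 v = ennreal (\<bar>f v\<bar> / (a v)\<^sup>2 * phi a b v x) * indicator {..x} v" for v
  have phi0: "0 \<le> phi a b u z" for u z by (simp add: phi_def)
  have "ennreal \<bar>f v\<bar> * green x v \<le> 2 * (P1 v + tail x * P2 v)" for v
  proof (cases "x \<le> v")
    case True
    then have "ennreal \<bar>f v\<bar> * green x v = (ennreal \<bar>f v\<bar> * ennreal (2 / (a v)\<^sup>2)) * tail v"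
      by (simp add: green_def tail_def max_def mult.assoc)
    also have "ennreal \<bar>f v\<bar> * ennreal (2 / (a v)\<^sup>2) = 2 * ennreal (\<bar>f v\<bar> / (a v)\<^sup>2)"
      by (simp add: ennreal_mult[symmetric] mult.commute flip: ennreal_numeral)
    finally show ?thesis using True by (simp add: P1_def mult.assoc distrib_left)
  next
    case False
    have "(\<integral>\<^sup>+z\<in>{x..}. ennreal (phi a b v z) \<partial>lborel) = (\<integral>\<^sup>+z. ennreal (phi a b v x) * (ennreal (phi a b x z) * indicator {x..} z) \<partial>lborel)"
      using \<psi>_pos by (intro nn_integral_cong) (simp add: phi_eq ennreal_mult[symmetric] mult.assoc[symmetric] less_imp_le less_imp_neq[symmetric])
    also have "\<dots> = ennreal (phi a b v x) * tail x"
      unfolding tail_def phi_eq by (rule nn_integral_cmult) measurable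
    finally have "ennreal \<bar>f v\<bar> * green x v = (ennreal \<bar>f v\<bar> * ennreal (2 / (a v)\<^sup>2) * ennreal (phi a b v x)) * tail x"
      using False by (simp add: green_def max_def mult.assoc)
    also have "ennreal \<bar>f v\<bar> * ennreal (2 / (a v)\<^sup>2) * ennreal (phi a b v x) = 2 * ennreal (\<bar>f v\<bar> / (a v)\<^sup>2 * phi a b v x)"
      using phi0 by (simp add: ennreal_mult[symmetric] ac_simps flip: ennreal_numeral)
    finally show ?thesis using False by (simp add: P2_def P1_def ac_simps)
  qed
  then have "(\<integral>\<^sup>+v. ennreal \<bar>f v\<bar> * green x v \<partial>lborel) \<le> (\<integral>\<^sup>+v. 2 * (P1 v + tail x * P2 v) \<partial>lborel)"
    by (intro nn_integral_mono)
  also have "\<dots> = 2 * ((\<integral>\<^sup>+v. P1 v \<partial>lborel) + tail x * (\<integral>\<^sup>+v. P2 v \<partial>lborel))"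
    unfolding P1_def P2_def by (simp add: nn_integral_cmult nn_integral_add)
  also have "\<dots> \<le> potential_bound a b f"
    unfolding potential_bound_def Phi_at_top_eq_tail P1_def P2_def
    by (intro mult_left_mono SUP_upper2[of x]) auto
  finally show ?thesis .
qed

text \<open>Variation of constants. With \<open>w = - u'\<close> the equation is linear of first
  order, \<open>w' = 2 * g / a^2 - 2 * (b / a^2) * w\<close>, with integrating factor
  \<open>1 / \<psi>\<close>. Integrating from \<open>-\<infinity>\<close> for \<open>w\<close>, and
  then from \<open>x\<close> to \<open>+\<infinity>\<close> for \<open>u\<close>, gives a
  nonnegative solution that is constant to the left of the support of \<open>g\<close> and vanishes
  at \<open>+\<infinity>\<close>; Fubini's theorem turns the double integral into the Green
  potential.\<close>

lemma green_solution:
  fixes g :: "real \<Rightarrow> real"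
  assumes g: "continuous_on UNIV g" "\<And>y. 0 \<le> g y" "\<And>y. R < \<bar>y\<bar> \<Longrightarrow> g y = 0" and fin: "tail 0 < \<infinity>"
  obtains u u' u'' :: "real \<Rightarrow> real"
  where "\<And>y. (u has_real_derivative u' y) (at y)" "\<And>y. (u' has_real_derivative u'' y) (at y)"
    "continuous_on UNIV u''" "\<And>y. 0 \<le> u y" "\<And>y. g y = - (u' y * b y + u'' y * (a y)\<^sup>2 / 2)"
    "\<And>x. ennreal (u x) = (\<integral>\<^sup>+v. ennreal (g v) * green x v \<partial>lborel)"
proof -
  have [measurable]: "g \<in> borel_measurable borel" using g(1) by (rule borel_measurable_continuous_onI)
  define q where "q v = g v / ((a v)\<^sup>2 * \<psi> v)" for v
  have q_cont: "continuous_on UNIV q"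
    unfolding q_def[abs_def] using \<psi>_pos by (intro continuous_intros g a_cont \<psi>_cont) (simp add: a_nz less_imp_neq[symmetric])
  have q0: "0 \<le> q v" for v using g(2)[of v] \<psi>_pos[of v] by (simp add: q_def)
  have q_i: "integrable lborel q"
  proof -
    have "set_integrable lborel {- R..R} q"
      by (rule borel_integrable_atLeastAtMost'[OF continuous_on_subset[OF q_cont]]) auto
    moreover have "(\<lambda>v. indicator {- R..R} v *\<^sub>R q v) = q"
    proof
      fix v show "indicator {- R..R} v *\<^sub>R q v = q v"
        using g(3)[of v] by (cases "\<bar>v\<bar> \<le> R") (auto simp: indicator_def q_def)
    qed
    ultimately show ?thesis by (simp add: set_integrable_def)
  qed
  have q_si: "set_integrable lborel {..x} q" for x
    unfolding set_integrable_def by (rule integrable_mult_indicator[OF _ q_i]) simp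
  define I where "I z = (LBINT v:{..z}. q v)" for z
  have DI: "(I has_real_derivative q z) (at z)" for z
    unfolding I_def by (rule DERIV_left_tail[OF q_cont q_si])
  have I0: "0 \<le> I z" for z unfolding I_def set_lebesgue_integral_def using q0 by simp
  have I_le: "I z \<le> integral\<^sup>L lborel q" for z
    unfolding I_def set_lebesgue_integral_def
    by (rule integral_mono) (use q_i q_si[of z] q0 in \<open>auto simp: set_integrable_def indicator_def\<close>)
  define C where "C = integral\<^sup>L lborel q"
  have I_nn: "ennreal (I z) = (\<integral>\<^sup>+v\<in>{..z}. ennreal (q v) \<partial>lborel)" for z
    unfolding I_def by (rule ennreal_set_LBINT[OF q_si q0])
  define w where "w z = 2 * \<psi> z * I z" for z
  define w' where "w' z = 2 * g z / (a z)\<^sup>2 - 2 * (b z / (a z)\<^sup>2) * w z" for z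
  have w0: "0 \<le> w z" for z using I0[of z] \<psi>_pos[of z] by (simp add: w_def)
  have Dw: "(w has_real_derivative w' z) (at z)" for z
  proof -
    have "(w has_real_derivative 2 * (- 2 * (b z / (a z)\<^sup>2) * \<psi> z) * I z + 2 * \<psi> z * q z) (at z)"
      unfolding w_def[abs_def] by (auto intro!: derivative_eq_intros DERIV_\<psi> DI)
    moreover have "2 * \<psi> z * q z = 2 * g z / (a z)\<^sup>2" using \<psi>_pos[of z] by (simp add: q_def)
    ultimately show ?thesis by (simp add: w'_def w_def algebra_simps)
  qed
  have w_cont: "continuous_on UNIV w"
    using Dw by (auto simp: continuous_on_eq_continuous_at intro: DERIV_isCont)
  have [measurable]: "w \<in> borel_measurable borel" using w_cont by (rule borel_measurable_continuous_onI)
  \<comment> \<open>On the right half-line \<open>w\<close> is at most a constant times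
    \<open>\<psi>\<close>, which is integrable there because \<open>tail 0\<close> is finite; on
    compact intervals continuity suffices.\<close>
  have w_si: "set_integrable lborel {x..} w" for x
  proof -
    have "(\<integral>\<^sup>+z\<in>{0..}. ennreal (w z) \<partial>lborel) \<le> (\<integral>\<^sup>+z. ennreal (2 * C) * (ennreal (phi a b 0 z) * indicator {0..} z) \<partial>lborel)"
    proof (intro nn_integral_mono)
      fix z :: real
      have "w z \<le> 2 * C * phi a b 0 z"
        unfolding w_def \<psi>_def[symmetric] using I_le[of z] \<psi>_pos[of z] by (simp add: C_def)
      moreover have "0 \<le> 2 * C" using order.trans[OF I0 I_le] by (simp add: C_def)
      ultimately show "ennreal (w z) * indicator {0..} z \<le> ennreal (2 * C) * (ennreal (phi a b 0 z) * indicator {0..} z)"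
        by (auto simp: indicator_def ennreal_mult'[symmetric] intro!: ennreal_leI)
    qed
    also have "\<dots> = ennreal (2 * C) * tail 0"
      unfolding tail_def phi_eq by (rule nn_integral_cmult) measurable
    also have "\<dots> < \<infinity>" using fin by (simp add: ennreal_mult_less_top)
    finally have "(\<integral>\<^sup>+z. ennreal (norm (indicator {0..} z *\<^sub>R w z)) \<partial>lborel) < \<infinity>"
      by (rule le_less_trans[rotated]) (auto intro!: nn_integral_mono simp: indicator_def w0)
    then have 1: "set_integrable lborel {0..} w"
      unfolding set_integrable_def by (intro integrableI_bounded) auto
    have 2: "set_integrable lborel {x..0} w"
      by (rule borel_integrable_atLeastAtMost'[OF continuous_on_subset[OF w_cont]]) auto
    show ?thesis
      by (rule set_integrable_subset[OF set_integrable_Un[OF 2 1]]) auto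
  qed
  define u where "u x = (LBINT z:{x..}. w z)" for x
  show thesis
  proof (rule that[of u "\<lambda>y. - w y" "\<lambda>y. - w' y"])
    show "(u has_real_derivative - w y) (at y)" for y
      unfolding u_def by (rule DERIV_right_tail[OF w_cont w_si])
    show "((\<lambda>y. - w y) has_real_derivative - w' y) (at y)" for y by (intro DERIV_minus Dw)
    show "continuous_on UNIV (\<lambda>y. - w' y)"
      unfolding w'_def[abs_def] by (intro continuous_intros g a_cont b_cont w_cont) (simp_all add: a_nz)
    show "0 \<le> u y" for y unfolding u_def set_lebesgue_integral_def using w0 by simp
    show "g y = - (- w y * b y + - w' y * (a y)\<^sup>2 / 2)" for y
      using a_nz[of y] by (simp add: w'_def field_simps)
    fix x
    \<comment> \<open>The single condition \<open>max x v \<le> z\<close> encodes both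
      \<open>x \<le> z\<close> and \<open>v \<le> z\<close>, so exchanging the integrals leaves
      exactly the domain used in \<open>green\<close>.\<close>
    let ?k = "\<lambda>v z. ennreal (2 * \<psi> z) * ennreal (q v) * indicator {u. max x (fst u) \<le> snd u} (v, z)"
    have "ennreal (u x) = (\<integral>\<^sup>+z\<in>{x..}. ennreal (w z) \<partial>lborel)"
      unfolding u_def by (rule ennreal_set_LBINT[OF w_si w0])
    also have "\<dots> = (\<integral>\<^sup>+z. (\<integral>\<^sup>+v. ?k v z \<partial>lborel) \<partial>lborel)"
    proof (intro nn_integral_cong)
      fix z
      have "ennreal (w z) * indicator {x..} z = (ennreal (2 * \<psi> z) * indicator {x..} z) * ennreal (I z)"
        using \<psi>_pos[of z] I0[of z] by (simp add: w_def ennreal_mult[symmetric] indicator_def)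
      also have "\<dots> = (\<integral>\<^sup>+v. (ennreal (2 * \<psi> z) * indicator {x..} z) * (ennreal (q v) * indicator {..z} v) \<partial>lborel)"
        unfolding I_nn using borel_measurable_continuous_onI[OF q_cont] by (subst nn_integral_cmult) auto
      also have "\<dots> = (\<integral>\<^sup>+v. ?k v z \<partial>lborel)"
        by (intro nn_integral_cong) (auto simp: indicator_def)
      finally show "ennreal (w z) * indicator {x..} z = (\<integral>\<^sup>+v. ?k v z \<partial>lborel)" .
    qed
    also have "\<dots> = (\<integral>\<^sup>+v. (\<integral>\<^sup>+z. ?k v z \<partial>lborel) \<partial>lborel)"
    proof (rule lborel_pair.Fubini')
      have [measurable]: "q \<in> borel_measurable borel" using q_cont by (rule borel_measurable_continuous_onI)
      show "(\<lambda>(v, z). ?k v z) \<in> borel_measurable (lborel \<Otimes>\<^sub>M lborel)"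
        by measurable
    qed
    also have "\<dots> = (\<integral>\<^sup>+v. ennreal (g v) * green x v \<partial>lborel)"
    proof (intro nn_integral_cong)
      fix v
      have "(\<integral>\<^sup>+z. ?k v z \<partial>lborel)
        = (\<integral>\<^sup>+z. (ennreal (g v) * ennreal (2 / (a v)\<^sup>2)) * (ennreal (phi a b v z) * indicator {max x v..} z) \<partial>lborel)"
      proof (intro nn_integral_cong)
        fix z
        have "ennreal (2 * \<psi> z) * ennreal (q v) = ennreal (2 * \<psi> z * q v)"
          using \<psi>_pos[of z] q0[of v] by (simp add: ennreal_mult)
        also have "2 * \<psi> z * q v = g v * (2 / (a v)\<^sup>2) * phi a b v z"
          by (simp add: q_def phi_eq)
        also have "ennreal \<dots> = ennreal (g v) * ennreal (2 / (a v)\<^sup>2) * ennreal (phi a b v z)"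
        proof -
          have d: "0 \<le> 2 / (a v)\<^sup>2" and p: "0 \<le> phi a b v z" by (simp_all add: phi_def)
          show ?thesis
            by (simp only: ennreal_mult[OF mult_nonneg_nonneg[OF g(2) d] p] ennreal_mult[OF g(2) d])
        qed
        finally show "?k v z
          = (ennreal (g v) * ennreal (2 / (a v)\<^sup>2)) * (ennreal (phi a b v z) * indicator {max x v..} z)"
          by (simp add: indicator_def)
      qed
      also have "\<dots> = (ennreal (g v) * ennreal (2 / (a v)\<^sup>2)) * (\<integral>\<^sup>+z\<in>{max x v..}. ennreal (phi a b v z) \<partial>lborel)"
        unfolding phi_eq by (rule nn_integral_cmult) measurable
      finally show "(\<integral>\<^sup>+z. ?k v z \<partial>lborel) = ennreal (g v) * green x v"
        by (simp add: green_def mult.assoc)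
    qed
    finally show "ennreal (u x) = (\<integral>\<^sup>+v. ennreal (g v) * green x v \<partial>lborel)" .
  qed
qed

end

section \<open>Comparison of the occupation measure with the Green measure\<close>

text \<open>Continuous functions of compact support decrease to the indicator of a compact set, and
  inner regularity of the finite measure \<open>\<mu>\<close> extends the comparison to Borel sets.
  The measure \<open>\<nu>\<close> may be infinite: finiteness on the test functions is enough for
  dominated convergence.\<close>

lemma measure_le_if_compactly_supported_le:
  fixes \<mu> \<nu> :: "real measure"
  assumes sets: "sets \<mu> = sets borel" "sets \<nu> = sets borel" and fin: "emeasure \<mu> (space \<mu>) \<noteq> \<infinity>"
    and le: "\<And>g R. continuous_on UNIV g \<Longrightarrow> (\<And>y. 0 \<le> g y) \<Longrightarrow> (\<And>y. R < \<bar>y\<bar> \<Longrightarrow> g y = 0) \<Longrightarrow>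
      (\<integral>\<^sup>+y. ennreal (g y) \<partial>\<mu>) \<le> (\<integral>\<^sup>+y. ennreal (g y) \<partial>\<nu>) \<and> (\<integral>\<^sup>+y. ennreal (g y) \<partial>\<nu>) < \<infinity>"
  shows "\<mu> \<le> \<nu>"
proof -
  have compact_le: "emeasure \<mu> K \<le> emeasure \<nu> K" if K: "compact K" for K
  proof (cases "K = {}")
    case False
    \<comment> \<open>Tents of width \<open>1 / (j + 1)\<close> around \<open>K\<close>; thanks to
      \<open>Suc j\<close> the first one already vanishes at distance 1 from \<open>K\<close>, and
      it dominates all the others.\<close>
    define g where "g j y = max 0 (1 - real (Suc j) * infdist y K)" for j y
    have g_cont: "continuous_on UNIV (g j)" for j
      unfolding g_def by (intro continuous_intros)
    have g0: "0 \<le> g j y" for j y by (simp add: g_def)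
    have Kc: "closed K" using K by (rule compact_imp_closed)
    obtain R where R: "\<And>k. k \<in> K \<Longrightarrow> \<bar>k\<bar> \<le> R"
      using compact_imp_bounded[OF K] by (auto simp: bounded_iff)
    have g_supp: "g j y = 0" if y: "R + 1 < \<bar>y\<bar>" for j y
    proof -
      obtain k where k: "k \<in> K" "infdist y K = dist y k"
        using infdist_attains_inf[OF Kc False] by metis
      have "1 \<le> infdist y K" using k(2) R[OF k(1)] y by (simp add: dist_real_def)
      then have "1 * 1 \<le> real (Suc j) * infdist y K" by (intro mult_mono) auto
      then show ?thesis by (simp add: g_def)
    qed
    have g_le: "(\<integral>\<^sup>+y. ennreal (g j y) \<partial>\<mu>) \<le> (\<integral>\<^sup>+y. ennreal (g j y) \<partial>\<nu>)"
      and g_fin: "(\<integral>\<^sup>+y. ennreal (g j y) \<partial>\<nu>) < \<infinity>" for j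
      using le[of "g j" "R + 1"] g_cont g0 g_supp by blast+
    have m: "(\<lambda>y. ennreal (g j y)) \<in> borel_measurable \<nu>" for j
      using borel_measurable_continuous_onI[OF g_cont[of j]] by (simp add: measurable_cong_sets[OF sets(2) refl])
    have lim: "(\<lambda>j. \<integral>\<^sup>+y. ennreal (g j y) \<partial>\<nu>) \<longlonglongrightarrow> (\<integral>\<^sup>+y. indicator K y \<partial>\<nu>)"
    proof (rule nn_integral_dominated_convergence[where w = "\<lambda>y. ennreal (g 0 y)"])
      show "indicator K \<in> borel_measurable \<nu>" using Kc sets by (intro borel_measurable_indicator) auto
      show "(\<integral>\<^sup>+y. ennreal (g 0 y) \<partial>\<nu>) < \<infinity>"
        by (rule g_fin)
      show "AE y in \<nu>. ennreal (g j y) \<le> ennreal (g 0 y)" for j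
      proof (intro AE_I2 ennreal_leI)
        fix y
        have "1 * infdist y K \<le> real (Suc j) * infdist y K" by (intro mult_right_mono) (auto simp: infdist_nonneg)
        then show "g j y \<le> g 0 y" by (auto simp: g_def)
      qed
      show "AE y in \<nu>. (\<lambda>j. ennreal (g j y)) \<longlonglongrightarrow> indicator K y"
      proof (rule AE_I2)
        fix y
        show "(\<lambda>j. ennreal (g j y)) \<longlonglongrightarrow> indicator K y"
        proof (cases "y \<in> K")
          case True
          then show ?thesis by (simp add: g_def infdist_zero)
        next
          case False
          then have pos: "0 < infdist y K"
            using in_closed_iff_infdist_zero[OF Kc \<open>K \<noteq> {}\<close>, of y] infdist_nonneg[of y K] by linarith
          obtain j0 where j0: "1 / infdist y K \<le> real j0" using real_arch_simple by blast
          have "g j y = 0" if "j0 \<le> j" for j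
          proof -
            have "1 / infdist y K \<le> real (Suc j)" using j0 that by simp
            then have "1 \<le> real (Suc j) * infdist y K" using pos by (simp only: pos_divide_le_eq)
            then show ?thesis by (simp add: g_def)
          qed
          then show ?thesis
            using False by (intro tendsto_eventually eventually_sequentiallyI[of j0]) simp
        qed
      qed
    qed (use m in auto)
    have "emeasure \<mu> K \<le> (\<integral>\<^sup>+y. ennreal (g j y) \<partial>\<nu>)" for j
    proof -
      have "emeasure \<mu> K = (\<integral>\<^sup>+y. indicator K y \<partial>\<mu>)" using Kc sets by simp
      also have "\<dots> \<le> (\<integral>\<^sup>+y. ennreal (g j y) \<partial>\<mu>)"
        by (intro nn_integral_mono) (auto simp: indicator_def g_def infdist_zero)
      also have "\<dots> \<le> (\<integral>\<^sup>+y. ennreal (g j y) \<partial>\<nu>)" by (rule g_le)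
      finally show ?thesis .
    qed
    then have "emeasure \<mu> K \<le> (\<integral>\<^sup>+y. indicator K y \<partial>\<nu>)"
      by (intro LIMSEQ_le_const[OF lim]) auto
    then show ?thesis using Kc sets by simp
  qed simp
  have "emeasure \<mu> B \<le> emeasure \<nu> B" if B: "B \<in> sets borel" for B
    unfolding inner_regular[OF sets(1) fin B]
  proof (rule SUP_least)
    fix K assume K: "K \<in> {K. K \<subseteq> B \<and> compact K}"
    then have "emeasure \<mu> K \<le> emeasure \<nu> K" by (intro compact_le) auto
    also have "\<dots> \<le> emeasure \<nu> B" using K B sets by (intro emeasure_mono) auto
    finally show "emeasure \<mu> K \<le> emeasure \<nu> B" .
  qed
  then show ?thesis using sets by (simp add: le_measure)
qed

section \<open>From the occupation measure to the functional on the half-line\<close>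

context diffusion
begin

text \<open>The product with Lebesgue measure contains negative times, at which nothing is known
  about \<open>X\<close>; the indicator removes them.\<close>

lemma X_joint_measurable:
  "(\<lambda>z. indicator {0..} (fst z) * X (fst z) (snd z)) \<in> borel_measurable (borel \<Otimes>\<^sub>M M)"
proof (rule borel_measurable_LIMSEQ_real)
  show "(\<lambda>z. indicator {0..real n} (fst z) * X (fst z) (snd z)) \<in> borel_measurable (borel \<Otimes>\<^sub>M M)" for n
    using measurable_pair_F_M[OF _ progressive_indicator[OF X_progressive], of "real n"] by (simp add: case_prod_beta)
  fix z :: "real \<times> 'a"
  obtain n0 where n0: "fst z \<le> real n0" using real_arch_simple by blast
  then have "indicator {0..real n} (fst z) = (indicator {0..} (fst z) :: real)" if "n0 \<le> n" for n
    using that by (auto simp: indicator_def)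
  then show "(\<lambda>n. indicator {0..real n} (fst z) * X (fst z) (snd z)) \<longlonglongrightarrow> indicator {0..} (fst z) * X (fst z) (snd z)"
    by (intro tendsto_eventually eventually_sequentiallyI[of n0]) simp
qed

lemma functional_joint_measurable:
  fixes f :: "real \<Rightarrow> real"
  assumes [measurable]: "f \<in> borel_measurable borel"
  shows "(\<lambda>z. indicator {0..} (fst z) * f (X (fst z) (snd z))) \<in> borel_measurable (borel \<Otimes>\<^sub>M M)"
proof -
  note [measurable] = X_joint_measurable
  have "(\<lambda>z. indicator {0..} (fst z) * f (indicator {0..} (fst z) * X (fst z) (snd z))) \<in> borel_measurable (borel \<Otimes>\<^sub>M M)"
    by measurable
  moreover have "(\<lambda>z. indicator {0..} (fst z) * f (indicator {0..} (fst z) * X (fst z) (snd z))) = (\<lambda>z. indicator {0..} (fst z) * f (X (fst z) (snd z)))"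
    by (auto simp: indicator_def fun_eq_iff)
  ultimately show ?thesis by simp
qed

lemma occupation_le_green:
  assumes a_nz: "\<And>y. a y \<noteq> 0" and fin: "Phi_at_top a b 0 < \<infinity>"
    and f: "f \<in> borel_measurable borel" and T: "0 < T"
  shows "(\<integral>\<^sup>+z. ennreal \<bar>f (X (fst z) (snd z))\<bar> \<partial>time_product T) \<le> potential_bound a b f"
proof -
  interpret scale_function a b by unfold_locales (use a_cont b_cont a_nz in auto)
  have tail0: "tail 0 < \<infinity>" using fin unfolding Phi_at_top_eq_tail by (simp add: less_top)
  have X_m [measurable]: "(\<lambda>z. X (fst z) (snd z)) \<in> borel_measurable (time_product T)"
    using progressive_time_product[OF X_progressive, of T] T by (simp add: case_prod_beta)
  \<comment> \<open>\<open>\<mu>\<close> is the expected occupation measure up to time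
    \<open>T\<close>; its total mass \<open>T\<close> gives the finiteness that inner regularity
    asks for.\<close>
  define \<mu> where "\<mu> = distr (time_product T) borel (\<lambda>z. X (fst z) (snd z))"
  define \<nu> where "\<nu> = density lborel (green x)"
  have "\<mu> \<le> \<nu>"
  proof (rule measure_le_if_compactly_supported_le)
    show "sets \<mu> = sets borel" "sets \<nu> = sets borel" by (simp_all add: \<mu>_def \<nu>_def)
    have "emeasure \<mu> (space \<mu>) = emeasure (time_product T) (space (time_product T))"
      by (simp add: \<mu>_def emeasure_distr)
    then show "emeasure \<mu> (space \<mu>) \<noteq> \<infinity>" using emeasure_time_product[of T] T by simp
    fix g :: "real \<Rightarrow> real" and R
    assume g: "continuous_on UNIV g" "\<And>y. 0 \<le> g y" "\<And>y. R < \<bar>y\<bar> \<Longrightarrow> g y = 0"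
    have g_m [measurable]: "g \<in> borel_measurable borel" using g(1) by (rule borel_measurable_continuous_onI)
    obtain u u' u'' where u: "\<And>y. (u has_real_derivative u' y) (at y)" "\<And>y. (u' has_real_derivative u'' y) (at y)"
      "continuous_on UNIV u''" "\<And>y. 0 \<le> u y" "\<And>y. g y = - (u' y * b y + u'' y * (a y)\<^sup>2 / 2)"
      and ux: "\<And>x. ennreal (u x) = (\<integral>\<^sup>+v. ennreal (g v) * green x v \<partial>lborel)"
      by (rule green_solution[of g R, OF g(1) g(2) _ tail0]) (rule g(3), assumption, rule that, assumption+)
    have \<nu>_eq: "(\<integral>\<^sup>+y. ennreal (g y) \<partial>\<nu>) = ennreal (u x)"
      unfolding \<nu>_def ux by (subst nn_integral_density) (auto simp: mult.commute)
    have "(\<integral>\<^sup>+y. ennreal (g y) \<partial>\<mu>) = (\<integral>\<^sup>+z. ennreal (g (X (fst z) (snd z))) \<partial>time_product T)"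
      unfolding \<mu>_def by (subst nn_integral_distr) auto
    also have "\<dots> \<le> ennreal (u x)"
      by (rule occupation_bound[where R = R, OF u(1-4) g_m g(2) _ u(5) T]) (rule g(3))
    finally show "(\<integral>\<^sup>+y. ennreal (g y) \<partial>\<mu>) \<le> (\<integral>\<^sup>+y. ennreal (g y) \<partial>\<nu>) \<and> (\<integral>\<^sup>+y. ennreal (g y) \<partial>\<nu>) < \<infinity>"
      by (simp add: \<nu>_eq)
  qed
  have "(\<integral>\<^sup>+z. ennreal \<bar>f (X (fst z) (snd z))\<bar> \<partial>time_product T) = (\<integral>\<^sup>+y. ennreal \<bar>f y\<bar> \<partial>\<mu>)"
    unfolding \<mu>_def using f by (subst nn_integral_distr) auto
  also have "\<dots> \<le> (\<integral>\<^sup>+y. ennreal \<bar>f y\<bar> \<partial>\<nu>)"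
    by (rule nn_integral_mono_measure) (use \<open>\<mu> \<le> \<nu>\<close> in \<open>simp_all add: \<mu>_def \<nu>_def\<close>)
  also have "\<dots> = (\<integral>\<^sup>+v. ennreal \<bar>f v\<bar> * green x v \<partial>lborel)"
    unfolding \<nu>_def using f by (subst nn_integral_density) (auto simp: mult.commute)
  also have "\<dots> \<le> potential_bound a b f" by (rule green_le_potential_bound[OF f])
  finally show ?thesis .
qed

lemma expected_functional_le:
  assumes a_nz: "\<And>y. a y \<noteq> 0" and fin: "Phi_at_top a b 0 < \<infinity>"
    and f [measurable]: "f \<in> borel_measurable borel"
  shows "(\<integral>\<^sup>+\<omega>. (\<integral>\<^sup>+s\<in>{0..}. ennreal \<bar>f (X s \<omega>)\<bar> \<partial>lborel) \<partial>M) \<le> potential_bound a b f"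
proof -
  \<comment> \<open>The successor keeps every horizon positive, as the bound on a finite horizon
    requires.\<close>
  define T where "T n = real (Suc n)" for n
  define j where "j n \<omega> = (\<integral>\<^sup>+s\<in>{0..T n}. ennreal \<bar>f (X s \<omega>)\<bar> \<partial>lborel)" for n \<omega>
  have jm: "j n \<in> borel_measurable M" and j_le: "(\<integral>\<^sup>+\<omega>. j n \<omega> \<partial>M) \<le> potential_bound a b f" for n
  proof -
    interpret P: pair_sigma_finite "restrict_space lborel {0..T n}" M by (rule pair_sigma_finite_time)
    have T: "0 < T n" by (simp add: T_def)
    have m [measurable]: "(\<lambda>z. ennreal \<bar>f (X (fst z) (snd z))\<bar>) \<in> borel_measurable (time_product (T n))"
    proof -
      have [measurable]: "(\<lambda>z. X (fst z) (snd z)) \<in> borel_measurable (time_product (T n))"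
        using progressive_time_product[OF X_progressive, of "T n"] T by (simp add: case_prod_beta)
      show ?thesis by measurable
    qed
    have j_eq: "j n \<omega> = (\<integral>\<^sup>+s. ennreal \<bar>f (X s \<omega>)\<bar> \<partial>restrict_space lborel {0..T n})" for \<omega>
      unfolding j_def by (subst nn_integral_restrict_space) auto
    show "j n \<in> borel_measurable M"
    proof -
      have "(\<lambda>(\<omega>, s). ennreal \<bar>f (X s \<omega>)\<bar>) \<in> borel_measurable (M \<Otimes>\<^sub>M restrict_space lborel {0..T n})"
        using measurable_compose[OF measurable_pair_swap' m] by (simp add: case_prod_beta)
      from P.M1.borel_measurable_nn_integral[OF this] show ?thesis
        unfolding j_eq[abs_def] by simp
    qed
    have "(\<integral>\<^sup>+\<omega>. j n \<omega> \<partial>M) = (\<integral>\<^sup>+z. ennreal \<bar>f (X (fst z) (snd z))\<bar> \<partial>time_product (T n))"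
      using P.nn_integral_snd[OF m] unfolding j_eq by simp
    also have "\<dots> \<le> potential_bound a b f" by (rule occupation_le_green[OF a_nz fin f T])
    finally show "(\<integral>\<^sup>+\<omega>. j n \<omega> \<partial>M) \<le> potential_bound a b f" .
  qed
  have j_SUP: "(\<integral>\<^sup>+s\<in>{0..}. ennreal \<bar>f (X s \<omega>)\<bar> \<partial>lborel) = (SUP n. j n \<omega>)" if \<omega>: "\<omega> \<in> space M" for \<omega>
  proof -
    have "(\<lambda>s. (\<lambda>z. indicator {0..} (fst z) * f (X (fst z) (snd z))) (s, \<omega>)) \<in> borel_measurable borel"
      by (rule measurable_compose[OF measurable_Pair2'[OF \<omega>] functional_joint_measurable[OF f]])
    then have [measurable]: "(\<lambda>s. indicator {0..} s * f (X s \<omega>)) \<in> borel_measurable borel" by simp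
    have eq: "ennreal \<bar>f (X s \<omega>)\<bar> * indicator {0..T n} s = ennreal \<bar>indicator {0..} s * f (X s \<omega>)\<bar> * indicator {0..T n} s" for s n
      by (auto simp: indicator_def)
    have "(\<integral>\<^sup>+s\<in>{0..}. ennreal \<bar>f (X s \<omega>)\<bar> \<partial>lborel) = (\<integral>\<^sup>+s. (SUP n. ennreal \<bar>f (X s \<omega>)\<bar> * indicator {0..T n} s) \<partial>lborel)"
    proof (rule nn_integral_cong)
      fix s :: real
      obtain n where "s \<le> real n" using real_arch_simple by blast
      then have n: "s \<le> T n" by (simp add: T_def)
      show "ennreal \<bar>f (X s \<omega>)\<bar> * indicator {0..} s = (SUP n. ennreal \<bar>f (X s \<omega>)\<bar> * indicator {0..T n} s)"
        by (rule antisym) (auto intro!: SUP_least SUP_upper2[of n] simp: indicator_def n)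
    qed
    also have "\<dots> = (SUP n. \<integral>\<^sup>+s\<in>{0..T n}. ennreal \<bar>f (X s \<omega>)\<bar> \<partial>lborel)"
    proof (rule nn_integral_monotone_convergence_SUP)
      show "incseq (\<lambda>n s. ennreal \<bar>f (X s \<omega>)\<bar> * indicator {0..T n} s)"
        by (auto simp: incseq_def le_fun_def indicator_def T_def)
      show "(\<lambda>s. ennreal \<bar>f (X s \<omega>)\<bar> * indicator {0..T n} s) \<in> borel_measurable lborel" for n
        unfolding eq by measurable
    qed
    finally show ?thesis by (simp add: j_def)
  qed
  have "(\<integral>\<^sup>+\<omega>. (\<integral>\<^sup>+s\<in>{0..}. ennreal \<bar>f (X s \<omega>)\<bar> \<partial>lborel) \<partial>M) = (\<integral>\<^sup>+\<omega>. (SUP n. j n \<omega>) \<partial>M)"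
    by (intro nn_integral_cong j_SUP)
  also have "\<dots> = (SUP n. \<integral>\<^sup>+\<omega>. j n \<omega> \<partial>M)"
  proof (rule nn_integral_monotone_convergence_SUP[OF _ jm])
    show "incseq j"
      by (auto simp: incseq_def le_fun_def j_def T_def indicator_def intro!: nn_integral_mono)
  qed
  also have "\<dots> \<le> potential_bound a b f" by (intro SUP_least j_le)
  finally show ?thesis .
qed

text \<open>Everything follows from the bound on the mean of the integral of
  \<open>\<bar>f\<bar>\<close> along the path: a variable with finite mean is almost surely finite,
  which gives convergence on almost every path, and it dominates \<open>J_infty\<close>.\<close>

lemma functional_integrable:
  assumes a_nz: "\<And>y. a y \<noteq> 0" and fin: "Phi_at_top a b 0 < \<infinity>"
    and f [measurable]: "f \<in> borel_measurable borel" and P0: "potential_bound a b f < \<infinity>"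
  shows "AE \<omega> in M. set_integrable lborel {0..} (\<lambda>s. f (X s \<omega>))"
    and "integrable M (J_infty f X)"
    and "ereal (\<integral>\<omega>. J_infty f X \<omega> \<partial>M) \<le> enn2ereal (potential_bound a b f)"
proof -
  note m [measurable] = functional_joint_measurable[OF f]
  define j where "j \<omega> = (\<integral>\<^sup>+s\<in>{0..}. ennreal \<bar>f (X s \<omega>)\<bar> \<partial>lborel)" for \<omega>
  have j_eq: "j \<omega> = (\<integral>\<^sup>+s. ennreal (norm (indicator {0..} s *\<^sub>R f (X s \<omega>))) \<partial>lborel)" for \<omega>
    unfolding j_def by (intro nn_integral_cong) (auto simp: indicator_def)
  have swap: "(\<lambda>(\<omega>, s). indicator {0..} s *\<^sub>R f (X s \<omega>)) \<in> borel_measurable (M \<Otimes>\<^sub>M lborel)"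
    using measurable_compose[OF measurable_pair_swap' m] by (simp add: case_prod_beta)
  have "(\<lambda>(\<omega>, s). ennreal (norm (indicator {0..} s *\<^sub>R f (X s \<omega>)))) \<in> borel_measurable (M \<Otimes>\<^sub>M lborel)"
    using swap by (simp add: case_prod_beta)
  then have jm: "j \<in> borel_measurable M"
    unfolding j_eq[abs_def] using lborel.borel_measurable_nn_integral by simp
  have J_m: "J_infty f X \<in> borel_measurable M"
    unfolding J_infty_def[abs_def] set_lebesgue_integral_def
    by (rule lborel.borel_measurable_lebesgue_integral[OF swap])
  have j_le: "(\<integral>\<^sup>+\<omega>. j \<omega> \<partial>M) \<le> potential_bound a b f"
    unfolding j_def by (rule expected_functional_le[OF a_nz fin f])
  have section_m: "(\<lambda>s. indicator {0..} s *\<^sub>R f (X s \<omega>)) \<in> borel_measurable lborel" if "\<omega> \<in> space M" for \<omega>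
    using measurable_compose[OF measurable_Pair1'[OF that] swap] by simp
  have "AE \<omega> in M. j \<omega> \<noteq> \<infinity>"
    using j_le P0 by (intro nn_integral_PInf_AE[OF jm]) auto
  with AE_space show "AE \<omega> in M. set_integrable lborel {0..} (\<lambda>s. f (X s \<omega>))"
  proof eventually_elim
    case (elim \<omega>)
    then show ?case
      unfolding set_integrable_def j_eq
      by (intro integrableI_bounded section_m) (auto simp: less_top)
  qed
  \<comment> \<open>If the path integral does not converge absolutely, \<open>J_infty\<close> takes
    the default value 0 and the bound is trivial, so it holds for every path without
    exception.\<close>
  have J_j: "ennreal (norm (J_infty f X \<omega>)) \<le> j \<omega>" for \<omega>
  proof (cases "set_integrable lborel {0..} (\<lambda>s. f (X s \<omega>))")
    case True
    then show ?thesis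
      unfolding J_infty_def j_eq set_lebesgue_integral_def set_integrable_def by (rule integral_norm_bound_ennreal)
  next
    case False
    then show ?thesis
      by (simp add: J_infty_def set_lebesgue_integral_def set_integrable_def not_integrable_integral_eq)
  qed
  have nJ: "(\<integral>\<^sup>+\<omega>. ennreal (norm (J_infty f X \<omega>)) \<partial>M) \<le> potential_bound a b f"
    by (rule order.trans[OF nn_integral_mono j_le]) (rule J_j)
  show J_i: "integrable M (J_infty f X)"
    by (rule integrableI_bounded[OF J_m]) (use nJ P0 in \<open>auto intro: le_less_trans\<close>)
  have "ennreal (norm (\<integral>\<omega>. J_infty f X \<omega> \<partial>M)) \<le> potential_bound a b f"
    by (rule order.trans[OF integral_norm_bound_ennreal[OF J_i] nJ])
  then have "enn2ereal (ennreal \<bar>\<integral>\<omega>. J_infty f X \<omega> \<partial>M\<bar>) \<le> enn2ereal (potential_bound a b f)"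
    by (simp add: less_eq_ennreal.rep_eq)
  then have "ereal \<bar>\<integral>\<omega>. J_infty f X \<omega> \<partial>M\<bar> \<le> enn2ereal (potential_bound a b f)" by simp
  then show "ereal (\<integral>\<omega>. J_infty f X \<omega> \<partial>M) \<le> enn2ereal (potential_bound a b f)"
    by (rule order.trans[rotated]) simp
qed

end

theorem theorem5:
  fixes M :: "'a measure" and F :: "real \<Rightarrow> 'a measure" and W :: "real \<Rightarrow> 'a \<Rightarrow> real"
    and X :: "real \<Rightarrow> real \<Rightarrow> 'a \<Rightarrow> real"
    and a b f :: "real \<Rightarrow> real"
  assumes "complete_filtered_prob_space M F"
    and "wiener_process M F W"
    and "continuous_on UNIV a" and "continuous_on UNIV b" and "\<And>x. a x \<noteq> 0"
    and "\<And>x. sde_solution M F W a b x (X x)"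
    and "Phi_at_top a b 0 < \<infinity>" and "Phi_at_bot a b 0 = - \<infinity>"
    and "f \<in> borel_measurable borel"
    and "locally_integrable f" and "locally_integrable (\<lambda>u. f u / (a u)\<^sup>2)"
    and "potential_bound a b f < \<infinity>"
  shows "has_bounded_potential M X f \<and> potential M X f \<le> enn2ereal (potential_bound a b f)"
proof -
  have diff: "diffusion M F W a b x (X x)" for x
    using assms(1-6) by (intro diffusion.intro filtered_wiener.intro diffusion_axioms.intro)
  note int = diffusion.functional_integrable[OF diff assms(5,7,9,12)]
  \<comment> \<open>The supremum over starting points is already inside
    \<open>potential_bound\<close>, so one constant bounds every term.\<close>
  have le: "potential M X f \<le> enn2ereal (potential_bound a b f)"
    unfolding potential_def by (intro SUP_least int(3))
  moreover have "enn2ereal (potential_bound a b f) < \<infinity>"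
    using assms(12) by (simp add: less_top)
  ultimately have "potential M X f < \<infinity>" by (rule le_less_trans)
  then show ?thesis using int(1,2) le by (auto simp: has_bounded_potential_def)
qed

end
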